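(* Under the standing setup, assume that $a(x)$ is a (positive) multiple of the identity for a.a. $x$ and that $b\in\mathcal M$ is a multiple of the identity; identify these with scalars $a(x),b\ge\alpha$. Then for almost all $x_0\in\Omega$, \[ \delta J(a;b,x_0,B(0,1))=-\nabla y(x_0)\cdot\nabla p(x_0)\,\frac{a(x_0)\,d}{b+a(x_0)(d-1)}\,(b-a(x_0)). \]
   Context: Standing setup: $\Omega\subset\mathbb R^d$ bounded domain, $\alpha>0$, $y_d,f\in L^2(\Omega)$; $\mathcal M:=\{A\in\mathbb R^{d\times d}:\xi^TA\xi\ge\alpha|\xi|^2\ \forall\xi\}$, $\mathcal A:=\{a\in L^\infty(\Omega;\mathbb R^{d\times d}):a(x)\in\mathcal M\text{ a.e.}\}$. Fix $a\in\mathcal A$; $y\in H^1_0(\Omega)$ solves $\int_\Omega a\nabla y\cdot\nabla v=\int_\Omega fv$, $p\in H^1_0(\Omega)$ solves $\int_\Omega a\nabla v\cdot\nabla p=\int_\Omega(y-y_d)v$, for all $v\in H^1_0(\Omega)$; $J(a):=\frac12\|y-y_d\|^2_{L^2(\Omega)}$. For $\omega\subset\mathbb R^d$ open bounded with $0\in\omega$: $a_r:=a+\chi_{x_0+r\omega}(b-a)$ and $\delta J(a;b,x_0,\omega):=\lim_{r\searrow0}\frac{J(a_r)-J(a)}{r^d|\omega|}$. *)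

theory Defs
  imports "HOL-Analysis.Analysis"
begin

definition pderiv_dir :: "'a::euclidean_space \<Rightarrow> ('a \<Rightarrow> real) \<Rightarrow> ('a \<Rightarrow> real)" where
  "pderiv_dir i f = (\<lambda>x. frechet_derivative f (at x) i)"

definition grad :: "('a::euclidean_space \<Rightarrow> real) \<Rightarrow> 'a \<Rightarrow> 'a" where
  "grad f x = (\<Sum>i\<in>Basis. frechet_derivative f (at x) i *\<^sub>R i)"

definition smooth_fun :: "('a::euclidean_space \<Rightarrow> real) \<Rightarrow> bool" where
  "smooth_fun f \<longleftrightarrow> (\<forall>is. set is \<subseteq> Basis \<longrightarrow>
      (\<forall>x. foldr pderiv_dir is f differentiable (at x)))"

definition test_fun :: "'a::euclidean_space set \<Rightarrow> ('a \<Rightarrow> real) \<Rightarrow> bool" where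
  "test_fun \<Omega> \<phi> \<longleftrightarrow> smooth_fun \<phi> \<and> compact (closure {x. \<phi> x \<noteq> 0})
      \<and> closure {x. \<phi> x \<noteq> 0} \<subseteq> \<Omega>"

definition L2 :: "'a::euclidean_space set \<Rightarrow> ('a \<Rightarrow> real) \<Rightarrow> bool" where
  "L2 \<Omega> u \<longleftrightarrow> u \<in> borel_measurable (lebesgue_on \<Omega>)
      \<and> integrable (lebesgue_on \<Omega>) (\<lambda>x. (u x)^2)"

text \<open>H10 Omega u G: u belongs to H^1_0(Omega) (closure of C_c^infinity(Omega) in the H^1 norm)
  and G is its weak gradient.\<close>
definition H10 :: "'a::euclidean_space set \<Rightarrow> ('a \<Rightarrow> real) \<Rightarrow> ('a \<Rightarrow> 'a) \<Rightarrow> bool" where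
  "H10 \<Omega> u G \<longleftrightarrow> L2 \<Omega> u \<and> G \<in> borel_measurable (lebesgue_on \<Omega>)
      \<and> integrable (lebesgue_on \<Omega>) (\<lambda>x. (norm (G x))^2)
      \<and> (\<exists>\<phi>. (\<forall>n. test_fun \<Omega> (\<phi> n))
           \<and> (\<lambda>n. integral\<^sup>L (lebesgue_on \<Omega>) (\<lambda>x. (\<phi> n x - u x)^2)) \<longlonglongrightarrow> 0
           \<and> (\<lambda>n. integral\<^sup>L (lebesgue_on \<Omega>) (\<lambda>x. (norm (grad (\<phi> n) x - G x))^2)) \<longlonglongrightarrow> 0)"

text \<open>Weak solution y (with gradient Gy) in H^1_0 of  -div(c grad y) = g, for scalar coefficient c
  (i.e. matrix coefficient c(x) times the identity).\<close>
definition weak_sol :: "'a::euclidean_space set \<Rightarrow> ('a \<Rightarrow> real) \<Rightarrow> ('a \<Rightarrow> real)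
     \<Rightarrow> ('a \<Rightarrow> real) \<Rightarrow> ('a \<Rightarrow> 'a) \<Rightarrow> bool" where
  "weak_sol \<Omega> c g y Gy \<longleftrightarrow> H10 \<Omega> y Gy \<and>
     (\<forall>v Gv. H10 \<Omega> v Gv \<longrightarrow>
        integral\<^sup>L (lebesgue_on \<Omega>) (\<lambda>x. c x * (Gy x \<bullet> Gv x))
        = integral\<^sup>L (lebesgue_on \<Omega>) (\<lambda>x. g x * v x))"

text \<open>Scalar coefficient c is admissible: c times identity lies in the class A
  (measurable, essentially bounded, c(x) \<ge> alpha a.e.).\<close>
definition admissible :: "'a::euclidean_space set \<Rightarrow> real \<Rightarrow> ('a \<Rightarrow> real) \<Rightarrow> bool" where
  "admissible \<Omega> \<alpha> c \<longleftrightarrow> c \<in> borel_measurable (lebesgue_on \<Omega>)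
     \<and> (\<exists>M. AE x in lebesgue_on \<Omega>. \<bar>c x\<bar> \<le> M)
     \<and> (AE x in lebesgue_on \<Omega>. \<alpha> \<le> c x)"

text \<open>Cost functional J(c) = 1/2 ||y_c - y_d||^2, y_c the (a.e. unique) state.\<close>
definition Jfun :: "'a::euclidean_space set \<Rightarrow> ('a \<Rightarrow> real) \<Rightarrow> ('a \<Rightarrow> real)
     \<Rightarrow> ('a \<Rightarrow> real) \<Rightarrow> real" where
  "Jfun \<Omega> f yd c = (THE j. \<exists>y Gy. weak_sol \<Omega> c f y Gy
       \<and> j = 1/2 * integral\<^sup>L (lebesgue_on \<Omega>) (\<lambda>x. (y x - yd x)^2))"

definition pert :: "('a::euclidean_space \<Rightarrow> real) \<Rightarrow> real \<Rightarrow> 'a \<Rightarrow> 'a set \<Rightarrow> real \<Rightarrow> 'a \<Rightarrow> real" where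
  "pert a b x0 \<omega> r = (\<lambda>x. a x + indicator ((\<lambda>z. x0 + r *\<^sub>R z) ` \<omega>) x * (b - a x))"

end

theory Submission
  imports Defs
begin

text \<open>Let \<open>y\<^sub>r\<close> be the state for the perturbed coefficient and \<open>w = y\<^sub>r - y\<close>. Testing with the adjoint state,
  \<open>J(a\<^sub>r) - J(a) = - \<integral>\<^bsub>B(x0,r)\<^esub> (b - a) grad y\<^sub>r \<bullet> grad p + \<parallel>w\<parallel>\<^sup>2 / 2\<close>.
  At a Lebesgue point \<open>x0\<close> of \<open>a\<close>, \<open>grad y\<close>, \<open>grad p\<close> the energy estimate gives
  \<open>\<parallel>grad w\<parallel>\<^sup>2 = O(r\<^sup>d)\<close>. The rescaled \<open>w\<close> tends weakly to zero (test with solutions of the unperturbed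
  equation, whose energy on shrinking balls vanishes), so compactness makes \<open>\<parallel>w\<parallel>\<^sup>2 = o(r\<^sup>d)\<close>.
  The mean of \<open>grad w \<bullet> grad p(x0)\<close> over the ball comes from testing the equation of \<open>w\<close> with the explicit
  corrector \<open>(e \<bullet> z) \<Phi>(|z|\<^sup>2 / r\<^sup>2)\<close>, \<open>z = x - x0\<close>, \<open>e = grad p(x0)\<close>, where \<open>\<Phi>(s)\<close> is a smooth
  approximation of \<open>min 1 (s powr (-d/2))\<close>: up to small errors its Laplacian is the distribution
  \<open>d * \<partial>\<^sub>e\<close> of the indicator function of the ball.\<close>

section \<open>Smooth functions\<close>

text \<open>The usual route identifies the limit of the rescaled \<open>w\<close> by solving a
  transmission problem on the whole space. Here one number suffices: with \<open>X\<close> and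
  \<open>J\<close> the integrals over the ball of the \<open>e\<close>-components of
  \<open>grad w\<close> and \<open>grad y\<close>, and \<delta> = b - a(x0), one test function
  yields (d a(x0) + \<delta>) X + \<delta> J = small, and d a(x0) + \<delta> = b + a(x0)(d-1) is the
  denominator of the formula. Three obstacles shape the rest. The coefficient is only bounded and
  measurable, so freezing it at x0 costs its L2 oscillation near x0; the test function therefore
  needs a scale-invariant gradient bound and compact support. \<open>H10\<close> is a closure of
  smooth functions, so the profile is smoothed rather than kinked at the sphere; this leaves an
  error of relative size sqrt \<epsilon>, which can be sent to 0 after r because \<open>X\<close>
  does not depend on \<epsilon>. Finally, the Poincare inequality bounds the squared L2 norm of
  \<open>w\<close> only by O(r^d), the order of the main term itself, which is why compactness has
  to enter.\<close>

fun Ck :: "nat \<Rightarrow> ('a::euclidean_space \<Rightarrow> real) \<Rightarrow> bool" where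
  "Ck 0 f = True"
| "Ck (Suc n) f = ((\<forall>x. f differentiable (at x)) \<and> (\<forall>i\<in>Basis. Ck n (pderiv_dir i f)))"

lemma pderiv_dir_eq:
  assumes "\<And>x. (f has_derivative f' x) (at x)"
  shows "pderiv_dir i f = (\<lambda>x. f' x i)"
  using frechet_derivative_at[OF assms] by (simp add: pderiv_dir_def fun_eq_iff)

lemma smooth_fun_differentiable: "smooth_fun f \<Longrightarrow> f differentiable (at x)"
  unfolding smooth_fun_def by (metis foldr.simps(1) id_apply list.set(1) empty_subsetI)

lemma smooth_fun_pderiv:
  assumes "smooth_fun f" "i \<in> Basis"
  shows "smooth_fun (pderiv_dir i f)"
proof -
  have "foldr pderiv_dir is (pderiv_dir i f) differentiable (at x)" if "set is \<subseteq> Basis" for "is" x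
  proof -
    have "foldr pderiv_dir (is @ [i]) f differentiable (at x)"
      using assms that unfolding smooth_fun_def by (metis Un_insert_right insert_subset list.simps(15) set_append sup_bot.right_neutral list.set(1))
    then show ?thesis by simp
  qed
  then show ?thesis by (auto simp: smooth_fun_def)
qed

text \<open>\<open>smooth_fun\<close> quantifies over lists of directions, which is awkward for
  closure rules; \<open>Ck\<close> peels off one derivative at a time, so sums, products and
  compositions go by induction on \<open>n\<close>. \<open>foldr\<close> applies the last direction
  of a list first, hence the reverse induction.\<close>

lemma smooth_fun_iff_Ck: "smooth_fun f \<longleftrightarrow> (\<forall>n. Ck n f)"
proof
  assume "smooth_fun f"
  have "smooth_fun g \<Longrightarrow> Ck n g" for n and g :: "'a \<Rightarrow> real"
    by (induction n arbitrary: g) (auto simp: smooth_fun_differentiable smooth_fun_pderiv)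
  with \<open>smooth_fun f\<close> show "\<forall>n. Ck n f" by blast
next
  assume *: "\<forall>n. Ck n f"
  have "\<forall>n. Ck n g \<Longrightarrow> set is \<subseteq> Basis \<Longrightarrow> foldr pderiv_dir is g differentiable (at x)" for "is" x and g :: "'a \<Rightarrow> real"
  proof (induction "is" arbitrary: g rule: rev_induct)
    case Nil
    then have "Ck (Suc 0) g" by blast
    then show ?case by simp
  next
    case (snoc i "is")
    have "Ck n (pderiv_dir i g)" for n
      using snoc.prems(1)[rule_format, of "Suc n"] snoc.prems(2) by simp
    then show ?case using snoc.IH[of "pderiv_dir i g"] snoc.prems(2) by simp
  qed
  with * show "smooth_fun f" by (auto simp: smooth_fun_def)
qed

lemma Ck_SucD: "Ck (Suc n) f \<Longrightarrow> Ck n f"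
  by (induction n arbitrary: f) (auto)

lemma Ck_SucI:
  assumes "\<And>x. (f has_derivative f' x) (at x)" "\<And>i. i \<in> Basis \<Longrightarrow> Ck n (\<lambda>x. f' x i)"
  shows "Ck (Suc n) f"
  using assms(2) pderiv_dir_eq[OF assms(1)] assms(1) by (auto simp: differentiable_def)

lemma has_derivative_frechet: "Ck (Suc n) f \<Longrightarrow> (f has_derivative frechet_derivative f (at x)) (at x)"
  using frechet_derivative_works by auto

lemma Ck_const [simp]: "Ck n (\<lambda>x. c)"
proof (induction n arbitrary: c)
  case (Suc n)
  show ?case by (rule Ck_SucI[where f'="\<lambda>x h. 0"]) (auto simp: Suc)
qed simp

lemma Ck_add: "Ck n f \<Longrightarrow> Ck n g \<Longrightarrow> Ck n (\<lambda>x. f x + g x)"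
proof (induction n arbitrary: f g)
  case (Suc n)
  show ?case
  proof (rule Ck_SucI)
    show "((\<lambda>x. f x + g x) has_derivative (\<lambda>h. frechet_derivative f (at x) h + frechet_derivative g (at x) h)) (at x)" for x
      by (intro has_derivative_add has_derivative_frechet[where n=n] Suc.prems)
    show "Ck n (\<lambda>x. frechet_derivative f (at x) i + frechet_derivative g (at x) i)" if "i \<in> Basis" for i
      using Suc.IH[of "pderiv_dir i f" "pderiv_dir i g"] Suc.prems that by (simp add: pderiv_dir_def)
  qed
qed simp

lemma Ck_mult: "Ck n f \<Longrightarrow> Ck n g \<Longrightarrow> Ck n (\<lambda>x. f x * g x)"
proof (induction n arbitrary: f g)
  case (Suc n)
  show ?case
  proof (rule Ck_SucI)
    show "((\<lambda>x. f x * g x) has_derivative (\<lambda>h. f x * frechet_derivative g (at x) h + frechet_derivative f (at x) h * g x)) (at x)" for x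
      by (intro has_derivative_mult has_derivative_frechet[where n=n] Suc.prems)
    show "Ck n (\<lambda>x. f x * frechet_derivative g (at x) i + frechet_derivative f (at x) i * g x)" if "i \<in> Basis" for i
      using Ck_add[OF Suc.IH[of f "pderiv_dir i g"] Suc.IH[of "pderiv_dir i f" g]] Suc.prems that Ck_SucD
      by (auto simp: pderiv_dir_def)
  qed
qed simp

lemma Ck_minus: "Ck n f \<Longrightarrow> Ck n (\<lambda>x. - f x)"
  using Ck_mult[of n "\<lambda>_. -1" f] by simp

lemma Ck_diff: "Ck n f \<Longrightarrow> Ck n g \<Longrightarrow> Ck n (\<lambda>x. f x - g x)"
  using Ck_add[of n f "\<lambda>x. - g x"] Ck_minus by auto

lemma Ck_inner_affine: "Ck n (\<lambda>x. c \<bullet> (x - x0))"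
proof (cases n)
  case (Suc m)
  have "Ck (Suc m) (\<lambda>x. c \<bullet> (x - x0))"
    by (rule Ck_SucI[where f'="\<lambda>x h. c \<bullet> h"]) (auto intro!: derivative_eq_intros)
  then show ?thesis using Suc by simp
qed simp

lemma Ck_sum: "(\<And>i. i \<in> I \<Longrightarrow> Ck n (f i)) \<Longrightarrow> Ck n (\<lambda>x. \<Sum>i\<in>I. f i x)"
  by (induction I rule: infinite_finite_induct) (auto intro: Ck_add)

lemma Ck_norm_sq: "Ck n (\<lambda>x. (norm (x - x0))^2)"
proof -
  have "Ck n (\<lambda>x. \<Sum>i\<in>Basis. (i \<bullet> (x - x0)) * (i \<bullet> (x - x0)))"
    by (intro Ck_sum Ck_mult Ck_inner_affine)
  also have "(\<lambda>x. \<Sum>i\<in>Basis. (i \<bullet> (x - x0)) * (i \<bullet> (x - x0))) = (\<lambda>x. (norm (x - x0))^2)"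
    by (simp add: fun_eq_iff power2_norm_eq_inner euclidean_inner[of "_ - x0" "_ - x0"] inner_commute)
  finally show ?thesis .
qed

lemma Ck_real_SucI:
  assumes "\<And>s. (g has_real_derivative g' s) (at s)" "Ck n g'"
  shows "Ck (Suc n) g"
  by (rule Ck_SucI[where f'="\<lambda>s h. g' s * h"])
    (use assms in \<open>auto simp: has_field_derivative_def Basis_real_def\<close>)

lemma Ck_real_deriv:
  fixes g :: "real \<Rightarrow> real"
  assumes "Ck (Suc n) g"
  shows "(g has_real_derivative deriv g s) (at s)" "Ck n (deriv g)"
proof -
  have d: "(g has_real_derivative deriv g s) (at s)" for s
    using assms by (auto simp: DERIV_deriv_iff_real_differentiable)
  then show "(g has_real_derivative deriv g s) (at s)" by blast
  have "pderiv_dir 1 g = (\<lambda>s. deriv g s * 1)"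
    by (rule pderiv_dir_eq[where f'="\<lambda>s h. deriv g s * h"]) (use d in \<open>auto simp: has_field_derivative_def\<close>)
  then show "Ck n (deriv g)" using assms by (auto simp: Basis_real_def)
qed

text \<open>The derivative is a composition with the same inner function times a derivative of
  \<open>u\<close>, so the induction varies the outer function and keeps \<open>u\<close>
  fixed.\<close>

lemma Ck_compose:
  fixes g :: "real \<Rightarrow> real"
  shows "Ck n g \<Longrightarrow> Ck n u \<Longrightarrow> Ck n (\<lambda>x. g (u x))"
proof (induction n arbitrary: g)
  case (Suc n)
  show ?case
  proof (rule Ck_SucI)
    show "((\<lambda>x. g (u x)) has_derivative (\<lambda>h. deriv g (u x) * frechet_derivative u (at x) h)) (at x)" for x
      using has_derivative_compose[OF has_derivative_frechet[OF Suc.prems(2)]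
          Ck_real_deriv(1)[OF Suc.prems(1), unfolded has_field_derivative_def]] .
    show "Ck n (\<lambda>x. deriv g (u x) * frechet_derivative u (at x) i)" if "i \<in> Basis" for i
      using Ck_mult[OF Suc.IH[OF Ck_real_deriv(2)[OF Suc.prems(1)]], of "pderiv_dir i u"] Suc.prems(2) that Ck_SucD
      by (auto simp: pderiv_dir_def)
  qed
qed simp

text \<open>The derivative is a polynomial in \<open>deriv g\<close> and \<open>1 / g\<close>
  itself, so the induction hypothesis is needed for the same reciprocal only.\<close>

lemma Ck_inverse:
  fixes g :: "real \<Rightarrow> real"
  assumes "\<And>s. g s \<noteq> 0"
  shows "Ck n g \<Longrightarrow> Ck n (\<lambda>s. 1 / g s)"
proof (induction n)
  case (Suc n)
  show ?case
  proof (rule Ck_real_SucI)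
    show "((\<lambda>s. 1 / g s) has_real_derivative - (deriv g s * ((1 / g s) * (1 / g s)))) (at s)" for s
      using Ck_real_deriv(1)[OF Suc.prems] assms
      by (auto intro!: derivative_eq_intros simp: field_simps)
    show "Ck n (\<lambda>s. - (deriv g s * ((1 / g s) * (1 / g s))))"
      using Suc.IH[OF Ck_SucD[OF Suc.prems]] Ck_real_deriv(2)[OF Suc.prems] by (intro Ck_minus Ck_mult) auto
  qed
qed simp

section \<open>Functions that vanish to infinite order at 1\<close>

definition flat_exp :: "real \<Rightarrow> real \<Rightarrow> nat \<Rightarrow> real \<Rightarrow> real" where
  "flat_exp q \<kappa> m s = (if s > 1 then s powr q * exp (- \<kappa> * inverse (s - 1)) * inverse (s - 1) ^ m else 0)"

text \<open>From the right, the substitution t = \<kappa> / (s - 1) reduces the limit to t^m / exp t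
  at infinity.\<close>

lemma flat_exp_tendsto_1:
  assumes "\<kappa> > 0"
  shows "(flat_exp q \<kappa> m \<longlongrightarrow> 0) (at 1)"
proof -
  have l: "(flat_exp q \<kappa> m \<longlongrightarrow> 0) (at_left 1)"
    by (rule tendsto_eventually) (auto simp: flat_exp_def eventually_at_filter)
  have lim: "filterlim (\<lambda>s::real. \<kappa> / (s - 1)) at_top (at_right 1)"
    by (rule LIM_at_top_divide[where a=\<kappa>])
      (use assms in \<open>auto intro!: tendsto_eq_intros simp: eventually_at_filter\<close>)
  have "((\<lambda>t. t ^ m / exp t) \<longlongrightarrow> (0::real)) at_top" by (rule tendsto_power_div_exp_0)
  then have "((\<lambda>s. (\<kappa> / (s - 1)) ^ m / exp (\<kappa> / (s - 1))) \<longlongrightarrow> 0) (at_right (1::real))"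
    by (rule filterlim_compose[OF _ lim])
  moreover have "((\<lambda>s::real. s powr q / \<kappa> ^ m) \<longlongrightarrow> 1 powr q / \<kappa> ^ m) (at_right 1)"
    using assms by (intro tendsto_intros) auto
  ultimately have "((\<lambda>s. (s powr q / \<kappa> ^ m) * ((\<kappa> / (s - 1)) ^ m / exp (\<kappa> / (s - 1)))) \<longlongrightarrow> (1 powr q / \<kappa> ^ m) * 0) (at_right (1::real))"
    by (intro tendsto_mult)
  then have "((\<lambda>s. (s powr q / \<kappa> ^ m) * ((\<kappa> / (s - 1)) ^ m / exp (\<kappa> / (s - 1)))) \<longlongrightarrow> 0) (at_right (1::real))"
    by simp
  then have r: "(flat_exp q \<kappa> m \<longlongrightarrow> 0) (at_right 1)"
    by (rule Lim_transform_eventually)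
      (use assms in \<open>auto simp: eventually_at_filter flat_exp_def exp_minus divide_inverse power_mult_distrib\<close>)
  from l r show ?thesis by (simp add: filterlim_split_at)
qed

text \<open>The factors with the exponents \<open>q\<close> and \<open>m\<close> are in the
  definition to make the family closed under differentiation: smoothness of every member then
  follows by a single induction in \<open>Ck_flat_exp\<close>.\<close>

lemma flat_exp_deriv:
  assumes "\<kappa> > 0"
  shows "(flat_exp q \<kappa> m has_real_derivative
     q * flat_exp (q - 1) \<kappa> m s + \<kappa> * flat_exp q \<kappa> (m + 2) s - real m * flat_exp q \<kappa> (m + 1) s) (at s)"
proof -
  consider "s > 1" | "s < 1" | "s = 1" by linarith
  then show ?thesis
  proof cases
    case 1
    have v: "((\<lambda>s. inverse (s - 1)) has_real_derivative (- ((inverse (s - 1))^2))) (at s)"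
      using 1 by (auto intro!: derivative_eq_intros simp: power2_eq_square)
    have p: "((\<lambda>s. inverse (s - 1) ^ m) has_real_derivative (- (real m * inverse (s - 1) ^ (m + 1)))) (at s)"
      by (rule DERIV_cong[OF DERIV_power[OF v, of m]]) (cases m; simp add: power2_eq_square mult_ac)
    have e: "((\<lambda>s. exp (- \<kappa> * inverse (s - 1))) has_real_derivative
        exp (- \<kappa> * inverse (s - 1)) * (- \<kappa> * (- ((inverse (s - 1))^2)))) (at s)"
      by (rule DERIV_chain2[OF DERIV_exp DERIV_cmult[OF v]])
    have w: "((\<lambda>s. s powr q) has_real_derivative q * s powr (q - 1)) (at s)"
      using 1 by (intro has_real_derivative_powr) auto
    have "((\<lambda>s. s powr q * exp (- \<kappa> * inverse (s - 1)) * inverse (s - 1) ^ m) has_real_derivative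
       q * flat_exp (q - 1) \<kappa> m s + \<kappa> * flat_exp q \<kappa> (m + 2) s - real m * flat_exp q \<kappa> (m + 1) s) (at s)"
      by (rule DERIV_cong[OF DERIV_mult[OF DERIV_mult[OF w e] p]])
        (use 1 in \<open>simp add: flat_exp_def algebra_simps power2_eq_square\<close>)
    then show ?thesis
      by (rule has_field_derivative_transform_within_open[where S="{1<..}"]) (use 1 in \<open>auto simp: flat_exp_def\<close>)
  next
    case 2
    have "((\<lambda>s. 0) has_real_derivative
       q * flat_exp (q - 1) \<kappa> m s + \<kappa> * flat_exp q \<kappa> (m + 2) s - real m * flat_exp q \<kappa> (m + 1) s) (at s)"
      using 2 by (auto simp: flat_exp_def)
    then show ?thesis
      by (rule has_field_derivative_transform_within_open[where S="{..<1}"]) (use 2 in \<open>auto simp: flat_exp_def\<close>)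
  next
    \<comment> \<open>At the gluing point the difference quotient is the family member with exponent
      \<open>m + 1\<close>, whose limit is already known; all three terms of the claimed derivative
      vanish there.\<close>
    case 3
    have "((\<lambda>t. (flat_exp q \<kappa> m t - flat_exp q \<kappa> m 1) / (t - 1)) \<longlongrightarrow> 0) (at 1)"
      by (rule Lim_transform_eventually[OF flat_exp_tendsto_1[OF assms, of q "m+1"]])
        (auto simp: flat_exp_def eventually_at_filter divide_inverse)
    then show ?thesis using 3 by (simp add: has_field_derivative_iff flat_exp_def)
  qed
qed

lemma Ck_flat_exp: "\<kappa> > 0 \<Longrightarrow> Ck n (flat_exp q \<kappa> m)"
proof (induction n arbitrary: q m)
  case (Suc n)
  show ?case
    by (rule Ck_real_SucI[OF flat_exp_deriv[OF Suc.prems]]) (intro Ck_diff Ck_add Ck_mult Ck_const Suc)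
qed simp

section \<open>The radial profile\<close>

lemma isCont_flat_exp: "\<kappa> > 0 \<Longrightarrow> isCont (flat_exp q \<kappa> m) s"
  by (rule DERIV_isCont[OF flat_exp_deriv])

lemma exists_smooth_step:
  obtains \<sigma> \<sigma>' :: "real \<Rightarrow> real" and C where
    "\<And>n. Ck n \<sigma>" "\<And>t. t \<le> 0 \<Longrightarrow> \<sigma> t = 0" "\<And>t. t \<ge> 1 \<Longrightarrow> \<sigma> t = 1"
    "\<And>t. 0 \<le> \<sigma> t" "\<And>t. \<sigma> t \<le> 1"
    "\<And>t. (\<sigma> has_real_derivative \<sigma>' t) (at t)" "continuous_on UNIV \<sigma>'"
    "\<And>t. t < 0 \<Longrightarrow> \<sigma>' t = 0" "\<And>t. t > 1 \<Longrightarrow> \<sigma>' t = 0" "\<And>t. \<bar>\<sigma>' t\<bar> \<le> C"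
proof -
  define \<theta> where "\<theta> = flat_exp 0 1 0"
  have \<theta>0: "\<theta> u = 0" if "u \<le> 1" for u using that by (simp add: \<theta>_def flat_exp_def)
  have \<theta>1: "\<theta> u > 0" if "u > 1" for u using that by (simp add: \<theta>_def flat_exp_def)
  have \<theta>2: "\<theta> u \<ge> 0" for u using \<theta>0[of u] \<theta>1[of u] by (cases "u \<le> 1") auto
  \<comment> \<open>Since \<theta> vanishes up to 1 and is positive beyond, \<theta> (t + 1)
    switches on at t = 0 and \<theta> (2 - t) switches off at t = 1. At every t at least one of them
    is positive, which keeps the denominator away from 0.\<close>
  define \<sigma> where "\<sigma> t = \<theta> (t + 1) * (1 / (\<theta> (t + 1) + \<theta> (2 - t)))" for t
  have den: "\<theta> (t + 1) + \<theta> (2 - t) > 0" for t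
    using \<theta>1[of "t + 1"] \<theta>1[of "2 - t"] \<theta>2[of "t+1"] \<theta>2[of "2-t"] by (cases "t > 0") auto
  have CI: "Ck n (\<lambda>t::real. t)" for n
    using Ck_inner_affine[of n "1::real" 0] by simp
  have Ck\<theta>: "Ck n (\<lambda>t. \<theta> (t + 1))" "Ck n (\<lambda>t. \<theta> (2 - t))" for n
    unfolding \<theta>_def
    using Ck_compose[OF Ck_flat_exp[of 1 n 0 0], of "\<lambda>t. t + 1"] Ck_compose[OF Ck_flat_exp[of 1 n 0 0], of "\<lambda>t. 2 - t"]
      Ck_add[OF CI[of n] Ck_const] Ck_diff[OF Ck_const CI[of n]] by simp_all
  have Ck\<sigma>: "Ck n \<sigma>" for n
    unfolding \<sigma>_def by (intro Ck_mult Ck_inverse Ck_add Ck\<theta>) (use den in \<open>auto simp: less_le\<close>)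
  have s0: "\<sigma> t = 0" if "t \<le> 0" for t using that \<theta>0[of "t + 1"] by (simp add: \<sigma>_def)
  have s1: "\<sigma> t = 1" if "t \<ge> 1" for t using that \<theta>0[of "2 - t"] \<theta>1[of "t + 1"] by (simp add: \<sigma>_def)
  have D: "(\<sigma> has_real_derivative deriv \<sigma> t) (at t)" for t
    using Ck_real_deriv(1)[OF Ck\<sigma>] .
  have C1: "Ck (Suc 0) (deriv \<sigma>)" by (rule Ck_real_deriv(2)[OF Ck\<sigma>])
  have cont: "continuous_on UNIV (deriv \<sigma>)"
    using Ck_real_deriv(1)[OF C1] DERIV_continuous_on by (metis has_field_derivative_at_within)
  have d0: "deriv \<sigma> t = 0" if "t < 0" for t
  proof (rule DERIV_unique[OF D])
    show "(\<sigma> has_real_derivative 0) (at t)"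
      by (rule has_field_derivative_transform_within_open[where f="\<lambda>_. 0" and S="{..<0}"])
        (use that s0 in auto)
  qed
  have d1: "deriv \<sigma> t = 0" if "t > 1" for t
  proof (rule DERIV_unique[OF D])
    show "(\<sigma> has_real_derivative 0) (at t)"
      by (rule has_field_derivative_transform_within_open[where f="\<lambda>_. 1" and S="{1<..}"])
        (use that s1 in auto)
  qed
  have "compact (deriv \<sigma> ` {0..1})"
    by (intro compact_continuous_image continuous_on_subset[OF cont]) auto
  then obtain C where C: "\<And>t. t \<in> {0..1} \<Longrightarrow> norm (deriv \<sigma> t) \<le> C"
    by (metis (no_types, lifting) bounded_iff compact_imp_bounded imageI)
  have "\<bar>deriv \<sigma> t\<bar> \<le> C" for t
    using C[of t] C[of 0] d0[of t] d1[of t] by (cases "t < 0"; cases "t > 1") auto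
  moreover have "0 \<le> \<sigma> t" "\<sigma> t \<le> 1" for t
    using den[of t] \<theta>2[of "t+1"] \<theta>2[of "2-t"] by (auto simp: \<sigma>_def)
  ultimately show thesis by (intro that[of \<sigma> "deriv \<sigma>" C] Ck\<sigma> s0 s1 D cont d0 d1)
qed

text \<open>The linear bound is what absorbs one factor 1 / (s - 1) in the derivative of the
  smoothed profile, making the derivative bounded uniformly in the smoothing parameter.\<close>

lemma one_minus_powr_le:
  fixes s q :: real
  assumes "s > 1" "q \<ge> 0"
  shows "0 \<le> 1 - s powr (-q)" "1 - s powr (-q) \<le> 1" "1 - s powr (-q) \<le> q * (s - 1)"
proof -
  show "0 \<le> 1 - s powr (-q)"
    using powr_mono[of "-q" 0 s] assms by simp
  show "1 - s powr (-q) \<le> 1" by simp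
  have "1 + (- q * ln s) \<le> s powr (-q)"
    using exp_ge_add_one_self[of "- q * ln s"] assms by (simp add: powr_def)
  moreover have "q * ln s \<le> q * (s - 1)"
    using ln_le_minus_one[of s] assms by (intro mult_left_mono) auto
  ultimately show "1 - s powr (-q) \<le> q * (s - 1)" by simp
qed

text \<open>The profile is a smoothing of \<open>min 1 (s powr (-d/2))\<close>, cut off at large \<open>s\<close>; with \<open>s = |x|\<^sup>2\<close> this is
  the decaying harmonic profile \<open>|x| powr (-d)\<close>, for which \<open>d * \<Phi> + 2 * s * \<Phi>'\<close> vanishes.\<close>

lemma exists_radial_profile:
  fixes \<epsilon> :: real
  assumes "\<epsilon> > 0"
  obtains \<Phi> \<Phi>' :: "real \<Rightarrow> real" and R where
    "\<And>n. Ck n \<Phi>" "\<And>s. (\<Phi> has_real_derivative \<Phi>' s) (at s)" "continuous_on UNIV \<Phi>'"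
    "\<And>s. s \<le> 1 \<Longrightarrow> \<Phi> s = 1" "\<And>s. s \<le> 1 \<Longrightarrow> \<Phi>' s = 0" "R > 0" "\<And>s. s \<ge> R \<Longrightarrow> \<Phi> s = 0"
    "integral\<^sup>L lborel (\<lambda>x::'a::euclidean_space. indicator (- cball 0 1) x *
       (real DIM('a) * \<Phi> ((norm x)^2) + 2 * (norm x)^2 * \<Phi>' ((norm x)^2))^2) \<le> \<epsilon>"
proof -
  define D where "D = real DIM('a)"
  have D1: "D \<ge> 1" using DIM_positive[where 'a='a] unfolding D_def by linarith
  obtain \<sigma> \<sigma>' :: "real \<Rightarrow> real" and C where
    sCk: "\<And>n. Ck n \<sigma>" and s0: "\<And>t. t \<le> 0 \<Longrightarrow> \<sigma> t = 0" and s1: "\<And>t. t \<ge> 1 \<Longrightarrow> \<sigma> t = 1"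
    and sge: "\<And>t. 0 \<le> \<sigma> t" and sle: "\<And>t. \<sigma> t \<le> 1"
    and sD: "\<And>t. (\<sigma> has_real_derivative \<sigma>' t) (at t)" and sc: "continuous_on UNIV \<sigma>'"
    and sd0: "\<And>t. t < 0 \<Longrightarrow> \<sigma>' t = 0" and sd1: "\<And>t. t > 1 \<Longrightarrow> \<sigma>' t = 0" and sC: "\<And>t. \<bar>\<sigma>' t\<bar> \<le> C"
    by (rule exists_smooth_step) (rule that)
  have C0: "C \<ge> 0" using sC[of 0] by linarith
  define v where "v = measure lborel (cball (0::'a) 1)"
  have v0: "v \<ge> 0" by (simp add: v_def)
  \<comment> \<open>Chosen so that \<open>Q / real M ^ DIM('a)\<close> bounds the limit integral: an
    integrand of size (4 C)^2 N^(-d) on a ball of radius sqrt 2 * M, with N = M^2.\<close>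
  define Q where "Q = 16 * C^2 * sqrt 2 ^ DIM('a) * v"
  have Q0: "Q \<ge> 0" using v0 by (simp add: Q_def)
  obtain M :: nat where M: "real M > Q / \<epsilon>" "M \<ge> 1"
  proof -
    obtain m :: nat where "real m > Q / \<epsilon>" using reals_Archimedean2 by blast
    then show thesis by (intro that[of "Suc m"]) auto
  qed
  define N where "N = (real M)^2"
  have N1: "N \<ge> 1" using M by (simp add: N_def)
  \<comment> \<open>The transition takes place for s between N and 2 N, so \<open>cut'\<close> is
    O(1 / N) and s * \<open>cut' s\<close> is bounded independently of N; the smallness then comes
    from the decay of the profile alone.\<close>
  define cut where "cut s = 1 - \<sigma> (s / N - 1)" for s
  define cut' where "cut' s = - \<sigma>' (s / N - 1) / N" for s
  have chiD: "(cut has_real_derivative cut' s) (at s)" for s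
  proof -
    have "((\<lambda>s. s / N - 1) has_real_derivative 1 / N) (at s)"
      using N1 by (auto intro!: derivative_eq_intros)
    from DERIV_diff[OF DERIV_const DERIV_chain2[OF sD this]]
    show ?thesis unfolding cut_def[abs_def] cut'_def by simp
  qed
  have chicont: "continuous_on UNIV cut"
    using DERIV_isCont[OF chiD] by (simp add: continuous_at_imp_continuous_on)
  have chic: "continuous_on UNIV cut'"
    unfolding cut'_def using N1 by (intro continuous_intros continuous_on_compose2[OF sc]) auto
  have chib: "\<bar>cut s\<bar> \<le> 1" for s using sge[of "s / N - 1"] sle[of "s / N - 1"] by (simp add: cut_def)
  have chi1: "cut s = 1" if "s \<le> N" for s using that N1 s0 by (simp add: cut_def)
  have chi0: "cut s = 0" if "s \<ge> 2 * N" for s using that N1 s1 by (simp add: cut_def field_simps)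
  have chi'0: "cut' s = 0" if "s < N" for s using that N1 sd0 by (simp add: cut'_def field_simps)
  have chi'1: "cut' s = 0" if "s > 2 * N" for s using that N1 sd1 by (simp add: cut'_def field_simps)
  have chi'b: "\<bar>cut' s\<bar> \<le> C / N" for s
    using sC[of "s / N - 1"] N1 by (simp add: cut'_def divide_right_mono)
  have chiCk: "Ck n cut" for n
  proof -
    have "Ck n (\<lambda>s::real. (1 / N) * (1 \<bullet> (s - 0)) - 1)"
      by (intro Ck_diff Ck_mult Ck_const Ck_inner_affine)
    then have "Ck n (\<lambda>s::real. s / N - 1)" by simp
    then show ?thesis unfolding cut_def using Ck_compose[OF sCk, of n "\<lambda>s. s / N - 1"] by (intro Ck_diff Ck_const) auto
  qed
  \<comment> \<open>A convex combination of 1 and s powr (-D/2) with weight exp (-\<kappa> / (s -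
    1)) on the second: it joins the constant 1 smoothly at s = 1 and tends to the harmonic profile
    for every s > 1 as \<kappa> tends to 0.\<close>
  define g where "g \<kappa> s = 1 - flat_exp 0 \<kappa> 0 s + flat_exp (-D/2) \<kappa> 0 s" for \<kappa> s
  define g' where "g' \<kappa> s = - (\<kappa> * flat_exp 0 \<kappa> 2 s) + ((-D/2) * flat_exp (-D/2-1) \<kappa> 0 s + \<kappa> * flat_exp (-D/2) \<kappa> 2 s)" for \<kappa> s
  have gD: "(g \<kappa> has_real_derivative g' \<kappa> s) (at s)" if "\<kappa> > 0" for \<kappa> s
    using DERIV_add[OF DERIV_diff[OF DERIV_const flat_exp_deriv[OF that, of 0 0]] flat_exp_deriv[OF that, of "-D/2" 0]]
    unfolding g_def[abs_def] g'_def by (simp add: numeral_2_eq_2)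
  have gCk: "Ck n (g \<kappa>)" if "\<kappa> > 0" for \<kappa> n
    unfolding g_def using that by (intro Ck_add Ck_diff Ck_const Ck_flat_exp)
  have gcont: "continuous_on UNIV (g \<kappa>)" "continuous_on UNIV (g' \<kappa>)" if "\<kappa> > 0" for \<kappa>
    unfolding g_def[abs_def] g'_def[abs_def] using isCont_flat_exp[OF that]
    by (intro continuous_intros continuous_at_imp_continuous_on; simp)+
  have gle1: "g \<kappa> s = 1" "g' \<kappa> s = 0" if "s \<le> 1" for \<kappa> s using that by (auto simp: g_def g'_def flat_exp_def)
  have gform: "g \<kappa> s = 1 - exp (-\<kappa> * inverse (s - 1)) * (1 - s powr (-(D/2)))"
    "g' \<kappa> s = - (exp (-\<kappa> * inverse (s - 1)) * (\<kappa> * (inverse (s - 1))^2 * (1 - s powr (-(D/2))))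
        + (D/2) * s powr (-D/2-1) * exp (-\<kappa> * inverse (s - 1)))" if "s > 1" for \<kappa> s
    using that by (auto simp: g_def g'_def flat_exp_def algebra_simps)
  have gb: "\<bar>g \<kappa> s\<bar> \<le> 1" "\<bar>g' \<kappa> s\<bar> \<le> D" if "s > 1" "\<kappa> > 0" for \<kappa> s
  proof -
    define e where "e = exp (-\<kappa> * inverse (s - 1))"
    define w where "w = 1 - s powr (-(D/2))"
    note w = one_minus_powr_le[of s "D/2", folded w_def]
    have e: "0 \<le> e" "e \<le> 1" using that by (auto simp: e_def)
    have w0: "0 \<le> w" "w \<le> 1" "w \<le> D/2 * (s - 1)" using w that D1 by auto
    have "0 \<le> e * w" "e * w \<le> 1" using e w0 by (auto intro: mult_le_one)
    then show "\<bar>g \<kappa> s\<bar> \<le> 1" using gform(1)[OF that(1), of \<kappa>] unfolding e_def[symmetric] w_def[symmetric] by auto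
    have ue: "e * (\<kappa> * inverse (s - 1)) \<le> 1"
    proof -
      have "\<kappa> * inverse (s - 1) \<le> exp (\<kappa> * inverse (s - 1))"
        using exp_ge_add_one_self[of "\<kappa> * inverse (s - 1)"] by linarith
      then have "e * (\<kappa> * inverse (s - 1)) \<le> e * exp (\<kappa> * inverse (s - 1))" using e by (intro mult_left_mono) auto
      also have "\<dots> = 1" by (simp add: e_def exp_add[symmetric])
      finally show ?thesis .
    qed
    have iw: "inverse (s - 1) * w \<le> D/2" "0 \<le> inverse (s - 1) * w" using w0 that by (auto simp: field_simps)
    \<comment> \<open>Of the two factors 1 / (s - 1), one is paid for by the exponential through t
      <= exp t, the other by the linear bound on \<open>w\<close>.\<close>
    have "e * (\<kappa> * (inverse (s - 1))^2 * w) = (e * (\<kappa> * inverse (s - 1))) * (inverse (s - 1) * w)"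
      by (simp add: power2_eq_square)
    also have "\<dots> \<le> 1 * (D/2)" using ue iw D1 by (intro mult_mono) auto
    finally have a: "e * (\<kappa> * (inverse (s - 1))^2 * w) \<le> D/2" by simp
    have a0: "0 \<le> e * (\<kappa> * (inverse (s - 1))^2 * w)" using e w0 that by auto
    have "s powr (-D/2-1) \<le> 1" using powr_mono[of "-D/2-1" 0 s] that D1 by simp
    then have "s powr (-D/2-1) * e \<le> 1" using e by (auto intro: mult_le_one)
    then have b: "(D/2) * s powr (-D/2-1) * e \<le> D/2" using D1 mult_left_mono[of "s powr (-D/2-1) * e" 1 "D/2"] by (simp add: mult.assoc)
    have b0: "0 \<le> (D/2) * s powr (-D/2-1) * e" using D1 e by auto
    show "\<bar>g' \<kappa> s\<bar> \<le> D" using gform(2)[OF that(1), of \<kappa>] a a0 b b0 unfolding e_def[symmetric] w_def[symmetric] by auto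
  qed
  define \<Phi> where "\<Phi> \<kappa> s = cut s * g \<kappa> s" for \<kappa> s
  define \<Phi>' where "\<Phi>' \<kappa> s = cut' s * g \<kappa> s + g' \<kappa> s * cut s" for \<kappa> s
  define K where "K \<kappa> s = D * \<Phi> \<kappa> s + 2 * s * \<Phi>' \<kappa> s" for \<kappa> s
  \<comment> \<open>Independent of \<kappa>, so it yields the integrable majorant for the limit
    \<kappa> to 0.\<close>
  define B where "B = D + 4 * N * (C / N + D)"
  have Kb: "\<bar>K \<kappa> s\<bar> \<le> B" if "s > 1" "s \<le> 2 * N" "\<kappa> > 0" for \<kappa> s
  proof -
    have "\<bar>\<Phi> \<kappa> s\<bar> \<le> 1 * 1" unfolding \<Phi>_def abs_mult using gb[OF that(1,3)] chib[of s] by (intro mult_mono) auto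
    then have 1: "\<bar>D * \<Phi> \<kappa> s\<bar> \<le> D" using D1 by (simp add: abs_mult mult_left_le)
    have "\<bar>\<Phi>' \<kappa> s\<bar> \<le> \<bar>cut' s\<bar> * \<bar>g \<kappa> s\<bar> + \<bar>g' \<kappa> s\<bar> * \<bar>cut s\<bar>" unfolding \<Phi>'_def by (metis abs_mult abs_triangle_ineq)
    also have "\<dots> \<le> C / N * 1 + D * 1" using gb[OF that(1,3)] chib[of s] chi'b[of s] C0 N1 D1 by (intro add_mono mult_mono) auto
    finally have "\<bar>2 * s\<bar> * \<bar>\<Phi>' \<kappa> s\<bar> \<le> (4 * N) * (C / N + D)" using that N1 by (intro mult_mono) auto
    then have 2: "\<bar>2 * s * \<Phi>' \<kappa> s\<bar> \<le> 4 * N * (C / N + D)" by (simp only: abs_mult)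
    show ?thesis using 1 2 abs_triangle_ineq[of "D * \<Phi> \<kappa> s" "2 * s * \<Phi>' \<kappa> s"] unfolding K_def B_def by linarith
  qed
  have K0: "K \<kappa> s = 0" if "s > 2 * N" for \<kappa> s
    using that chi0[of s] chi'1[of s] by (simp add: K_def \<Phi>_def \<Phi>'_def)
  define K\<^sub>0 where "K\<^sub>0 s = 2 * s * cut' s * s powr (-(D/2))" for s
  \<comment> \<open>In the limit the contributions of the harmonic profile cancel, and only the term
    with the derivative of the cut-off survives.\<close>
  have Klim: "(\<lambda>n. K (1 / real (Suc n)) s) \<longlonglongrightarrow> K\<^sub>0 s" if "s > 1" for s
  proof -
    have l: "(\<lambda>n. 1 / real (Suc n)) \<longlonglongrightarrow> 0"
      using LIMSEQ_inverse_real_of_nat by (simp add: inverse_eq_divide)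
    have le: "(\<lambda>n. exp (- (1 / real (Suc n)) * inverse (s - 1))) \<longlonglongrightarrow> exp (- 0 * inverse (s - 1))"
      by (intro tendsto_intros l)
    have "(\<lambda>n. g (1 / real (Suc n)) s) \<longlonglongrightarrow> 1 - exp (- 0 * inverse (s - 1)) * (1 - s powr (-(D/2)))"
      unfolding gform(1)[OF that] by (intro tendsto_intros le)
    then have lg: "(\<lambda>n. g (1 / real (Suc n)) s) \<longlonglongrightarrow> s powr (-(D/2))" by simp
    have "(\<lambda>n. g' (1 / real (Suc n)) s) \<longlonglongrightarrow> - (exp (-0 * inverse (s - 1)) * (0 * (inverse (s - 1))^2 * (1 - s powr (-(D/2))))
        + (D/2) * s powr (-D/2-1) * exp (-0 * inverse (s - 1)))"
      unfolding gform(2)[OF that] by (intro tendsto_intros le l)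
    then have lg': "(\<lambda>n. g' (1 / real (Suc n)) s) \<longlonglongrightarrow> - ((D/2) * s powr (-D/2-1))" by simp
    have "(\<lambda>n. K (1 / real (Suc n)) s) \<longlonglongrightarrow> D * (cut s * s powr (-(D/2)))
        + 2 * s * (cut' s * s powr (-(D/2)) + (- ((D/2) * s powr (-D/2-1))) * cut s)"
      unfolding K_def \<Phi>_def \<Phi>'_def by (intro tendsto_intros lg lg')
    moreover have "s * s powr (-D/2-1) = s powr (-(D/2))"
      using that by (simp add: powr_diff)
    then have "D * (cut s * s powr (-(D/2)))
        + 2 * s * (cut' s * s powr (-(D/2)) + (- ((D/2) * s powr (-D/2-1))) * cut s) = K\<^sub>0 s"
      unfolding K\<^sub>0_def by (simp add: algebra_simps)
    ultimately show ?thesis by simp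
  qed
  define S where "S = cball (0::'a) (sqrt 2 * real M)"
  have inS: "x \<in> S \<longleftrightarrow> (norm x)^2 \<le> 2 * N" for x
  proof -
    have "(sqrt 2 * real M)^2 = 2 * N" by (simp add: N_def power_mult_distrib)
    then show ?thesis
      using abs_le_square_iff[of "norm x" "sqrt 2 * real M"] by (simp add: S_def abs_mult)
  qed
  have mS: "measure lborel S = (sqrt 2 * real M) ^ DIM('a) * v"
    unfolding S_def v_def unfolding content_cball_conv_ball using content_ball_conv_unit_ball(1)[of "sqrt 2 * real M" "0::'a"] by simp
  have fS: "integrable lborel (\<lambda>x. c * indicator S x)" for c :: real
    unfolding S_def by (intro integrable_mult_right integrable_real_indicator) (simp_all add: emeasure_lborel_cball_finite[unfolded infinity_ennreal_def])
  define h where "h \<kappa> x = indicator (- cball 0 1) x * (K \<kappa> ((norm x)^2))^2" for \<kappa> and x :: 'a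
  define h\<^sub>0 where "h\<^sub>0 x = indicator (- cball 0 1) x * (K\<^sub>0 ((norm x)^2))^2" for x :: 'a
  have out: "(norm x)^2 > 1" if "x \<in> - cball 0 1" for x :: 'a
    using that by (simp add: one_less_power)
  have contK: "continuous_on UNIV (K \<kappa>)" if "\<kappa> > 0" for \<kappa>
    unfolding K_def[abs_def] \<Phi>_def \<Phi>'_def
    by (intro continuous_intros gcont[OF that] chic chicont)
  have mh: "h \<kappa> \<in> borel_measurable lborel" if "\<kappa> > 0" for \<kappa>
  proof -
    have "(\<lambda>x::'a. K \<kappa> ((norm x)^2)) \<in> borel_measurable borel"
      by (intro borel_measurable_continuous_onI continuous_on_compose2[OF contK[OF that]] continuous_intros) auto
    then show ?thesis unfolding h_def by measurable
  qed
  have mh0: "h\<^sub>0 \<in> borel_measurable lborel"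
  proof -
    have "(\<lambda>x::'a. cut' ((norm x)^2)) \<in> borel_measurable borel"
      by (intro borel_measurable_continuous_onI continuous_on_compose2[OF chic] continuous_intros) auto
    then show ?thesis unfolding h\<^sub>0_def K\<^sub>0_def by measurable
  qed
  have "(\<lambda>n. integral\<^sup>L lborel (h (1 / real (Suc n)))) \<longlonglongrightarrow> integral\<^sup>L lborel h\<^sub>0"
  proof (rule integral_dominated_convergence[where w="\<lambda>x. B^2 * indicator S x"])
    show "AE x in lborel. (\<lambda>n. h (1 / real (Suc n)) x) \<longlonglongrightarrow> h\<^sub>0 x"
    proof (rule AE_I2)
      fix x :: 'a
      show "(\<lambda>n. h (1 / real (Suc n)) x) \<longlonglongrightarrow> h\<^sub>0 x"
        unfolding h_def h\<^sub>0_def using Klim[OF out, of x]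
        by (cases "x \<in> - cball 0 1") (auto intro!: tendsto_intros)
    qed
    show "AE x in lborel. norm (h (1 / real (Suc n)) x) \<le> B^2 * indicator S x" for n
    proof (rule AE_I2)
      fix x :: 'a
      show "norm (h (1 / real (Suc n)) x) \<le> B^2 * indicator S x"
      proof (cases "x \<in> - cball 0 1")
        case True
        show ?thesis
        proof (cases "x \<in> S")
          case True
          have "\<bar>K (1 / real (Suc n)) ((norm x)^2)\<bar> \<le> B"
            using Kb[OF out[OF \<open>x \<in> - cball 0 1\<close>], of "1 / real (Suc n)"] True by (simp add: inS)
          then have "(K (1 / real (Suc n)) ((norm x)^2))^2 \<le> B^2"
            by (rule abs_le_square_iff[THEN iffD1, OF order_trans]) simp
          then show ?thesis using True \<open>x \<in> - cball 0 1\<close> by (simp add: h_def)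
        next
          case False
          then show ?thesis using K0[of "(norm x)^2"] by (simp add: h_def inS)
        qed
      qed (simp add: h_def)
    qed
  qed (rule mh0, rule mh, simp, rule fS)
  moreover have "integral\<^sup>L lborel h\<^sub>0 < \<epsilon>"
  proof -
    define c where "c = (4 * C)^2 * N powr (-D)"
    have b: "h\<^sub>0 x \<le> c * indicator S x" for x
    proof (cases "x \<in> - cball 0 1 \<and> x \<in> S \<and> (norm x)^2 \<ge> N")
      case True
      let ?s = "(norm x)^2"
      have s: "?s > 1" "?s \<le> 2 * N" "?s \<ge> N" using True out inS by auto
      have "\<bar>2 * ?s\<bar> * \<bar>cut' ?s\<bar> \<le> (4 * N) * (C / N)" using s chi'b[of ?s] N1 by (intro mult_mono) auto
      then have "\<bar>2 * ?s * cut' ?s\<bar> \<le> 4 * C" using N1 by (simp add: abs_mult)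
      then have "(2 * ?s * cut' ?s)^2 \<le> (4 * C)^2" using C0 by (metis abs_le_square_iff abs_of_nonneg mult_nonneg_nonneg zero_le_numeral)
      moreover have "(?s powr (-(D/2)))^2 = ?s powr (-D)" using s by (simp add: power2_eq_square powr_add[symmetric])
      moreover have "?s powr (-D) \<le> N powr (-D)" using s N1 D1 by (intro powr_mono2') auto
      ultimately have "(2 * ?s * cut' ?s)^2 * (?s powr (-(D/2)))^2 \<le> c"
        unfolding c_def by (metis mult_mono zero_le_power2)
      then show ?thesis using True by (simp add: h\<^sub>0_def K\<^sub>0_def power_mult_distrib)
    next
      case False
      then have "h\<^sub>0 x = 0" using chi'0[of "(norm x)^2"] chi'1[of "(norm x)^2"] by (auto simp: h\<^sub>0_def K\<^sub>0_def inS)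
      then show ?thesis by (simp add: c_def)
    qed
    have "integral\<^sup>L lborel h\<^sub>0 \<le> (LBINT x. c * indicator S x)"
    proof (rule integral_mono_AE)
      show "integrable lborel h\<^sub>0"
        by (rule Bochner_Integration.integrable_bound[OF fS[of c] mh0]) (use b in \<open>auto simp: h\<^sub>0_def c_def intro!: AE_I2\<close>)
    qed (use b fS in auto)
    also have "\<dots> = c * ((sqrt 2 * real M) ^ DIM('a) * v)" using mS by simp
    also have "\<dots> = Q / real M ^ DIM('a)"
    proof -
      have "N powr (-D) = inverse (N ^ DIM('a))" using N1 by (simp add: D_def powr_minus powr_realpow)
      also have "\<dots> = inverse (real M ^ DIM('a) * real M ^ DIM('a))" by (simp add: N_def power2_eq_square power_mult_distrib)
      finally show ?thesis using M by (simp add: c_def Q_def power_mult_distrib field_simps)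
    qed
    also have "\<dots> \<le> Q / real M"
      using M Q0 DIM_positive[where 'a='a] by (intro divide_left_mono self_le_power) auto
    also have "\<dots> < \<epsilon>" using M assms by (simp add: field_simps)
    finally show ?thesis .
  qed
  ultimately have "eventually (\<lambda>n. integral\<^sup>L lborel (h (1 / real (Suc n))) < \<epsilon>) sequentially"
    by (rule order_tendstoD)
  then obtain n where n: "integral\<^sup>L lborel (h (1 / real (Suc n))) < \<epsilon>"
    by (auto simp: eventually_sequentially)
  define \<kappa> where "\<kappa> = 1 / real (Suc n)"
  have \<kappa>: "\<kappa> > 0" by (simp add: \<kappa>_def)
  show thesis
  proof (rule that[of "\<Phi> \<kappa>" "\<Phi>' \<kappa>" "2 * N"])
    show "Ck n (\<Phi> \<kappa>)" for n unfolding \<Phi>_def by (intro Ck_mult chiCk gCk \<kappa>)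
    show "(\<Phi> \<kappa> has_real_derivative \<Phi>' \<kappa> s) (at s)" for s
      unfolding \<Phi>_def[abs_def] \<Phi>'_def by (rule DERIV_mult[OF chiD gD[OF \<kappa>]])
    show "continuous_on UNIV (\<Phi>' \<kappa>)" unfolding \<Phi>'_def[abs_def]
      by (intro continuous_intros gcont[OF \<kappa>] chic chicont)
    show "\<Phi> \<kappa> s = 1" if "s \<le> 1" for s using that gle1 chi1 N1 by (simp add: \<Phi>_def)
    show "\<Phi>' \<kappa> s = 0" if "s \<le> 1" for s
    proof -
      have "cut' s = 0"
      proof (cases "s < N")
        case False
        \<comment> \<open>With N = 1 the point s = 1 lies on the edge of the region where
          \<open>chi'0\<close> applies; continuity of \<open>cut'\<close> from the left supplies the
          missing value.\<close>
        then have "N = 1" "s = 1" using that N1 by auto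
        have "(\<lambda>n. cut' (1 - 1 / real (Suc n))) \<longlonglongrightarrow> cut' 1"
        proof (rule continuous_on_tendsto_compose[OF chic])
          show "(\<lambda>n. 1 - 1 / real (Suc n)) \<longlonglongrightarrow> 1"
            using tendsto_diff[OF tendsto_const LIMSEQ_inverse_real_of_nat, of "1::real"] by (simp add: inverse_eq_divide)
        qed auto
        moreover have "(\<lambda>n. cut' (1 - 1 / real (Suc n))) = (\<lambda>n. 0)" using chi'0 \<open>N = 1\<close> by auto
        ultimately have "cut' 1 = 0" by (simp add: LIMSEQ_const_iff)
        then show ?thesis using \<open>s = 1\<close> by simp
      qed (rule chi'0)
      then show ?thesis using that gle1 by (simp add: \<Phi>'_def)
    qed
    show "\<Phi> \<kappa> s = 0" if "s \<ge> 2 * N" for s using that chi0 by (simp add: \<Phi>_def)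
    show "integral\<^sup>L lborel (\<lambda>x::'a. indicator (- cball 0 1) x *
       (real DIM('a) * \<Phi> \<kappa> ((norm x)^2) + 2 * (norm x)^2 * \<Phi>' \<kappa> ((norm x)^2))^2) \<le> \<epsilon>"
      using n unfolding h_def K_def D_def \<kappa>_def by simp
  qed (use N1 in auto)
qed

section \<open>Compactly supported continuously differentiable functions\<close>

lemma
  fixes f :: "'a::euclidean_space \<Rightarrow> 'b::{banach,second_countable_topology}"
  assumes "continuous_on UNIV f" "\<And>x. norm x > R \<Longrightarrow> f x = 0"
  shows integrable_cont_compact_support: "integrable lborel f"
    and bounded_cont_compact_support: "\<exists>B\<ge>0. \<forall>x. norm (f x) \<le> B"
proof -
  have "integrable lborel (\<lambda>x. indicator (cball 0 R) x *\<^sub>R f x)"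
    by (intro borel_integrable_compact continuous_on_subset[OF assms(1)]) auto
  moreover have "(\<lambda>x. indicator (cball 0 R) x *\<^sub>R f x) = f"
    using assms(2) by (auto simp: fun_eq_iff indicator_def not_le)
  ultimately show "integrable lborel f" by simp
  have "compact (f ` cball 0 R)"
    by (intro compact_continuous_image continuous_on_subset[OF assms(1)]) auto
  then obtain B where B: "\<And>x. x \<in> cball 0 R \<Longrightarrow> norm (f x) \<le> B"
    by (metis bounded_iff compact_imp_bounded imageI)
  have "norm (f x) \<le> max 0 B" for x
    using B[of x] assms(2)[of x] by (cases "norm x \<le> R") (auto simp: le_max_iff_disj)
  then show "\<exists>B\<ge>0. \<forall>x. norm (f x) \<le> B" by (meson max.cobounded1)
qed

lemma integral_shift:
  fixes f :: "'a::euclidean_space \<Rightarrow> 'b::{banach,second_countable_topology}"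
  assumes "f \<in> borel_measurable borel"
  shows "(LBINT x. f (x + t)) = integral\<^sup>L lborel f"
proof -
  have "integral\<^sup>L lborel f = integral\<^sup>L (distr lborel borel ((+) t)) f"
    by (simp add: lborel_distr_plus)
  also have "\<dots> = (LBINT x. f (t + x))"
    by (rule integral_distr) (use assms in auto)
  finally show ?thesis by (simp add: add.commute)
qed

lemma integrable_shift:
  fixes f :: "'a::euclidean_space \<Rightarrow> 'b::{banach,second_countable_topology}"
  assumes "integrable lborel f"
  shows "integrable lborel (\<lambda>x. f (x + t))"
proof -
  have "integrable (distr lborel borel ((+) t)) f"
    using assms by (simp add: lborel_distr_plus)
  then have "integrable lborel (\<lambda>x. f (t + x))"
    using borel_measurable_integrable[OF assms] by (subst (asm) integrable_distr_eq) auto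
  then show ?thesis by (simp add: add.commute)
qed

text \<open>The gradient is carried as data, matching the pairs in \<open>H10\<close>. One
  continuous derivative is enough, because difference quotients stand in wherever a second
  derivative would appear.\<close>

definition C1c :: "('a::euclidean_space \<Rightarrow> real) \<Rightarrow> ('a \<Rightarrow> 'a) \<Rightarrow> bool" where
  "C1c u g \<longleftrightarrow> (\<forall>x. (u has_derivative (\<lambda>h. g x \<bullet> h)) (at x)) \<and> continuous_on UNIV g
      \<and> (\<exists>R. \<forall>x. norm x > R \<longrightarrow> u x = 0)"

lemma C1c_deriv: "C1c u g \<Longrightarrow> (u has_derivative (\<lambda>h. g x \<bullet> h)) (at x)"
  by (simp add: C1c_def)

lemma C1c_cont: "C1c u g \<Longrightarrow> continuous_on UNIV u"
  by (meson C1c_deriv has_derivative_continuous continuous_at_imp_continuous_on)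

lemma C1c_cont_grad: "C1c u g \<Longrightarrow> continuous_on UNIV g"
  by (simp add: C1c_def)

lemma C1c_grad_zero:
  assumes "C1c u g" "\<And>x. norm x > R \<Longrightarrow> u x = 0" "norm x > R"
  shows "g x = 0"
proof -
  have "open {x::'a. norm x > R}"
    by (intro open_Collect_less continuous_intros)
  then have "(u has_derivative (\<lambda>h. 0)) (at x)"
    by (rule has_derivative_transform_within_open[where f="\<lambda>_. 0", rotated 1]) (use assms in auto)
  from has_derivative_unique[OF C1c_deriv[OF assms(1)] this]
  have "(\<lambda>h. g x \<bullet> h) = (\<lambda>h. 0)" .
  then have "g x \<bullet> g x = 0" by meson
  then show ?thesis by simp
qed

lemma C1c_support:
  assumes "C1c u g"
  obtains R where "R \<ge> 0" "\<And>x. norm x > R \<Longrightarrow> u x = 0" "\<And>x. norm x > R \<Longrightarrow> g x = 0"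
proof -
  obtain R where R: "\<And>x. norm x > R \<Longrightarrow> u x = 0" using assms by (auto simp: C1c_def)
  have 1: "u x = 0" if "norm x > max 0 R" for x using R that by auto
  show thesis
    using that[of "max 0 R"] 1 C1c_grad_zero[OF assms, of "max 0 R"] by simp
qed

lemma C1c_lipschitz:
  assumes "C1c u g"
  obtains L where "L \<ge> 0" "\<And>x y. \<bar>u x - u y\<bar> \<le> L * norm (x - y)"
proof -
  obtain R where R: "\<And>x. norm x > R \<Longrightarrow> g x = 0" using C1c_support[OF assms] by metis
  obtain L where L: "L \<ge> 0" "\<And>x. norm (g x) \<le> L"
    using bounded_cont_compact_support[OF C1c_cont_grad[OF assms] R] by blast
  have "norm (u x - u y) \<le> L * norm (x - y)" for x y
  proof (rule differentiable_bound[of UNIV u "\<lambda>x h. g x \<bullet> h"])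
    show "(u has_derivative (\<lambda>h. g x \<bullet> h)) (at x within UNIV)" for x
      using C1c_deriv[OF assms] by simp
    show "onorm (\<lambda>h. g x \<bullet> h) \<le> L" for x
    proof (rule onorm_bound[OF L(1)])
      show "norm (g x \<bullet> h) \<le> L * norm h" for h
        using Cauchy_Schwarz_ineq2[of "g x" h] mult_right_mono[OF L(2)[of x], of "norm h"] by simp
    qed
  qed auto
  then show thesis using that L by auto
qed

lemma C1c_mult:
  assumes "C1c u g" "\<And>x. (w has_derivative (\<lambda>h. k x \<bullet> h)) (at x)" "continuous_on UNIV k"
  shows "C1c (\<lambda>x. u x * w x) (\<lambda>x. u x *\<^sub>R k x + w x *\<^sub>R g x)"
proof -
  have w: "continuous_on UNIV w"
    using assms(2) by (meson has_derivative_continuous continuous_at_imp_continuous_on)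
  have "((\<lambda>x. u x * w x) has_derivative (\<lambda>h. (u x *\<^sub>R k x + w x *\<^sub>R g x) \<bullet> h)) (at x)" for x
    by (rule has_derivative_eq_rhs[OF has_derivative_mult[OF C1c_deriv[OF assms(1)] assms(2)]])
      (auto simp: inner_add_left)
  moreover have "continuous_on UNIV (\<lambda>x. u x *\<^sub>R k x + w x *\<^sub>R g x)"
    by (intro continuous_intros C1c_cont[OF assms(1)] C1c_cont_grad[OF assms(1)] w assms(3))
  moreover obtain R where "\<And>x. norm x > R \<Longrightarrow> u x = 0" using C1c_support[OF assms(1)] by metis
  ultimately show ?thesis unfolding C1c_def by auto
qed

section \<open>Difference quotients and integration by parts\<close>

definition dq :: "nat \<Rightarrow> 'a::real_vector \<Rightarrow> ('a \<Rightarrow> real) \<Rightarrow> 'a \<Rightarrow> real" where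
  "dq n e u x = real (Suc n) * (u (x + (1 / real (Suc n)) *\<^sub>R e) - u x)"

lemma dq_tendsto:
  assumes "C1c u g"
  shows "(\<lambda>n. dq n e u x) \<longlonglongrightarrow> g x \<bullet> e"
proof -
  have "((\<lambda>t. u (x + t *\<^sub>R e)) has_derivative (\<lambda>t. g x \<bullet> (t *\<^sub>R e))) (at 0)"
    by (rule has_derivative_compose[of "\<lambda>t. x + t *\<^sub>R e" "\<lambda>t. t *\<^sub>R e"])
      (use C1c_deriv[OF assms, of x] in \<open>auto intro!: derivative_eq_intros\<close>)
  then have "((\<lambda>t. u (x + t *\<^sub>R e)) has_real_derivative (g x \<bullet> e)) (at 0)"
    by (rule has_derivative_imp_has_field_derivative) (simp add: mult.commute)
  then have l: "((\<lambda>t. (u (x + t *\<^sub>R e) - u x) / t) \<longlongrightarrow> g x \<bullet> e) (at 0)"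
    by (simp add: has_field_derivative_iff)
  have "filterlim (\<lambda>n. 1 / real (Suc n)) (at 0) sequentially"
    using LIMSEQ_inverse_real_of_nat by (auto simp: filterlim_at inverse_eq_divide)
  from filterlim_compose[OF l this] show ?thesis
    by (simp add: dq_def mult.commute)
qed

lemma dq_bound:
  assumes "C1c u g"
  obtains R B where "B \<ge> 0" "\<And>n x. \<bar>dq n e u x\<bar> \<le> B * indicator (cball 0 R) x"
proof -
  obtain R where R: "\<And>x. norm x > R \<Longrightarrow> u x = 0" using C1c_support[OF assms] by metis
  obtain L where L: "L \<ge> 0" "\<And>x y. \<bar>u x - u y\<bar> \<le> L * norm (x - y)" using C1c_lipschitz[OF assms] by blast
  have "\<bar>dq n e u x\<bar> \<le> (L * norm e) * indicator (cball 0 (R + norm e)) x" for n x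
  proof (cases "x \<in> cball 0 (R + norm e)")
    case True
    have "\<bar>dq n e u x\<bar> = real (Suc n) * \<bar>u (x + (1 / real (Suc n)) *\<^sub>R e) - u x\<bar>"
      by (simp add: dq_def abs_mult)
    also have "\<dots> \<le> real (Suc n) * (L * norm ((1 / real (Suc n)) *\<^sub>R e))"
      using L(2)[of "x + (1 / real (Suc n)) *\<^sub>R e" x] by (intro mult_left_mono) auto
    also have "\<dots> = L * norm e" by simp
    finally show ?thesis using True by simp
  next
    case False
    then have 1: "norm x > R + norm e" by simp
    have "norm ((1 / real (Suc n)) *\<^sub>R e) \<le> norm e" using mult_right_mono[of 1 "real (Suc n)" "norm e"] by (simp add: field_simps)
    then have "norm (x + (1 / real (Suc n)) *\<^sub>R e) > R"
      using 1 norm_triangle_ineq4[of "x + (1 / real (Suc n)) *\<^sub>R e" "(1 / real (Suc n)) *\<^sub>R e"] by simp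
    moreover have "norm x > R" using 1 norm_ge_zero[of e] by linarith
    ultimately show ?thesis using False R by (simp add: dq_def)
  qed
  then show thesis using that[of "L * norm e" "R + norm e"] L(1) by simp
qed

lemma dq_cont:
  assumes "C1c u g"
  shows "continuous_on UNIV (dq n e u)"
  unfolding dq_def[abs_def]
  by (intro continuous_intros C1c_cont[OF assms] continuous_on_compose2[OF C1c_cont[OF assms]]) auto

lemma borel_cont: "continuous_on UNIV f \<Longrightarrow> f \<in> borel_measurable borel"
  by (rule borel_measurable_continuous_onI)

text \<open>The factor \<open>m\<close> may grow: all difference quotients live in one fixed ball
  and are bounded there by the Lipschitz constant of \<open>u\<close>, which gives the majorant for
  dominated convergence.\<close>

lemma dq_integral_tendsto:
  assumes u: "C1c u g" and m: "continuous_on UNIV m"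
  shows "integrable lborel (\<lambda>x. m x * dq n e u x)" "integrable lborel (\<lambda>x. m x * (g x \<bullet> e))"
    "(\<lambda>n. (LBINT x. m x * dq n e u x)) \<longlonglongrightarrow> (LBINT x. m x * (g x \<bullet> e))"
proof -
  obtain R B where B: "B \<ge> 0" "\<And>n x. \<bar>dq n e u x\<bar> \<le> B * indicator (cball 0 R) x"
    by (rule dq_bound[OF u, of e]) (rule that)
  have w: "integrable lborel (\<lambda>x. indicator (cball 0 R) x *\<^sub>R (\<bar>m x\<bar> * B))"
    by (intro borel_integrable_compact continuous_intros continuous_on_subset[OF m]) auto
  note [measurable] = borel_cont[OF m] borel_cont[OF C1c_cont_grad[OF u]] borel_cont[OF dq_cont[OF u]]
  have b: "AE x in lborel. norm (m x * dq n e u x) \<le> indicator (cball 0 R) x *\<^sub>R (\<bar>m x\<bar> * B)" for n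
  proof (rule AE_I2)
    fix x
    show "norm (m x * dq n e u x) \<le> indicator (cball 0 R) x *\<^sub>R (\<bar>m x\<bar> * B)"
      using mult_left_mono[OF B(2)[of n x], of "\<bar>m x\<bar>"] by (simp add: abs_mult mult_ac)
  qed
  have l: "AE x in lborel. (\<lambda>n. m x * dq n e u x) \<longlonglongrightarrow> m x * (g x \<bullet> e)"
    by (intro AE_I2 tendsto_intros dq_tendsto[OF u])
  show "integrable lborel (\<lambda>x. m x * (g x \<bullet> e))"
    by (rule integrable_dominated_convergence[OF _ _ w l b]) auto
  show "integrable lborel (\<lambda>x. m x * dq n e u x)"
    by (rule Bochner_Integration.integrable_bound[OF w]) (use b[of n] in auto)
  show "(\<lambda>n. (LBINT x. m x * dq n e u x)) \<longlonglongrightarrow> (LBINT x. m x * (g x \<bullet> e))"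
    by (rule integral_dominated_convergence[OF _ _ w l b]) auto
qed

lemma C1c_integrable: "C1c u g \<Longrightarrow> integrable lborel u"
  using C1c_support integrable_cont_compact_support C1c_cont by metis

text \<open>Every difference quotient integrates to zero by translation invariance, and the limit
  inherits this.\<close>

lemma integral_grad_zero:
  assumes "C1c u g"
  shows "(LBINT x. g x \<bullet> e) = 0"
proof -
  have "(LBINT x. 1 * dq n e u x) = 0" for n
    unfolding dq_def using C1c_integrable[OF assms] integrable_shift[OF C1c_integrable[OF assms]]
      integral_shift[OF borel_cont[OF C1c_cont[OF assms]]] by simp
  then have "(\<lambda>n. 0) \<longlonglongrightarrow> (LBINT x. 1 * (g x \<bullet> e))"
    using dq_integral_tendsto(3)[OF assms, of "\<lambda>_. 1" e] by simp
  then show ?thesis by (simp add: LIMSEQ_const_iff)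
qed

text \<open>No decay of \<open>w\<close> is asked for: the products of \<open>w\<close> with the
  components of \<open>X\<close> have compact support, so their partial derivatives integrate to
  zero.\<close>

lemma integration_by_parts:
  fixes X :: "'a::euclidean_space \<Rightarrow> 'a"
  assumes X: "\<And>i. i \<in> Basis \<Longrightarrow> C1c (\<lambda>x. X x \<bullet> i) (gX i)"
    and w: "\<And>x. (w has_derivative (\<lambda>h. k x \<bullet> h)) (at x)" "continuous_on UNIV k"
  shows "(LBINT x. X x \<bullet> k x) = - (LBINT x. (\<Sum>i\<in>Basis. gX i x \<bullet> i) * w x)"
proof -
  have cw: "continuous_on UNIV w"
    using w(1) by (meson has_derivative_continuous continuous_at_imp_continuous_on)
  have ck: "continuous_on UNIV (\<lambda>x. k x \<bullet> i)" for i by (intro continuous_intros w(2))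
  have i1: "integrable lborel (\<lambda>x. (X x \<bullet> i) * (k x \<bullet> i))" if i: "i \<in> Basis" for i
  proof -
    obtain R where R: "\<And>x. norm x > R \<Longrightarrow> X x \<bullet> i = 0" using C1c_support[OF X[OF i]] by metis
    show ?thesis
      by (rule integrable_cont_compact_support[of _ R])
        (use R in \<open>auto intro!: continuous_intros C1c_cont[OF X[OF i]] ck\<close>)
  qed
  have i2: "integrable lborel (\<lambda>x. w x * (gX i x \<bullet> i))" if i: "i \<in> Basis" for i
    by (rule dq_integral_tendsto(2)[OF X[OF i] cw])
  have z: "(LBINT x. (X x \<bullet> i) * (k x \<bullet> i)) = - (LBINT x. w x * (gX i x \<bullet> i))" if i: "i \<in> Basis" for i
  proof -
    have "0 = (LBINT x. ((X x \<bullet> i) *\<^sub>R k x + w x *\<^sub>R gX i x) \<bullet> i)"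
      by (rule integral_grad_zero[OF C1c_mult[OF X[OF i] w], symmetric])
    also have "\<dots> = (LBINT x. (X x \<bullet> i) * (k x \<bullet> i) + w x * (gX i x \<bullet> i))"
      by (simp add: inner_add_left)
    also have "\<dots> = (LBINT x. (X x \<bullet> i) * (k x \<bullet> i)) + (LBINT x. w x * (gX i x \<bullet> i))"
      by (rule Bochner_Integration.integral_add[OF i1[OF i] i2[OF i]])
    finally show ?thesis by simp
  qed
  have "(LBINT x. X x \<bullet> k x) = integral\<^sup>L lborel (\<lambda>x. \<Sum>i\<in>Basis. (X x \<bullet> i) * (k x \<bullet> i))"
    by (subst euclidean_inner) (rule refl)
  also have "\<dots> = (\<Sum>i\<in>Basis. (LBINT x. (X x \<bullet> i) * (k x \<bullet> i)))"
    by (rule Bochner_Integration.integral_sum[OF i1])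
  also have "\<dots> = - (\<Sum>i\<in>Basis. (LBINT x. w x * (gX i x \<bullet> i)))"
    by (subst sum_negf[symmetric], rule sum.cong[OF refl z])
  also have "(\<Sum>i\<in>Basis. (LBINT x. w x * (gX i x \<bullet> i))) = integral\<^sup>L lborel (\<lambda>x. \<Sum>i\<in>Basis. w x * (gX i x \<bullet> i))"
    by (rule Bochner_Integration.integral_sum[OF i2, symmetric])
  also have "(\<lambda>x. \<Sum>i\<in>Basis. w x * (gX i x \<bullet> i)) = (\<lambda>x. (\<Sum>i\<in>Basis. gX i x \<bullet> i) * w x)"
    by (intro ext) (metis mult.commute sum_distrib_left)
  finally show ?thesis .
qed

section \<open>Translation estimates and compactness\<close>

lemma C1c_radial:
  fixes c x0 :: "'a::euclidean_space" and \<Phi> \<Phi>' :: "real \<Rightarrow> real"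
  assumes \<Phi>: "\<And>s. (\<Phi> has_real_derivative \<Phi>' s) (at s)" "continuous_on UNIV \<Phi>'" "\<And>s. s \<ge> R \<Longrightarrow> \<Phi> s = 0"
  shows "C1c (\<lambda>x. (c \<bullet> (x - x0)) * \<Phi> ((norm (x - x0))^2))
    (\<lambda>x. \<Phi> ((norm (x - x0))^2) *\<^sub>R c + (2 * \<Phi>' ((norm (x - x0))^2) * (c \<bullet> (x - x0))) *\<^sub>R (x - x0))"
proof -
  have n: "((\<lambda>x. (norm (x - x0))^2) has_derivative (\<lambda>h. 2 * ((x - x0) \<bullet> h))) (at x)" for x
    unfolding power2_norm_eq_inner by (auto intro!: derivative_eq_intros simp: inner_commute)
  have f: "((\<lambda>x. \<Phi> ((norm (x - x0))^2)) has_derivative (\<lambda>h. \<Phi>' ((norm (x - x0))^2) * (2 * ((x - x0) \<bullet> h)))) (at x)" for x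
    using has_derivative_compose[OF n \<Phi>(1)[unfolded has_field_derivative_def]] .
  have l: "((\<lambda>x. c \<bullet> (x - x0)) has_derivative (\<lambda>h. c \<bullet> h)) (at x)" for x
    by (auto intro!: derivative_eq_intros)
  have d: "((\<lambda>x. (c \<bullet> (x - x0)) * \<Phi> ((norm (x - x0))^2)) has_derivative
    (\<lambda>h. (\<Phi> ((norm (x - x0))^2) *\<^sub>R c + (2 * \<Phi>' ((norm (x - x0))^2) * (c \<bullet> (x - x0))) *\<^sub>R (x - x0)) \<bullet> h)) (at x)" for x
    by (rule has_derivative_eq_rhs[OF has_derivative_mult[OF l f]])
      (auto simp: inner_add_left algebra_simps inner_diff_left)
  have c: "continuous_on UNIV \<Phi>"
    using DERIV_isCont[OF \<Phi>(1)] by (simp add: continuous_at_imp_continuous_on)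
  have z: "\<Phi> ((norm (x - x0))^2) = 0" if "norm x > norm x0 + sqrt \<bar>R\<bar>" for x
  proof -
    have "norm x - norm x0 \<le> norm (x - x0)" by (rule norm_triangle_ineq2)
    then have "sqrt \<bar>R\<bar> \<le> norm (x - x0)" using that by linarith
    then have "(sqrt \<bar>R\<bar>)^2 \<le> (norm (x - x0))^2" by (intro power_mono) auto
    then show ?thesis using \<Phi>(3) by simp
  qed
  show ?thesis
    unfolding C1c_def
  proof (intro conjI allI)
    show "continuous_on UNIV (\<lambda>x. \<Phi> ((norm (x - x0))^2) *\<^sub>R c + (2 * \<Phi>' ((norm (x - x0))^2) * (c \<bullet> (x - x0))) *\<^sub>R (x - x0))"
      by (intro continuous_intros continuous_on_compose2[OF c] continuous_on_compose2[OF \<Phi>(2)]) auto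
    show "\<exists>R. \<forall>x. norm x > R \<longrightarrow> (c \<bullet> (x - x0)) * \<Phi> ((norm (x - x0))^2) = 0" using z by auto
  qed (rule d)
qed

text \<open>Both sides are \<open>\<integral> div X (c \<bullet> grad v)\<close> for the gradient field \<open>X x = \<Phi>(|x - x0|\<^sup>2) (x - x0)\<close>:
  \<open>\<integral> \<partial>\<^sub>c X \<bullet> grad v\<close> is integrated by parts, moving the difference quotient in direction \<open>c\<close>
  over to \<open>v\<close> so that no second derivatives occur.\<close>

lemma radial_identity:
  fixes c x0 :: "'a::euclidean_space" and \<Phi> \<Phi>' :: "real \<Rightarrow> real"
  assumes \<Phi>: "\<And>s. (\<Phi> has_real_derivative \<Phi>' s) (at s)" "continuous_on UNIV \<Phi>'" "\<And>s. s \<ge> R \<Longrightarrow> \<Phi> s = 0"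
    and v: "C1c v gv"
  shows "(LBINT x. (\<Phi> ((norm (x - x0))^2) *\<^sub>R c
            + (2 * \<Phi>' ((norm (x - x0))^2) * (c \<bullet> (x - x0))) *\<^sub>R (x - x0)) \<bullet> gv x)
     = (LBINT x. (real DIM('a) * \<Phi> ((norm (x - x0))^2)
            + 2 * (norm (x - x0))^2 * \<Phi>' ((norm (x - x0))^2)) * (gv x \<bullet> c))"
proof -
  define s where "s x = (norm (x - x0))^2" for x
  define X where "X x = \<Phi> (s x) *\<^sub>R (x - x0)" for x
  define gX where "gX i x = \<Phi> (s x) *\<^sub>R i + (2 * \<Phi>' (s x) * (i \<bullet> (x - x0))) *\<^sub>R (x - x0)" for i x
  define k where "k x = real DIM('a) * \<Phi> (s x) + 2 * s x * \<Phi>' (s x)" for x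
  have X: "C1c (\<lambda>x. X x \<bullet> i) (gX i)" for i
    using C1c_radial[of \<Phi> \<Phi>' R i x0, OF \<Phi>] unfolding X_def gX_def s_def
    by (simp add: mult.commute inner_commute)
  have cX: "continuous_on UNIV X"
    by (rule continuous_on_componentwise[THEN iffD2]) (use C1c_cont[OF X] in auto)
  have cgv: "continuous_on UNIV gv" by (rule C1c_cont_grad[OF v])
  have c\<Phi>: "continuous_on UNIV \<Phi>"
    using DERIV_isCont[OF \<Phi>(1)] by (simp add: continuous_at_imp_continuous_on)
  have ck: "continuous_on UNIV k" unfolding k_def s_def
    by (intro continuous_intros continuous_on_compose2[OF c\<Phi>] continuous_on_compose2[OF \<Phi>(2)]) auto
  have div: "(\<Sum>i\<in>Basis. gX i x \<bullet> i) = k x" for x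
  proof -
    have "(\<Sum>i\<in>Basis. gX i x \<bullet> i) = (\<Sum>i\<in>Basis. \<Phi> (s x) + 2 * \<Phi>' (s x) * (((x - x0) \<bullet> i) * ((x - x0) \<bullet> i)))"
      unfolding gX_def by (intro sum.cong refl) (simp add: inner_add_left inner_commute[of _ "x - x0"])
    also have "\<dots> = real DIM('a) * \<Phi> (s x) + 2 * \<Phi>' (s x) * (\<Sum>i\<in>Basis. ((x - x0) \<bullet> i) * ((x - x0) \<bullet> i))"
      by (simp add: sum.distrib sum_distrib_left)
    also have "\<dots> = k x" by (simp add: k_def s_def power2_norm_eq_inner euclidean_inner[of "x - x0" "x - x0"])
    finally show ?thesis .
  qed
  \<comment> \<open>The Jacobian of \<open>X\<close> is symmetric, so its derivative in direction
    \<open>c\<close> is also the gradient of the component c \<bullet> X. That gradient is the left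
    integrand of the claim.\<close>
  have gXc: "(\<Sum>i\<in>Basis. (gv x \<bullet> i) * (gX i x \<bullet> c)) = (\<Phi> (s x) *\<^sub>R c + (2 * \<Phi>' (s x) * (c \<bullet> (x - x0))) *\<^sub>R (x - x0)) \<bullet> gv x" for x
  proof -
    have "(\<Sum>i\<in>Basis. (gv x \<bullet> i) * (gX i x \<bullet> c)) = (\<Sum>i\<in>Basis. \<Phi> (s x) * ((c \<bullet> i) * (gv x \<bullet> i))
         + 2 * \<Phi>' (s x) * (c \<bullet> (x - x0)) * (((x - x0) \<bullet> i) * (gv x \<bullet> i)))"
      unfolding gX_def by (intro sum.cong refl) (simp add: inner_add_left inner_commute algebra_simps)
    also have "\<dots> = \<Phi> (s x) * (\<Sum>i\<in>Basis. (c \<bullet> i) * (gv x \<bullet> i))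
         + 2 * \<Phi>' (s x) * (c \<bullet> (x - x0)) * (\<Sum>i\<in>Basis. ((x - x0) \<bullet> i) * (gv x \<bullet> i))"
      by (simp only: sum.distrib sum_distrib_left)
    also have "\<dots> = \<Phi> (s x) * (c \<bullet> gv x) + 2 * \<Phi>' (s x) * (c \<bullet> (x - x0)) * ((x - x0) \<bullet> gv x)"
      by (simp only: euclidean_inner[symmetric])
    finally show ?thesis by (simp add: inner_add_left)
  qed
  have cgvi: "continuous_on UNIV (\<lambda>x. gv x \<bullet> i)" for i by (intro continuous_intros cgv)
  define l where "l n = (\<Sum>i\<in>Basis. (LBINT x. (gv x \<bullet> i) * dq n c (\<lambda>x. X x \<bullet> i) x))" for n
  have "l \<longlonglongrightarrow> (\<Sum>i\<in>Basis. (LBINT x. (gv x \<bullet> i) * (gX i x \<bullet> c)))"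
    unfolding l_def by (intro tendsto_sum dq_integral_tendsto(3)[OF X cgvi])
  also have "(\<Sum>i\<in>Basis. (LBINT x. (gv x \<bullet> i) * (gX i x \<bullet> c)))
      = integral\<^sup>L lborel (\<lambda>x. \<Sum>i\<in>Basis. (gv x \<bullet> i) * (gX i x \<bullet> c))"
    by (rule Bochner_Integration.integral_sum[symmetric]) (rule dq_integral_tendsto(2)[OF X cgvi])
  finally have lim1: "l \<longlonglongrightarrow> (LBINT x. (\<Phi> (s x) *\<^sub>R c + (2 * \<Phi>' (s x) * (c \<bullet> (x - x0))) *\<^sub>R (x - x0)) \<bullet> gv x)"
    by (simp only: gXc)
  \<comment> \<open>Translating the variable moves the shift from \<open>X\<close> to
    \<open>gv\<close> and reverses its direction; only then is the divergence of \<open>X\<close>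
    brought in, against the difference of \<open>v\<close> in direction -c.\<close>
  have "l n = - (LBINT x. k x * dq n (-c) v x)" for n
  proof -
    define t where "t = 1 / real (Suc n)"
    have t: "real (Suc n) = 1 / t" "t > 0" by (auto simp: t_def)
    obtain R1 where R1: "\<And>x. norm x > R1 \<Longrightarrow> gv x = 0" using C1c_support[OF v] by metis
    have i0: "integrable lborel (\<lambda>x. X (x + t *\<^sub>R c) \<bullet> gv x)"
      by (rule integrable_cont_compact_support[of _ R1]) (use R1 in \<open>auto intro!: continuous_intros continuous_on_compose2[OF cX] cgv\<close>)
    have i1: "integrable lborel (\<lambda>x. X x \<bullet> gv x)"
      by (rule integrable_cont_compact_support[of _ R1]) (use R1 in \<open>auto intro!: continuous_intros cX cgv\<close>)
    have i2: "integrable lborel (\<lambda>x. X x \<bullet> gv (x - t *\<^sub>R c))"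
      using integrable_shift[OF i0, of "- t *\<^sub>R c"] by simp
    have "l n = integral\<^sup>L lborel (\<lambda>x. \<Sum>i\<in>Basis. (gv x \<bullet> i) * dq n c (\<lambda>x. X x \<bullet> i) x)"
      unfolding l_def by (rule Bochner_Integration.integral_sum[symmetric]) (rule dq_integral_tendsto(1)[OF X cgvi])
    also have "(\<lambda>x. \<Sum>i\<in>Basis. (gv x \<bullet> i) * dq n c (\<lambda>x. X x \<bullet> i) x) = (\<lambda>x. (1 / t) * (X (x + t *\<^sub>R c) \<bullet> gv x - X x \<bullet> gv x))"
    proof
      fix x
      have "(\<Sum>i\<in>Basis. (gv x \<bullet> i) * dq n c (\<lambda>x. X x \<bullet> i) x)
        = (\<Sum>i\<in>Basis. (1 / t) * (((X (x + t *\<^sub>R c) - X x) \<bullet> i) * (gv x \<bullet> i)))"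
        unfolding dq_def t_def[symmetric] unfolding t by (intro sum.cong refl) (simp add: inner_diff_left)
      also have "\<dots> = (1 / t) * ((X (x + t *\<^sub>R c) - X x) \<bullet> gv x)"
        by (simp only: sum_distrib_left[symmetric] euclidean_inner[symmetric])
      finally show "(\<Sum>i\<in>Basis. (gv x \<bullet> i) * dq n c (\<lambda>x. X x \<bullet> i) x) = (1 / t) * (X (x + t *\<^sub>R c) \<bullet> gv x - X x \<bullet> gv x)"
        by (simp add: inner_diff_left)
    qed
    also have "(LBINT x. (1 / t) * (X (x + t *\<^sub>R c) \<bullet> gv x - X x \<bullet> gv x))
        = (1 / t) * ((LBINT x. X (x + t *\<^sub>R c) \<bullet> gv x) - (LBINT x. X x \<bullet> gv x))"
      using i0 i1 by simp
    also have "(LBINT x. X (x + t *\<^sub>R c) \<bullet> gv x) = (LBINT x. X x \<bullet> gv (x - t *\<^sub>R c))"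
      using integral_shift[OF borel_measurable_integrable[OF i0, simplified], of "- t *\<^sub>R c"] by simp
    also have "\<dots> - (LBINT x. X x \<bullet> gv x) = (LBINT x. X x \<bullet> (gv (x - t *\<^sub>R c) - gv x))"
      using i1 i2 by (simp add: inner_diff_right)
    also have "\<dots> = - (LBINT x. (\<Sum>i\<in>Basis. gX i x \<bullet> i) * (v (x - t *\<^sub>R c) - v x))"
    proof (rule integration_by_parts[OF X])
      have "((\<lambda>x. v (x - t *\<^sub>R c)) has_derivative (\<lambda>h. gv (x - t *\<^sub>R c) \<bullet> h)) (at x)" for x
        by (rule has_derivative_compose[of "\<lambda>x. x - t *\<^sub>R c" "\<lambda>h. h"])
          (use C1c_deriv[OF v] in \<open>auto intro!: derivative_eq_intros\<close>)
      from has_derivative_diff[OF this C1c_deriv[OF v]]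
      show "((\<lambda>x. v (x - t *\<^sub>R c) - v x) has_derivative (\<lambda>h. (gv (x - t *\<^sub>R c) - gv x) \<bullet> h)) (at x)" for x
        by (simp add: inner_diff_left)
      show "continuous_on UNIV (\<lambda>x. gv (x - t *\<^sub>R c) - gv x)"
        by (intro continuous_intros continuous_on_compose2[OF cgv] cgv) auto
    qed
    also have "(1 / t) * - (LBINT x. (\<Sum>i\<in>Basis. gX i x \<bullet> i) * (v (x - t *\<^sub>R c) - v x))
       = - (LBINT x. (1 / t) * (k x * (v (x - t *\<^sub>R c) - v x)))" unfolding div by simp
    also have "(\<lambda>x. (1 / t) * (k x * (v (x - t *\<^sub>R c) - v x))) = (\<lambda>x. k x * dq n (-c) v x)"
      unfolding dq_def t_def[symmetric] unfolding t by (simp add: algebra_simps)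
    finally show ?thesis .
  qed
  then have "l \<longlonglongrightarrow> - (LBINT x. k x * (gv x \<bullet> (-c)))"
    using tendsto_minus[OF dq_integral_tendsto(3)[OF v ck, of "-c"]] by presburger
  then have "l \<longlonglongrightarrow> (LBINT x. k x * (gv x \<bullet> c))" by simp
  from LIMSEQ_unique[OF lim1 this] show ?thesis unfolding k_def s_def .
qed

section \<open>Translations in L2 and the Poincare inequality\<close>

lemma C1c_sq_integrable: "C1c u g \<Longrightarrow> integrable lborel (\<lambda>x. (u x)^2)"
proof -
  assume u: "C1c u g"
  obtain R where R: "\<And>x. norm x > R \<Longrightarrow> u x = 0" using C1c_support[OF u] by metis
  show ?thesis
    by (rule integrable_cont_compact_support[of _ R]) (use R in \<open>auto intro!: continuous_intros C1c_cont[OF u]\<close>)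
qed

lemma C1c_grad_integrable: 
  assumes u: "C1c u g" 
  shows "integrable lborel (\<lambda>x. (norm (g x))^2)" "integrable lborel (\<lambda>x. (g x \<bullet> e)^2)"
proof -
  obtain R where R: "\<And>x. norm x > R \<Longrightarrow> g x = 0" using C1c_support[OF u] by metis
  show "integrable lborel (\<lambda>x. (norm (g x))^2)" "integrable lborel (\<lambda>x. (g x \<bullet> e)^2)"
    by (rule integrable_cont_compact_support[of _ R]; use R in \<open>auto intro!: continuous_intros C1c_cont_grad[OF u]\<close>)+
qed

lemma C1c_shift_diff_sq_integrable:
  assumes u: "C1c u g"
  shows "integrable lborel (\<lambda>x. (u (x + a) - u (x + b))^2)"
proof -
  have e: "integrable lborel (\<lambda>x. (u (x + a))^2)" for a using integrable_shift[OF C1c_sq_integrable[OF u]] .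
  note [measurable] = borel_cont[OF C1c_cont[OF u]]
  show ?thesis
  proof (rule Bochner_Integration.integrable_bound[where f="\<lambda>x. 2 * (u (x + a))^2 + 2 * (u (x + b))^2"])
    show "integrable lborel (\<lambda>x. 2 * (u (x + a))^2 + 2 * (u (x + b))^2)" using e by simp
    have "(p - q)^2 \<le> 2 * p^2 + 2 * q^2" for p q :: real
      using zero_le_power2[of "p + q"] by (simp add: power2_eq_square algebra_simps)
    then show "AE x in lborel. norm ((u (x + a) - u (x + b))^2) \<le> norm (2 * (u (x + a))^2 + 2 * (u (x + b))^2)"
      by auto
  qed measurable
qed

text \<open>The shift by \<open>h\<close> is cut into m = n + 1 equal steps. Cauchy-Schwarz costs a
  factor m, and the m integrals agree by translation invariance, so the total is exactly the squared
  L2 norm of the n-th difference quotient; then n tends to infinity. This is why \<open>dq\<close>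
  uses the steps 1 / (n + 1).\<close>

lemma translation_inequality:
  assumes u: "C1c u g"
  shows "(LBINT x. (u (x + h) - u x)^2) \<le> (norm h)^2 * (LBINT x. (norm (g x))^2)"
proof -
  have cu: "continuous_on UNIV u" by (rule C1c_cont[OF u])
  note sh = C1c_shift_diff_sq_integrable[OF u]
  define I where "I = (LBINT x. (u (x + h) - u x)^2)"
  have le: "I \<le> (LBINT x. (dq n h u x)^2)" for n
  proof -
    define m where "m = Suc n"
    define d where "d = (1 / real m) *\<^sub>R h"
    have md: "real m *\<^sub>R d = h" by (simp add: d_def m_def)
    have p: "(u (x + h) - u x)^2 \<le> (\<Sum>k<m. (u (x + (real k *\<^sub>R d + d)) - u (x + real k *\<^sub>R d))^2) * real m" for x
    proof -
      have "u (x + h) - u x = (\<Sum>k<m. u (x + real (Suc k) *\<^sub>R d) - u (x + real k *\<^sub>R d))"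
        using sum_lessThan_telescope[of "\<lambda>k. u (x + real k *\<^sub>R d)" m] md by simp
      also have "\<dots> = (\<Sum>k<m. u (x + (real k *\<^sub>R d + d)) - u (x + real k *\<^sub>R d))"
        by (simp add: algebra_simps)
      finally show ?thesis using sum_squared_le_sum_of_squares[of _ "{..<m}"] by simp
    qed
    have e: "(LBINT x. (u (x + (real k *\<^sub>R d + d)) - u (x + real k *\<^sub>R d))^2) = (LBINT x. (u (x + d) - u x)^2)" for k
    proof -
      have "(\<lambda>x. (u (x + d) - u x)^2) \<in> borel_measurable borel"
        by (intro borel_cont continuous_intros continuous_on_compose2[OF cu] cu) auto
      from integral_shift[OF this, of "real k *\<^sub>R d"] show ?thesis by (simp add: add.assoc)
    qed
    have "I \<le> (LBINT x. (\<Sum>k<m. (u (x + (real k *\<^sub>R d + d)) - u (x + real k *\<^sub>R d))^2) * real m)"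
      unfolding I_def using sh[of h 0] sh p by (intro integral_mono) auto
    also have "\<dots> = (\<Sum>k<m. (LBINT x. (u (x + (real k *\<^sub>R d + d)) - u (x + real k *\<^sub>R d))^2)) * real m"
      using sh by simp
    also have "\<dots> = (\<Sum>k<m. (LBINT x. (u (x + d) - u x)^2)) * real m"
      by (simp only: e)
    also have "(\<Sum>k<m. (LBINT x. (u (x + d) - u x)^2)) * real m = (real m)^2 * (LBINT x. (u (x + d) - u x)^2)"
      by (simp add: power2_eq_square)
    also have "\<dots> = (LBINT x. (dq n h u x)^2)"
      unfolding dq_def d_def m_def by (simp add: power_mult_distrib)
    finally show ?thesis .
  qed
  have lim: "(\<lambda>n. (LBINT x. (dq n h u x)^2)) \<longlonglongrightarrow> (LBINT x. (g x \<bullet> h)^2)"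
  proof -
    obtain R B where B: "B \<ge> 0" "\<And>n x. \<bar>dq n h u x\<bar> \<le> B * indicator (cball 0 R) x"
      by (rule dq_bound[OF u, of h]) (rule that)
    note [measurable] = borel_cont[OF C1c_cont_grad[OF u]] borel_cont[OF dq_cont[OF u]]
    show ?thesis
    proof (rule integral_dominated_convergence[where w="\<lambda>x. indicator (cball 0 R) x *\<^sub>R B^2"])
      show "integrable lborel (\<lambda>x. indicator (cball (0::'a) R) x *\<^sub>R B^2)"
        by (intro borel_integrable_compact) auto
      show "AE x in lborel. (\<lambda>n. (dq n h u x)^2) \<longlonglongrightarrow> (g x \<bullet> h)^2"
        by (intro AE_I2 tendsto_intros dq_tendsto[OF u])
      show "AE x in lborel. norm ((dq n h u x)^2) \<le> indicator (cball 0 R) x *\<^sub>R B^2" for n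
      proof (rule AE_I2)
        fix x
        have "(dq n h u x)^2 \<le> (B * indicator (cball 0 R) x)^2"
          using B(2)[of n x] B(1) by (intro abs_le_square_iff[THEN iffD1]) (auto simp: abs_mult)
        then show "norm ((dq n h u x)^2) \<le> indicator (cball 0 R) x *\<^sub>R B^2"
          by (auto split: split_indicator simp: power_mult_distrib)
      qed
    qed auto
  qed
  have "I \<le> (LBINT x. (g x \<bullet> h)^2)"
    by (rule LIMSEQ_le_const[OF lim]) (use le in auto)
  also have "\<dots> \<le> (LBINT x. (norm h)^2 * (norm (g x))^2)"
  proof (intro integral_mono)
    show "(g x \<bullet> h)^2 \<le> (norm h)^2 * (norm (g x))^2" for x
      using power_mono[OF Cauchy_Schwarz_ineq2[of "g x" h], of 2] by (simp add: power_mult_distrib mult.commute)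
  qed (use C1c_grad_integrable[OF u] in auto)
  finally show ?thesis by (simp add: I_def)
qed

text \<open>A shift of length 2 R + 1 moves the support off itself, so the squared difference in the
  translation inequality integrates to twice the squared norm of \<open>u\<close>.\<close>

lemma poincare_C1c:
  fixes u :: "'a::euclidean_space \<Rightarrow> real"
  assumes u: "C1c u g" and R: "\<And>x. norm x > R \<Longrightarrow> u x = 0" "R \<ge> 0"
  shows "(LBINT x. (u x)^2) \<le> (2 * R + 1)^2 * (LBINT x. (norm (g x))^2)"
proof -
  obtain i :: 'a where i: "i \<in> Basis" using nonempty_Basis by blast
  define h where "h = (2 * R + 1) *\<^sub>R i"
  have nh: "norm h = 2 * R + 1" using i R by (simp add: h_def)
  have e: "(u (x + h) - u x)^2 = (u (x + h))^2 + (u x)^2" for x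
  proof -
    have "norm h \<le> norm (x + h) + norm x" by (metis add.commute add_diff_cancel_left' norm_triangle_ineq4)
    then have "norm (x + h) > R \<or> norm x > R" using nh by linarith
    then show ?thesis using R(1) by (auto simp: power2_eq_square)
  qed
  note s = C1c_sq_integrable[OF u]
  have "(\<lambda>x. (u x)^2) \<in> borel_measurable borel" using borel_measurable_integrable[OF s] by simp
  from integral_shift[OF this] have "(LBINT x. (u (x + h) - u x)^2) = 2 * (LBINT x. (u x)^2)"
    unfolding e using integrable_shift[OF s, of h] s by simp
  moreover have "0 \<le> (LBINT x. (u x)^2)" by (rule integral_nonneg_AE) simp
  ultimately show ?thesis using translation_inequality[OF u, of h] unfolding nh by linarith
qed


text \<open>Averaging the translation inequality over \<open>|h| < \<epsilon>\<close> bounds \<open>\<parallel>u\<parallel>\<^sup>2\<close> by the Dirichlet energy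
  and the local means \<open>M x\<close>.\<close>

lemma local_mean_inequality:
  fixes u :: "'a::euclidean_space \<Rightarrow> real"
  assumes u: "C1c u g" and R: "\<And>x. norm x > R \<Longrightarrow> u x = 0" and \<epsilon>: "\<epsilon> > 0"
    and K: "(LBINT x. (norm (g x))^2) \<le> K"
  defines "V \<equiv> measure lborel (ball (0::'a) \<epsilon>)"
  defines "M \<equiv> \<lambda>x. integral\<^sup>L lborel (\<lambda>y. if norm (y - x) < \<epsilon> then u y else 0)"
  shows "M \<in> borel_measurable borel" "\<And>x. \<bar>M x\<bar> \<le> (V + (LBINT x. (u x)^2)) / 2"
    "V^2 * (LBINT x. (u x)^2) \<le> V^2 * \<epsilon>^2 * K + (LBINT x. indicator (cball 0 R) x * (M x)^2)"
proof -
  note [measurable] = borel_cont[OF C1c_cont[OF u]]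
  have [measurable]: "ball x e \<in> sets borel" "cball x e \<in> sets borel" for x :: 'a and e by auto
  have V0: "V > 0" using content_ball_pos[OF \<epsilon>, of "0::'a"] by (simp add: V_def)
  have indi: "integrable lborel (\<lambda>y. indicator (ball x \<epsilon>) y * c)" for x :: 'a and c :: real
    using emeasure_lborel_ball_finite[of x \<epsilon>]
    by (intro integrable_mult_left integrable_real_indicator) auto
  have K0: "K \<ge> 0" using order_trans[OF _ K] by (simp add: integral_nonneg_AE)
  define N where "N = (LBINT x. (u x)^2)"
  have N0: "N \<ge> 0" by (simp add: N_def)
  note s = C1c_sq_integrable[OF u]
  have M': "M x = (LBINT y. indicator (ball x \<epsilon>) y * u y)" for x
    unfolding M_def by (intro Bochner_Integration.integral_cong) (auto simp: dist_norm norm_minus_commute)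
  have iM: "integrable lborel (\<lambda>y. indicator (ball x \<epsilon>) y * u y)" for x
  proof (rule Bochner_Integration.integrable_bound[OF C1c_integrable[OF u]])
    show "(\<lambda>y. indicator (ball x \<epsilon>) y * u y) \<in> borel_measurable lborel" by measurable
  qed (auto split: split_indicator)
  show Mm: "M \<in> borel_measurable borel"
  proof -
    have "(\<lambda>x::'a. integral\<^sup>L lborel (\<lambda>y. if norm (y - x) < \<epsilon> then u y else 0)) \<in> borel_measurable lborel"
      by measurable
    then show ?thesis by (simp add: M_def)
  qed
  have Vx: "measure lborel (ball x \<epsilon>) = V" for x :: 'a
    using content_ball_conv_unit_ball[of \<epsilon> x] content_ball_conv_unit_ball[of \<epsilon> "0::'a"] \<epsilon> by (simp add: V_def)
  show Mb: "\<bar>M x\<bar> \<le> (V + (LBINT x. (u x)^2)) / 2" for x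
  proof -
    have "\<bar>M x\<bar> \<le> (LBINT y. \<bar>indicator (ball x \<epsilon>) y * u y\<bar>)"
      unfolding M' by (rule integral_abs_bound)
    also have "\<dots> \<le> (LBINT y. indicator (ball x \<epsilon>) y * (1/2) + (u y)^2 / 2)"
    proof (intro integral_mono)
      show "integrable lborel (\<lambda>y. indicator (ball x \<epsilon>) y * (1/2) + (u y)^2 / 2)"
        by (rule Bochner_Integration.integrable_add[OF indi integrable_divide[OF s]])
      show "integrable lborel (\<lambda>y. \<bar>indicator (ball x \<epsilon>) y * u y\<bar>)"
        by (rule integrable_abs[OF iM])
      fix y
      have "\<bar>t\<bar> \<le> 1/2 + t^2/2" for t :: real
        using zero_le_power2[of "\<bar>t\<bar> - 1"] by (simp add: power2_eq_square algebra_simps)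
      then show "\<bar>indicator (ball x \<epsilon>) y * u y\<bar> \<le> indicator (ball x \<epsilon>) y * (1/2) + (u y)^2 / 2"
        by (auto split: split_indicator)
    qed
    also have "\<dots> = (V + N) / 2"
      using Bochner_Integration.integral_add[OF indi[of x "1/2"] integrable_divide[OF s, of 2]] Vx[of x]
      by (simp add: N_def add_divide_distrib)
    finally show ?thesis by (simp add: N_def)
  qed
  \<comment> \<open>Integrated in \<open>h\<close> this gives u * M; integrated in \<open>x\<close>
    it gives the autocorrelation of \<open>u\<close>, which equals N minus half the squared
    translation difference. Fubini equates the two.\<close>
  define F where "F x h = indicator (ball (0::'a) \<epsilon>) h * (u x * u (x + h))" for x h
  have F_int: "integrable (lborel \<Otimes>\<^sub>M lborel) (case_prod F)"
  proof -
    obtain B where B: "B \<ge> 0" "\<And>x. \<bar>u x\<bar> \<le> B"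
      using bounded_cont_compact_support[OF C1c_cont[OF u] R] by auto
    have A: "emeasure (lborel \<Otimes>\<^sub>M lborel) (cball (0::'a) R \<times> ball (0::'a) \<epsilon>) < \<infinity>"
      using emeasure_lborel_cball_finite[of "0::'a" R] emeasure_lborel_ball_finite[of "0::'a" \<epsilon>]
      by (subst lborel.emeasure_pair_measure_Times) (auto simp: ennreal_mult_less_top)
    have "integrable (lborel \<Otimes>\<^sub>M lborel) (\<lambda>p. indicator (cball (0::'a) R \<times> ball (0::'a) \<epsilon>) p * (B * B))"
      using A by (intro integrable_mult_left integrable_real_indicator) (auto intro: pair_measureI)
    then show ?thesis
    proof (rule Bochner_Integration.integrable_bound)
      show "case_prod F \<in> borel_measurable (lborel \<Otimes>\<^sub>M lborel)" unfolding F_def by measurable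
      have "\<bar>F x h\<bar> \<le> indicator (cball (0::'a) R \<times> ball (0::'a) \<epsilon>) (x, h) * (B * B)" for x h
        using R[of x] B mult_mono[OF B(2)[of x] B(2)[of "x + h"]] by (auto simp: F_def abs_mult split: split_indicator)
      then show "AE p in lborel \<Otimes>\<^sub>M lborel. norm (case_prod F p) \<le> norm (indicator (cball (0::'a) R \<times> ball (0::'a) \<epsilon>) p * (B * B))"
        using B(1) by (intro AE_I2) auto
    qed
  qed
  have Fu: "(LBINT h. (LBINT x. F x h)) = (LBINT x. (LBINT h. F x h))"
    by (rule lborel_pair.Fubini_integral[OF F_int])
  have in1: "(LBINT h. F x h) = u x * M x" for x
  proof -
    have "(LBINT h. F x h) = (LBINT h. u x * (if norm ((h + x) - x) < \<epsilon> then u (h + x) else 0))"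
      by (intro Bochner_Integration.integral_cong) (auto simp: F_def add.commute)
    also have "\<dots> = u x * integral\<^sup>L lborel (\<lambda>h. if norm ((h + x) - x) < \<epsilon> then u (h + x) else 0)"
      by simp
    also have "\<dots> = u x * M x"
      unfolding M_def by (subst integral_shift[of "\<lambda>y. if norm (y - x) < \<epsilon> then u y else 0" x]) auto
    finally show ?thesis .
  qed
  have in2: "indicator (ball 0 \<epsilon>) h * (N - \<epsilon>^2 * K / 2) \<le> (LBINT x. F x h)" for h
  proof (cases "h \<in> ball 0 \<epsilon>")
    case True
    note s' = integrable_shift[OF s, of h]
    have sd: "integrable lborel (\<lambda>x. (u (x + h) - u x)^2)"
      using C1c_shift_diff_sq_integrable[OF u, of h 0] by simp
    have "(LBINT x. F x h) = (LBINT x. ((u (x + h))^2 + (u x)^2 - (u (x + h) - u x)^2) / 2)"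
      using True by (intro Bochner_Integration.integral_cong) (auto simp: F_def power2_eq_square algebra_simps)
    also have "\<dots> = ((LBINT x. (u (x + h))^2) + N - (LBINT x. (u (x + h) - u x)^2)) / 2"
      using s s' sd by (simp add: N_def)
    finally have e1: "(LBINT x. F x h) = ((LBINT x. (u (x + h))^2) + N - (LBINT x. (u (x + h) - u x)^2)) / 2" .
    have e2: "(LBINT x. (u (x + h))^2) = N"
      unfolding N_def by (rule integral_shift) measurable
    have e3: "(LBINT x. (u (x + h) - u x)^2) \<le> \<epsilon>^2 * K"
      by (rule order_trans[OF translation_inequality[OF u]]) (use True K in \<open>auto intro!: mult_mono power_mono\<close>)
    have "N - \<epsilon>^2 * K / 2 \<le> (LBINT x. F x h)" 
      using e1 e3 unfolding e2 by argo
    then show ?thesis using True by simp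
  qed (simp add: F_def)
  have "integrable lborel (\<lambda>x. indicator (cball (0::'a) R) x * ((V + N) / 2)^2)"
    using emeasure_lborel_cball_finite[of "0::'a" R] by (intro integrable_mult_left integrable_real_indicator) auto
  then have iM2: "integrable lborel (\<lambda>x. indicator (cball 0 R) x * (M x)^2)"
  proof (rule Bochner_Integration.integrable_bound)
    have "(M x)^2 \<le> ((V + N) / 2)^2" for x
      using Mb[of x] V0 N0 unfolding N_def[symmetric] by (intro abs_le_square_iff[THEN iffD1]) auto
    then show "AE x in lborel. norm (indicator (cball 0 R) x * (M x)^2) \<le> norm (indicator (cball (0::'a) R) x * ((V + N) / 2)^2)"
      by (intro AE_I2) (auto split: split_indicator)
    note [measurable] = Mm
    show "(\<lambda>x. indicator (cball 0 R) x * (M x)^2) \<in> borel_measurable lborel" by measurable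
  qed
  have "V * (N - \<epsilon>^2 * K / 2) = (LBINT h. indicator (ball (0::'a) \<epsilon>) h * (N - \<epsilon>^2 * K / 2))"
    by (simp add: V_def)
  also have "\<dots> \<le> (LBINT h. (LBINT x. F x h))"
    by (intro integral_mono in2 indi lborel_pair.integrable_snd[OF F_int, simplified])
  also have "\<dots> = (LBINT x. u x * M x)" unfolding Fu in1 ..
  also have "\<dots> \<le> (LBINT x. V * (u x)^2 / 2 + indicator (cball 0 R) x * (M x)^2 / (2 * V))"
  proof (intro integral_mono)
    show "integrable lborel (\<lambda>x. u x * M x)"
      using lborel_pair.integrable_fst[OF F_int] in1 by simp
    show "integrable lborel (\<lambda>x. V * (u x)^2 / 2 + indicator (cball 0 R) x * (M x)^2 / (2 * V))"
      using s iM2 by simp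
    fix x
    \<comment> \<open>Young's inequality, weighted by V so that the first term contributes V * N / 2
      and can be absorbed on the left.\<close>
    have "u x * M x \<le> V * (u x)^2 / 2 + (M x)^2 / (2 * V)"
    proof -
      have "0 \<le> (V * u x - M x)^2 / (2 * V)" using V0 by simp
      also have "\<dots> = V * (u x)^2 / 2 + (M x)^2 / (2 * V) - u x * M x"
        using V0 by (simp add: power2_eq_square field_simps)
      finally show ?thesis by simp
    qed
    then show "u x * M x \<le> V * (u x)^2 / 2 + indicator (cball 0 R) x * (M x)^2 / (2 * V)"
      using R[of x] V0 by (auto split: split_indicator)
  qed
  also have "\<dots> = V * N / 2 + (LBINT x. indicator (cball 0 R) x * (M x)^2) / (2 * V)"
    using s iM2 by (simp add: N_def)
  finally have "V * (N - \<epsilon>^2 * K / 2) \<le> V * N / 2 + (LBINT x. indicator (cball 0 R) x * (M x)^2) / (2 * V)" .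
  then have "V * (N - \<epsilon>^2 * K / 2) * (2 * V) \<le> (V * N / 2 + (LBINT x. indicator (cball 0 R) x * (M x)^2) / (2 * V)) * (2 * V)"
    using V0 by (intro mult_right_mono) auto
  moreover have "V * (N - \<epsilon>^2 * K / 2) * (2 * V) = 2 * (V^2 * N) - V^2 * \<epsilon>^2 * K"
    by (simp add: algebra_simps power2_eq_square)
  moreover have "(V * N / 2 + J / (2 * V)) * (2 * V) = V^2 * N + J" for J
    using V0 by (simp add: algebra_simps power2_eq_square)
  ultimately show "V^2 * (LBINT x. (u x)^2) \<le> V^2 * \<epsilon>^2 * K + (LBINT x. indicator (cball 0 R) x * (M x)^2)"
    unfolding N_def[symmetric] by (simp add: mult.commute[of N])
qed

text \<open>Compactness without extracting subsequences. For fixed \<epsilon> the local means tend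
  to 0 pointwise and are bounded uniformly through the Poincare inequality, so dominated convergence
  on the ball of radius R removes the second term of \<open>local_mean_inequality\<close>; the first
  is small by the choice of \<epsilon>.\<close>

lemma rellich_sequence:
  fixes u :: "nat \<Rightarrow> 'a::euclidean_space \<Rightarrow> real"
  assumes u: "\<And>n. C1c (u n) (g n)" and R: "\<And>n x. norm x > R \<Longrightarrow> u n x = 0" "R \<ge> 0"
    and K: "\<And>n. (LBINT x. (norm (g n x))^2) \<le> K"
    and weak: "\<And>x \<epsilon>. \<epsilon> > 0 \<Longrightarrow> (\<lambda>n. integral\<^sup>L lborel (\<lambda>y. if norm (y - x) < \<epsilon> then u n y else 0)) \<longlonglongrightarrow> 0"
  shows "(\<lambda>n. (LBINT x. (u n x)^2)) \<longlonglongrightarrow> 0"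
proof (rule LIMSEQ_I)
  fix \<delta> :: real assume "\<delta> > 0"
  have K0: "K \<ge> 0" using order_trans[OF _ K] by (simp add: integral_nonneg_AE)
  \<comment> \<open>Makes the translation term \<epsilon>^2 * K at most \<delta> / 2; the summand 1
    covers K = 0.\<close>
  define \<epsilon> where "\<epsilon> = sqrt (\<delta> / (2 * (K + 1)))"
  have \<epsilon>: "\<epsilon> > 0" "\<epsilon>^2 * K \<le> \<delta> / 2" using \<open>\<delta> > 0\<close> K0 by (auto simp: \<epsilon>_def field_simps)
  define V where "V = measure lborel (ball (0::'a) \<epsilon>)"
  have V0: "V > 0" using content_ball_pos[OF \<epsilon>(1), of "0::'a"] by (simp add: V_def)
  define M where "M n x = integral\<^sup>L lborel (\<lambda>y. if norm (y - x) < \<epsilon> then u n y else 0)" for n x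
  have L: "M n \<in> borel_measurable borel" "\<bar>M n x\<bar> \<le> (V + (LBINT x. (u n x)^2)) / 2"
    "V^2 * (LBINT x. (u n x)^2) \<le> V^2 * \<epsilon>^2 * K + (LBINT x. indicator (cball 0 R) x * (M n x)^2)" for n x
    using local_mean_inequality[OF u[of n] R(1) \<epsilon>(1) K] unfolding M_def V_def by auto
  define P where "P = (2 * R + 1)^2 * K"
  have P: "(LBINT x. (u n x)^2) \<le> P" for n
    unfolding P_def by (rule order_trans[OF poincare_C1c[OF u R]]) (use K in \<open>auto intro!: mult_left_mono\<close>)
  have Mb: "(M n x)^2 \<le> ((V + P) / 2)^2" for n x
    using L(2)[where n=n and x=x] P[of n] V0 by (intro abs_le_square_iff[THEN iffD1]) auto
  have "(\<lambda>n. (LBINT x. indicator (cball 0 R) x * (M n x)^2)) \<longlonglongrightarrow> integral\<^sup>L lborel (\<lambda>x::'a. 0)"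
  proof (rule integral_dominated_convergence[where w="\<lambda>x. indicator (cball (0::'a) R) x * ((V + P) / 2)^2"])
    show "integrable lborel (\<lambda>x. indicator (cball (0::'a) R) x * ((V + P) / 2)^2)"
      using emeasure_lborel_cball_finite[of "0::'a" R] by (intro integrable_mult_left integrable_real_indicator) auto
    show "(\<lambda>x. indicator (cball 0 R) x * (M n x)^2) \<in> borel_measurable lborel" for n
    proof -
      have [measurable]: "M n \<in> borel_measurable borel" "cball (0::'a) R \<in> sets borel" using L(1)[where n=n] by auto
      show ?thesis by measurable
    qed
    show "AE x in lborel. (\<lambda>n. indicator (cball 0 R) x * (M n x)^2) \<longlonglongrightarrow> 0"
    proof (rule AE_I2)
      fix x :: 'a
      have "(\<lambda>n. indicator (cball 0 R) x * (M n x)^2) \<longlonglongrightarrow> indicator (cball 0 R) x * 0^2"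
        unfolding M_def by (intro tendsto_intros weak \<epsilon>)
      then show "(\<lambda>n. indicator (cball 0 R) x * (M n x)^2) \<longlonglongrightarrow> 0" by simp
    qed
    show "AE x in lborel. norm (indicator (cball 0 R) x * (M n x)^2) \<le> indicator (cball (0::'a) R) x * ((V + P) / 2)^2" for n
      using Mb by (intro AE_I2) (auto split: split_indicator)
  qed simp
  then have "eventually (\<lambda>n. (LBINT x. indicator (cball 0 R) x * (M n x)^2) < V^2 * (\<delta> / 2)) sequentially"
    by (rule order_tendstoD) (use V0 \<open>\<delta> > 0\<close> in auto)
  then obtain n0 where n0: "\<And>n. n \<ge> n0 \<Longrightarrow> (LBINT x. indicator (cball 0 R) x * (M n x)^2) < V^2 * (\<delta> / 2)"
    by (auto simp: eventually_sequentially)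
  have "(LBINT x. (u n x)^2) < \<delta>" if "n \<ge> n0" for n
  proof -
    have "V^2 * (LBINT x. (u n x)^2) \<le> V^2 * (\<epsilon>^2 * K) + (LBINT x. indicator (cball 0 R) x * (M n x)^2)"
      using L(3)[where n=n] by (simp add: mult.assoc)
    also have "\<dots> < V^2 * (\<delta> / 2) + V^2 * (\<delta> / 2)"
      using \<epsilon>(2) V0 n0[OF that] by (intro add_le_less_mono mult_left_mono) auto
    also have "\<dots> = V^2 * \<delta>" by simp
    finally show ?thesis using V0 by simp
  qed
  then show "\<exists>n0. \<forall>n\<ge>n0. norm ((LBINT x. (u n x)^2) - 0) < \<delta>" by auto
qed

section \<open>The Lebesgue differentiation theorem\<close>

text \<open>A Urysohn function between a closed set inside \<open>A\<close> and an open set around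
  it differs from the indicator only on the two small gaps, and there by at most 1.\<close>

lemma lebesgue_approx_continuous_indicator:
  fixes A :: "'a::euclidean_space set"
  assumes A: "A \<in> lmeasurable" and e: "e > 0"
  obtains g :: "'a \<Rightarrow> real" where "continuous_on UNIV g" "integrable lebesgue g"
    "(LINT x|lebesgue. \<bar>indicator A x - g x\<bar>) < e"
proof -
  have As: "A \<in> sets lebesgue" using A by (simp add: fmeasurableD)
  obtain U where U: "open U" "A \<subseteq> U" "U - A \<in> lmeasurable" "emeasure lebesgue (U - A) < ennreal (e/2)"
    using sets_lebesgue_outer_open[OF As, of "e/2"] e by auto
  obtain F where F: "closed F" "F \<subseteq> A" "A - F \<in> lmeasurable" "emeasure lebesgue (A - F) < ennreal (e/2)"
    using sets_lebesgue_inner_closed[OF As, of "e/2"] e by auto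
  have m: "measure lebesgue (U - A) < e/2" "measure lebesgue (A - F) < e/2"
    using U(3,4) F(3,4) e by (auto simp: emeasure_eq_measure2 ennreal_less_iff)
  obtain g :: "'a \<Rightarrow> real" where g: "continuous_on UNIV g" "\<And>x. g x \<in> closed_segment 1 0"
      "\<And>x. x \<in> F \<Longrightarrow> g x = 1" "\<And>x. x \<in> -U \<Longrightarrow> g x = 0"
    using Urysohn[of F "-U" 1 "0::real"] F U by blast
  have g01: "0 \<le> g x" "g x \<le> 1" for x using g(2)[of x] by (auto simp: closed_segment_eq_real_ivl)
  have Ul: "U \<in> lmeasurable"
    using fmeasurable.Un[OF A U(3)] U(2) by (simp add: Un_absorb1)
  have gm: "g \<in> borel_measurable lebesgue"
    using borel_measurable_continuous_onI[OF g(1)] by (simp add: measurable_completion)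
  have gi: "integrable lebesgue g"
  proof (rule Bochner_Integration.integrable_bound[OF _ gm])
    show "integrable lebesgue (indicator U :: 'a \<Rightarrow> real)" using Ul by (intro integrable_real_indicator) (auto simp: fmeasurable_def)
    show "AE x in lebesgue. norm (g x) \<le> norm (indicator U x :: real)"
      using g01 g(4) by (intro AE_I2) (auto split: split_indicator)
  qed
  have ind: "integrable lebesgue (indicator S :: 'a \<Rightarrow> real)" if "S \<in> lmeasurable" for S
    using that by (intro integrable_real_indicator) (auto simp: fmeasurable_def)
  have "(LINT x|lebesgue. \<bar>indicator A x - g x\<bar>) \<le> (LINT x|lebesgue. indicator (U - A) x + indicator (A - F) x)"
  proof (rule integral_mono)
    show "integrable lebesgue (\<lambda>x. \<bar>indicator A x - g x\<bar>)"
      using ind[OF A] gi by simp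
    show "integrable lebesgue (\<lambda>x. indicator (U - A) x + indicator (A - F) x :: real)"
      by (intro Bochner_Integration.integrable_add ind U F)
    show "\<bar>indicator A x - g x\<bar> \<le> indicator (U - A) x + indicator (A - F) x" for x
      using g01[of x] g(3)[of x] g(4)[of x] by (auto split: split_indicator)
  qed
  also have "\<dots> = measure lebesgue (U - A) + measure lebesgue (A - F)"
    using ind U(3) F(3) by simp
  also have "\<dots> < e" using m by linarith
  finally show thesis using that g(1) gi by blast
qed

lemma lebesgue_approx_continuous:
  fixes f :: "'a::euclidean_space \<Rightarrow> real"
  assumes "integrable lebesgue f" "e > 0"
  shows "\<exists>g. continuous_on UNIV g \<and> integrable lebesgue g \<and> (LINT x|lebesgue. \<bar>f x - g x\<bar>) < e"
  using assms
proof (induction f arbitrary: e rule: integrable_induct)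
  case (base A c)
  have A: "A \<in> lmeasurable" using base by (simp add: fmeasurable_def)
  obtain g :: "'a \<Rightarrow> real" where g: "continuous_on UNIV g" "integrable lebesgue g"
    "(LINT x|lebesgue. \<bar>indicator A x - g x\<bar>) < e / (\<bar>c\<bar> + 1)"
    using lebesgue_approx_continuous_indicator[OF A, of "e / (\<bar>c\<bar> + 1)"] base by auto
  have "(LINT x|lebesgue. \<bar>indicator A x *\<^sub>R c - c * g x\<bar>) = (LINT x|lebesgue. \<bar>c\<bar> * \<bar>indicator A x - g x\<bar>)"
    by (intro Bochner_Integration.integral_cong) (auto simp: abs_mult[symmetric] algebra_simps)
  also have "\<dots> = \<bar>c\<bar> * (LINT x|lebesgue. \<bar>indicator A x - g x\<bar>)" by simp
  also have "\<dots> \<le> \<bar>c\<bar> * (e / (\<bar>c\<bar> + 1))" using g(3) by (intro mult_left_mono) auto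
  also have "\<dots> < e" using base(3) by (simp add: field_simps)
  finally show ?case using g by (intro exI[of _ "\<lambda>x. c * g x"]) (auto intro!: continuous_intros)
next
  case (add f1 f2)
  obtain g1 where g1: "continuous_on UNIV g1" "integrable lebesgue g1" "(LINT x|lebesgue. \<bar>f1 x - g1 x\<bar>) < e/2"
    using add.IH(1)[of "e/2"] add.prems by auto
  obtain g2 where g2: "continuous_on UNIV g2" "integrable lebesgue g2" "(LINT x|lebesgue. \<bar>f2 x - g2 x\<bar>) < e/2"
    using add.IH(2)[of "e/2"] add.prems by auto
  have "(LINT x|lebesgue. \<bar>(f1 x + f2 x) - (g1 x + g2 x)\<bar>) \<le> (LINT x|lebesgue. \<bar>f1 x - g1 x\<bar> + \<bar>f2 x - g2 x\<bar>)"
    using add.hyps g1 g2 by (intro integral_mono integrable_abs Bochner_Integration.integrable_add Bochner_Integration.integrable_diff) auto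
  also have "\<dots> < e" using add.hyps g1 g2 by simp
  finally show ?case using g1 g2 by (intro exI[of _ "\<lambda>x. g1 x + g2 x"]) (auto intro!: continuous_intros)
next
  case (lim f s)
  have [measurable]: "f \<in> borel_measurable lebesgue" "s i \<in> borel_measurable lebesgue" for i
    using lim.hyps by auto
  have "(\<lambda>i. (LINT x|lebesgue. \<bar>f x - s i x\<bar>)) \<longlonglongrightarrow> integral\<^sup>L lebesgue (\<lambda>x::'a. 0)"
  proof (rule integral_dominated_convergence[where w="\<lambda>x. 3 * \<bar>f x\<bar>"])
    show "AE x in lebesgue. (\<lambda>i. \<bar>f x - s i x\<bar>) \<longlonglongrightarrow> 0"
    proof (rule AE_I2)
      fix x :: 'a
      have "(\<lambda>i. \<bar>f x - s i x\<bar>) \<longlonglongrightarrow> \<bar>f x - f x\<bar>" by (intro tendsto_intros lim.hyps) auto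
      then show "(\<lambda>i. \<bar>f x - s i x\<bar>) \<longlonglongrightarrow> 0" by simp
    qed
    show "AE x in lebesgue. norm \<bar>f x - s i x\<bar> \<le> 3 * \<bar>f x\<bar>" for i
    proof (rule AE_I2)
      fix x :: 'a
      show "norm \<bar>f x - s i x\<bar> \<le> 3 * \<bar>f x\<bar>"
        using lim.hyps(3)[of x i] abs_triangle_ineq4[of "f x" "s i x"] by simp
    qed
  qed (use lim.hyps in auto)
  then have "eventually (\<lambda>i. (LINT x|lebesgue. \<bar>f x - s i x\<bar>) < e/2) sequentially"
    by (rule order_tendstoD) (use lim.prems in auto)
  then obtain i where i: "(LINT x|lebesgue. \<bar>f x - s i x\<bar>) < e/2" by (auto simp: eventually_sequentially)
  obtain g where g: "continuous_on UNIV g" "integrable lebesgue g" "(LINT x|lebesgue. \<bar>s i x - g x\<bar>) < e/2"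
    using lim.IH half_gt_zero[OF lim.prems] by blast
  have "(LINT x|lebesgue. \<bar>f x - g x\<bar>) \<le> (LINT x|lebesgue. \<bar>f x - s i x\<bar> + \<bar>s i x - g x\<bar>)"
    using lim.hyps g by (intro integral_mono integrable_abs Bochner_Integration.integrable_add Bochner_Integration.integrable_diff) auto
  also have "\<dots> < e" using lim.hyps g i by simp
  finally show ?case using g by blast
qed

lemma integrable_ball_mult:
  fixes f :: "'a::euclidean_space \<Rightarrow> real"
  assumes "integrable lebesgue f"
  shows "integrable lebesgue (\<lambda>y. indicator (ball x r) y * f y)"
proof -
  have "integrable lebesgue (\<lambda>y. indicator (ball x r) y *\<^sub>R f y)"
    by (rule integrable_mult_indicator[OF _ assms]) auto
  then show ?thesis by simp
qed

text \<open>The bad radii occur arbitrarily close to 0, so the balls form a fine cover and Vitali's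
  theorem gives disjoint balls that cover \<open>S\<close> up to a null set; the constant is
  therefore 1. \<open>S\<close> itself is not claimed to be measurable, hence the superset
  \<open>T\<close>. The estimate is proved for finite subfamilies and passes to the countable
  union.\<close>

lemma weak_type_maximal:
  fixes h :: "'a::euclidean_space \<Rightarrow> real"
  assumes h: "integrable lebesgue h" "\<And>x. h x \<ge> 0" and t: "t > 0"
  defines "S \<equiv> {x. \<forall>d>0. \<exists>r. 0 < r \<and> r < d \<and> t * measure lebesgue (ball x r) < (LINT y|lebesgue. indicator (ball x r) y * h y)}"
  obtains T where "S \<subseteq> T" "T \<in> lmeasurable" "measure lebesgue T \<le> integral\<^sup>L lebesgue h / t"
proof -
  define K where "K = {(x, r). x \<in> S \<and> 0 < r \<and> t * measure lebesgue (ball x r) < (LINT y|lebesgue. indicator (ball x r) y * h y)}"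
  have cov: "\<exists>i. i \<in> K \<and> x \<in> ball (fst i) (snd i) \<and> snd i < d" if x: "x \<in> S" and d: "0 < d" for x d
  proof -
    from x d obtain r where "0 < r" "r < d" "t * measure lebesgue (ball x r) < (LINT y|lebesgue. indicator (ball x r) y * h y)"
      unfolding S_def by blast
    then show ?thesis using x by (intro exI[of _ "(x, r)"]) (auto simp: K_def)
  qed
  obtain C where C: "countable C" "C \<subseteq> K"
    "pairwise (\<lambda>i j. disjnt (ball (fst i) (snd i)) (ball (fst j) (snd j))) C"
    "negligible (S - (\<Union>i \<in> C. ball (fst i) (snd i)))"
    by (rule Vitali_covering_theorem_balls[of S K fst snd, OF cov]) (assumption, assumption, rule that)
  define B where "B i = ball (fst i) (snd i)" for i :: "'a \<times> real"
  have Bm: "B i \<in> lmeasurable" for i by (simp add: B_def)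
  have bound: "measure lebesgue (\<Union> (B ` I)) \<le> integral\<^sup>L lebesgue h / t" if I: "I \<subseteq> C" "finite I" for I
  proof -
    have "measure lebesgue (\<Union> (B ` I)) \<le> (\<Sum>i\<in>I. measure lebesgue (B i))"
      by (rule measure_UNION_le[OF I(2)]) (use Bm in \<open>auto simp: fmeasurableD\<close>)
    also have "\<dots> \<le> (\<Sum>i\<in>I. (LINT y|lebesgue. indicator (B i) y * h y) / t)"
    proof (rule sum_mono)
      fix i assume "i \<in> I"
      then have "i \<in> K" using I C by auto
      then have "t * measure lebesgue (B i) < (LINT y|lebesgue. indicator (B i) y * h y)"
        by (auto simp: K_def B_def)
      then show "measure lebesgue (B i) \<le> (LINT y|lebesgue. indicator (B i) y * h y) / t"
        using t by (simp add: field_simps)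
    qed
    also have "\<dots> = integral\<^sup>L lebesgue (\<lambda>y. \<Sum>i\<in>I. indicator (B i) y * h y) / t"
      unfolding B_def sum_divide_distrib[symmetric]
      by (subst Bochner_Integration.integral_sum) (auto intro: integrable_ball_mult[OF h(1)])
    also have "\<dots> \<le> integral\<^sup>L lebesgue h / t"
    proof (intro divide_right_mono integral_mono)
      show "integrable lebesgue (\<lambda>y. \<Sum>i\<in>I. indicator (B i) y * h y)"
        unfolding B_def by (intro Bochner_Integration.integrable_sum integrable_ball_mult[OF h(1)])
      fix y
      have dj: "disjoint_family_on B I"
        using C(3) I(1) unfolding disjoint_family_on_def pairwise_def disjnt_def B_def by blast
      have "(\<Sum>i\<in>I. indicator (B i) y * h y) = (\<Sum>i\<in>I. indicator (B i) y) * h y"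
        by (simp add: sum_distrib_right)
      also have "(\<Sum>i\<in>I. indicator (B i) y :: real) = indicator (\<Union> (B ` I)) y"
        by (rule indicator_UN_disjoint[OF I(2) dj, symmetric])
      finally show "(\<Sum>i\<in>I. indicator (B i) y * h y) \<le> h y"
        using h(2)[of y] by (auto split: split_indicator)
    qed (use h t in auto)
    finally show ?thesis .
  qed
  let ?U = "\<Union> (B ` C)"
  have U: "?U \<in> lmeasurable" by (rule fmeasurable_UN_bound[OF C(1) Bm bound])
  have mU: "measure lebesgue ?U \<le> integral\<^sup>L lebesgue h / t" by (rule measure_UN_bound[OF C(1) Bm bound])
  have N: "negligible (S - ?U)" using C(4) by (simp add: B_def)
  show thesis
  proof (rule that[of "?U \<union> (S - ?U)"])
    show "?U \<union> (S - ?U) \<in> lmeasurable" by (intro fmeasurable.Un U negligible_imp_measurable N)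
    have "measure lebesgue (?U \<union> (S - ?U)) = measure lebesgue ?U"
      by (rule measure_negligible_symdiff)
        (use U N in \<open>auto simp: fmeasurableD intro: negligible_subset[OF N]\<close>)
    then show "measure lebesgue (?U \<union> (S - ?U)) \<le> integral\<^sup>L lebesgue h / t" using mU by simp
  qed auto
qed

lemma continuous_average_bound:
  fixes g :: "'a::euclidean_space \<Rightarrow> real"
  assumes g: "continuous_on UNIV g" "integrable lebesgue g" and t: "t > 0"
  shows "\<exists>d>0. \<forall>r. 0 < r \<and> r < d \<longrightarrow>
     \<bar>(LINT y|lebesgue. indicator (ball x r) y * g y) - g x * measure lebesgue (ball x r)\<bar> \<le> t * measure lebesgue (ball x r)"
proof -
  obtain d where d: "d > 0" "\<And>y. dist y x < d \<Longrightarrow> \<bar>g y - g x\<bar> < t"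
    using g(1) t unfolding continuous_on_iff dist_real_def by (metis UNIV_I)
  show ?thesis
  proof (intro exI[of _ d] conjI allI impI d)
    fix r assume r: "0 < r \<and> r < d"
    have i: "integrable lebesgue (\<lambda>y. indicator (ball x r) y * c)" for c :: real
      by (intro integrable_mult_left integrable_real_indicator) (auto simp: emeasure_lborel_ball_finite[unfolded infinity_ennreal_def])
    have "(LINT y|lebesgue. indicator (ball x r) y * g y) - g x * measure lebesgue (ball x r)
       = (LINT y|lebesgue. indicator (ball x r) y * g y) - (LINT y|lebesgue. indicator (ball x r) y * g x)"
      by simp
    also have "\<dots> = (LINT y|lebesgue. indicator (ball x r) y * g y - indicator (ball x r) y * g x)"
      by (rule Bochner_Integration.integral_diff[OF integrable_ball_mult[OF g(2)] i, symmetric])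
    also have "\<bar>\<dots>\<bar> \<le> (LINT y|lebesgue. \<bar>indicator (ball x r) y * g y - indicator (ball x r) y * g x\<bar>)"
      by (rule integral_abs_bound)
    also have "\<dots> \<le> (LINT y|lebesgue. indicator (ball x r) y * t)"
    proof (rule integral_mono)
      show "integrable lebesgue (\<lambda>y. \<bar>indicator (ball x r) y * g y - indicator (ball x r) y * g x\<bar>)"
        by (intro integrable_abs Bochner_Integration.integrable_diff integrable_ball_mult g i)
      show "\<bar>indicator (ball x r) y * g y - indicator (ball x r) y * g x\<bar> \<le> indicator (ball x r) y * t" for y
        using d(2)[of y] r by (auto split: split_indicator simp: dist_commute)
    qed (rule i)
    finally show "\<bar>(LINT y|lebesgue. indicator (ball x r) y * g y) - g x * measure lebesgue (ball x r)\<bar> \<le> t * measure lebesgue (ball x r)"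
      by (simp add: mult.commute)
  qed
qed

text \<open>Averages of a continuous approximation \<open>g\<close> converge, and the remainder h =
  |f - g| is controlled twice: its averages by the weak-type bound, its value at the point by
  Markov's inequality.\<close>

theorem lebesgue_differentiation:
  fixes f :: "'a::euclidean_space \<Rightarrow> real"
  assumes f: "integrable lebesgue f"
  shows "AE x in lebesgue. ((\<lambda>r. (LINT y|lebesgue. indicator (ball x r) y * f y) / measure lebesgue (ball x r)) \<longlongrightarrow> f x) (at_right 0)"
proof -
  define A where "A x r = (LINT y|lebesgue. indicator (ball x r) y * f y)" for x r
  define v where "v x r = measure lebesgue (ball x r)" for x :: 'a and r
  have v0: "v x r > 0" if "r > 0" for x r using content_ball_pos[OF that, of x] by (simp add: v_def)
  \<comment> \<open>The factor 3 adds up three errors of size \<open>t\<close>: the averages of |f -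
    g|, the averages of \<open>g\<close> against g x, and |f x - g x|. Measurability of
    \<open>E t\<close> is avoided by bounding its outer measure.\<close>
  define E where "E t = {x. \<not> (\<exists>d>0. \<forall>r. 0 < r \<and> r < d \<longrightarrow> \<bar>A x r - f x * v x r\<bar> \<le> 3 * t * v x r)}" for t
  have neg: "negligible (E t)" if t: "t > 0" for t
    unfolding negligible_outer_le
  proof (intro allI impI)
    fix e :: real assume e: "e > 0"
    obtain g where g: "continuous_on UNIV g" "integrable lebesgue g" "(LINT x|lebesgue. \<bar>f x - g x\<bar>) < e * t / 2"
      using lebesgue_approx_continuous[OF f, of "e * t / 2"] e t by auto
    define h where "h x = \<bar>f x - g x\<bar>" for x
    have h: "integrable lebesgue h" "\<And>x. h x \<ge> 0" unfolding h_def using f g by auto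
    obtain T where T: "{x. \<forall>d>0. \<exists>r. 0 < r \<and> r < d \<and> t * measure lebesgue (ball x r) < (LINT y|lebesgue. indicator (ball x r) y * h y)} \<subseteq> T"
       "T \<in> lmeasurable" "measure lebesgue T \<le> integral\<^sup>L lebesgue h / t"
      by (rule weak_type_maximal[OF h t]) (rule that)
    define T' where "T' = {x\<in>space lebesgue. h x \<ge> t}"
    have T's: "T' \<in> sets lebesgue" unfolding T'_def using h(1) by measurable
    have T'e: "emeasure lebesgue T' \<le> ennreal (1 / t * integral\<^sup>L lebesgue h)"
      unfolding T'_def by (rule integral_Markov_inequality[OF h(1)]) (use h t in auto)
    then have T'm: "T' \<in> lmeasurable" using T's by (intro fmeasurableI) (auto intro: le_less_trans)
    have T'i: "measure lebesgue T' \<le> integral\<^sup>L lebesgue h / t"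
      unfolding T'_def by (rule integral_Markov_inequality_measure[OF h(1) sets.empty_sets]) (use h t in auto)
    have "E t \<subseteq> T \<union> T'"
    proof
      fix x assume x: "x \<in> E t"
      show "x \<in> T \<union> T'"
      proof (rule ccontr)
        assume n: "x \<notin> T \<union> T'"
        then have "\<not> (\<forall>d>0. \<exists>r. 0 < r \<and> r < d \<and> t * measure lebesgue (ball x r) < (LINT y|lebesgue. indicator (ball x r) y * h y))"
          using T(1) by blast
        then obtain d1 where d1: "d1 > 0" "\<And>r. 0 < r \<Longrightarrow> r < d1 \<Longrightarrow> (LINT y|lebesgue. indicator (ball x r) y * h y) \<le> t * v x r"
          unfolding v_def by (metis not_less)
        have hx: "h x < t" using n by (auto simp: T'_def)
        obtain d2 where d2: "d2 > 0" "\<And>r. 0 < r \<Longrightarrow> r < d2 \<Longrightarrow> \<bar>(LINT y|lebesgue. indicator (ball x r) y * g y) - g x * v x r\<bar> \<le> t * v x r"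
          using continuous_average_bound[OF g(1,2) t, of x] unfolding v_def by blast
        have "\<bar>A x r - f x * v x r\<bar> \<le> 3 * t * v x r" if r: "0 < r" "r < min d1 d2" for r
        proof -
          have "A x r - (LINT y|lebesgue. indicator (ball x r) y * g y) = (LINT y|lebesgue. indicator (ball x r) y * f y - indicator (ball x r) y * g y)"
            unfolding A_def by (rule Bochner_Integration.integral_diff[symmetric]) (intro integrable_ball_mult f g)+
          also have "\<bar>\<dots>\<bar> \<le> (LINT y|lebesgue. \<bar>indicator (ball x r) y * f y - indicator (ball x r) y * g y\<bar>)"
            by (rule integral_abs_bound)
          also have "\<dots> = (LINT y|lebesgue. indicator (ball x r) y * h y)"
            by (intro Bochner_Integration.integral_cong) (auto simp: h_def split: split_indicator)
          also have "\<dots> \<le> t * v x r" using d1 r by auto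
          finally have 1: "\<bar>A x r - (LINT y|lebesgue. indicator (ball x r) y * g y)\<bar> \<le> t * v x r" .
          have 2: "\<bar>(LINT y|lebesgue. indicator (ball x r) y * g y) - g x * v x r\<bar> \<le> t * v x r" using d2 r by auto
          have "\<bar>g x * v x r - f x * v x r\<bar> = h x * v x r"
            unfolding left_diff_distrib[symmetric] abs_mult h_def using v0[OF r(1), of x]
            by (simp only: abs_of_pos abs_minus_commute[of "g x"])
          then have 3: "\<bar>g x * v x r - f x * v x r\<bar> \<le> t * v x r" using hx v0[OF r(1), of x] by (simp add: mult_right_mono)
          show ?thesis using 1 2 3 by linarith
        qed
        then have "x \<notin> E t" unfolding E_def using d1(1) d2(1) by (auto intro!: exI[of _ "min d1 d2"])
        with x show False by simp
      qed
    qed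
    moreover have "measure lebesgue (T \<union> T') \<le> e"
    proof -
      have "measure lebesgue (T \<union> T') \<le> measure lebesgue T + measure lebesgue T'"
        by (rule measure_Un_le) (use T T's in \<open>auto simp: fmeasurableD\<close>)
      also have "\<dots> \<le> 2 * (integral\<^sup>L lebesgue h / t)" using T(3) T'i by simp
      also have "\<dots> \<le> e" using g(3) t unfolding h_def by (simp add: field_simps)
      finally show ?thesis .
    qed
    ultimately show "\<exists>T. E t \<subseteq> T \<and> T \<in> lmeasurable \<and> measure lebesgue T \<le> e"
      using T(2) T'm by (intro exI[of _ "T \<union> T'"]) (auto intro: fmeasurable.Un)
  qed
  have "negligible (\<Union>k::nat. E (1 / real (Suc k)))" by (intro negligible_countable_Union) (auto intro: neg)
  then have "AE x in lebesgue. x \<notin> (\<Union>k::nat. E (1 / real (Suc k)))"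
    unfolding negligible_iff_null_sets by (rule AE_not_in)
  then show ?thesis
  proof (rule AE_mp, intro AE_I2 impI)
    fix x assume x: "x \<notin> (\<Union>k::nat. E (1 / real (Suc k)))"
    have "((\<lambda>r. A x r / v x r) \<longlongrightarrow> f x) (at_right 0)"
    proof (rule tendstoI)
      fix e :: real assume e: "e > 0"
      obtain k :: nat where k: "3 / real (Suc k) < e"
      proof -
        obtain k where "inverse (real (Suc k)) < e / 3" using reals_Archimedean[of "e/3"] e by auto
        then show thesis by (intro that[of k]) (simp add: field_simps)
      qed
      obtain d where d: "d > 0" "\<And>r. 0 < r \<Longrightarrow> r < d \<Longrightarrow> \<bar>A x r - f x * v x r\<bar> \<le> 3 * (1 / real (Suc k)) * v x r"
        using x unfolding E_def by blast
      show "eventually (\<lambda>r. dist (A x r / v x r) (f x) < e) (at_right 0)"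
        unfolding eventually_at_right_field
      proof (intro exI[of _ d] conjI allI impI d)
        fix r assume r: "0 < r" "r < d"
        have vp: "v x r > 0" by (rule v0[OF r(1)])
        have "\<bar>A x r / v x r - f x\<bar> * v x r = \<bar>(A x r / v x r - f x) * v x r\<bar>" using vp by (simp add: abs_mult)
        also have "(A x r / v x r - f x) * v x r = A x r - f x * v x r" using vp by (simp add: field_simps)
        also have "\<bar>\<dots>\<bar> \<le> 3 / real (Suc k) * v x r" using d(2)[OF r] by simp
        finally have "\<bar>A x r / v x r - f x\<bar> \<le> 3 / real (Suc k)" using vp by (simp only: mult_le_cancel_right_pos)
        then show "dist (A x r / v x r) (f x) < e" using k by (simp add: dist_real_def)
      qed
    qed
    then show "((\<lambda>r. (LINT y|lebesgue. indicator (ball x r) y * f y) / measure lebesgue (ball x r)) \<longlongrightarrow> f x) (at_right 0)"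
      by (simp add: A_def v_def)
  qed
qed

section \<open>Square integrable functions\<close>

text \<open>Values lie in an arbitrary Euclidean space, so that states, gradients and the scalar
  coefficient share the same lemmas.\<close>

definition L2v :: "'m measure \<Rightarrow> ('m \<Rightarrow> 'b::euclidean_space) \<Rightarrow> bool" where
  "L2v M F \<longleftrightarrow> F \<in> borel_measurable M \<and> integrable M (\<lambda>x. (norm (F x))^2)"

definition l2sq :: "'m measure \<Rightarrow> ('m \<Rightarrow> 'b::euclidean_space) \<Rightarrow> real" where
  "l2sq M F = (LINT x|M. (norm (F x))^2)"

definition essbdd :: "'m measure \<Rightarrow> ('m \<Rightarrow> real) \<Rightarrow> bool" where
  "essbdd M c \<longleftrightarrow> c \<in> borel_measurable M \<and> (\<exists>K. AE x in M. \<bar>c x\<bar> \<le> K)"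

lemma L2_iff_L2v: "L2 \<Omega> u \<longleftrightarrow> L2v (lebesgue_on \<Omega>) u"
  by (simp add: L2_def L2v_def)

lemma l2sq_nonneg [simp]: "0 \<le> l2sq M F"
  by (simp add: l2sq_def)

lemma L2v_meas: "L2v M F \<Longrightarrow> F \<in> borel_measurable M" by (simp add: L2v_def)

lemma L2v_sq: "L2v M F \<Longrightarrow> integrable M (\<lambda>x. (norm (F x))^2)" by (simp add: L2v_def)

lemma L2v_bound:
  assumes "L2v M F" "G \<in> borel_measurable M" "AE x in M. norm (G x) \<le> K * norm (F x)"
  shows "L2v M G"
  unfolding L2v_def
proof (intro conjI assms(2))
  note [measurable] = assms(2)
  show "integrable M (\<lambda>x. (norm (G x))^2)"
  proof (rule Bochner_Integration.integrable_bound)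
    show "integrable M (\<lambda>x. K^2 * (norm (F x))^2)" using L2v_sq[OF assms(1)] by simp
    show "AE x in M. norm ((norm (G x))^2) \<le> norm (K^2 * (norm (F x))^2)"
      using assms(3)
    proof (rule AE_mp, intro AE_I2 impI)
      fix x assume "norm (G x) \<le> K * norm (F x)"
      then have "(norm (G x))^2 \<le> (K * norm (F x))^2" by (intro power_mono) auto
      then show "norm ((norm (G x))^2) \<le> norm (K^2 * (norm (F x))^2)" by (simp add: power_mult_distrib)
    qed
  qed measurable
qed

lemma norm_add_sq_le: "(norm (a + b))^2 \<le> 2 * (norm a)^2 + 2 * (norm (b::'b::real_inner))^2"
proof -
  have "(norm (a + b))^2 + (norm (a - b))^2 = 2 * (norm a)^2 + 2 * (norm b)^2"
    by (simp add: power2_norm_eq_inner inner_add_left inner_add_right inner_diff_left inner_diff_right inner_commute)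
  then show ?thesis using zero_le_power2[of "norm (a - b)"] by linarith
qed

lemma L2v_add:
  assumes "L2v M F" "L2v M G"
  shows "L2v M (\<lambda>x. F x + G x)"
  unfolding L2v_def
proof
  note [measurable] = L2v_meas[OF assms(1)] L2v_meas[OF assms(2)]
  show "(\<lambda>x. F x + G x) \<in> borel_measurable M" by measurable
  show "integrable M (\<lambda>x. (norm (F x + G x))^2)"
  proof (rule Bochner_Integration.integrable_bound)
    show "integrable M (\<lambda>x. 2 * (norm (F x))^2 + 2 * (norm (G x))^2)"
      using L2v_sq[OF assms(1)] L2v_sq[OF assms(2)] by simp
    show "AE x in M. norm ((norm (F x + G x))^2) \<le> norm (2 * (norm (F x))^2 + 2 * (norm (G x))^2)"
      using norm_add_sq_le by (intro AE_I2) auto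
  qed measurable
qed

lemma essbdd_const [simp]: "essbdd M (\<lambda>x. k)" by (auto simp: essbdd_def)

lemma essbdd_add: "essbdd M c \<Longrightarrow> essbdd M d \<Longrightarrow> essbdd M (\<lambda>x. c x + d x)"
  unfolding essbdd_def
proof (elim conjE exE, intro conjI)
  fix K L assume "AE x in M. \<bar>c x\<bar> \<le> K" "AE x in M. \<bar>d x\<bar> \<le> L"
  then have "AE x in M. \<bar>c x + d x\<bar> \<le> K + L" by eventually_elim linarith
  then show "\<exists>K. AE x in M. \<bar>c x + d x\<bar> \<le> K" by blast
qed measurable

lemma essbdd_mult: "essbdd M c \<Longrightarrow> essbdd M d \<Longrightarrow> essbdd M (\<lambda>x. c x * d x)"
  unfolding essbdd_def
proof (elim conjE exE, intro conjI)
  fix K L assume "AE x in M. \<bar>c x\<bar> \<le> K" "AE x in M. \<bar>d x\<bar> \<le> L"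
  then have "AE x in M. \<bar>c x * d x\<bar> \<le> \<bar>K\<bar> * \<bar>L\<bar>"
    by eventually_elim (auto simp: abs_mult intro!: mult_mono)
  then show "\<exists>K. AE x in M. \<bar>c x * d x\<bar> \<le> K" by blast
qed measurable

lemma L2v_scale: "essbdd M c \<Longrightarrow> L2v M F \<Longrightarrow> L2v M (\<lambda>x. c x *\<^sub>R F x)"
  unfolding essbdd_def
proof (elim conjE exE)
  fix K assume c [measurable]: "c \<in> borel_measurable M" and K: "AE x in M. \<bar>c x\<bar> \<le> K" and F: "L2v M F"
  note [measurable] = L2v_meas[OF F]
  show ?thesis
    by (rule L2v_bound[OF F, of _ K]) (use K in \<open>auto elim!: eventually_mono intro: mult_right_mono\<close>)
qed

lemma L2v_cmult: "L2v M F \<Longrightarrow> L2v M (\<lambda>x. k *\<^sub>R F x)"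
  by (rule L2v_scale) auto

lemma L2v_minus: "L2v M F \<Longrightarrow> L2v M (\<lambda>x. - F x)"
  using L2v_cmult[of M F "-1"] by simp

lemma L2v_diff: "L2v M F \<Longrightarrow> L2v M G \<Longrightarrow> L2v M (\<lambda>x. F x - G x)"
  using L2v_add[of M F "\<lambda>x. - G x"] L2v_minus by auto

lemma L2v_const: "finite_measure M \<Longrightarrow> L2v M (\<lambda>x. k)"
  by (auto simp: L2v_def finite_measure.integrable_const)

lemma L2v_inner_integrable:
  assumes "L2v M F" "L2v M G"
  shows "integrable M (\<lambda>x. F x \<bullet> G x)"
proof (rule Bochner_Integration.integrable_bound)
  note [measurable] = L2v_meas[OF assms(1)] L2v_meas[OF assms(2)]
  show "integrable M (\<lambda>x. (norm (F x))^2 + (norm (G x))^2)"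
    using L2v_sq[OF assms(1)] L2v_sq[OF assms(2)] by simp
  show "AE x in M. norm (F x \<bullet> G x) \<le> norm ((norm (F x))^2 + (norm (G x))^2)"
  proof (rule AE_I2)
    fix x
    have "\<bar>F x \<bullet> G x\<bar> \<le> norm (F x) * norm (G x)" by (rule Cauchy_Schwarz_ineq2)
    also have "\<dots> \<le> (norm (F x))^2 + (norm (G x))^2"
    proof -
      have "p * q \<le> p^2 + q^2" for p q :: real
        using zero_le_power2[of "p - q"] zero_le_power2[of p] zero_le_power2[of q] unfolding power2_diff by linarith
      then show ?thesis .
    qed
    finally show "norm (F x \<bullet> G x) \<le> norm ((norm (F x))^2 + (norm (G x))^2)" by simp
  qed
  show "(\<lambda>x. F x \<bullet> G x) \<in> borel_measurable M" by measurable
qed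

lemma L2v_weighted_integrable:
  assumes "essbdd M c" "L2v M F" "L2v M G"
  shows "integrable M (\<lambda>x. c x * (F x \<bullet> G x))"
  using L2v_inner_integrable[OF L2v_scale[OF assms(1,2)] assms(3)] by simp

text \<open>Serves two purposes: the Cauchy-Schwarz inequality, and the bound on the first variation
  of the energy at a nearly minimising function. The degenerate case A = 0 forces b = 0.\<close>

lemma nonneg_quadratic_discriminant:
  fixes A b e :: real
  assumes "\<And>t. 0 \<le> e + t * b + t^2 * A" "A \<ge> 0"
  shows "b^2 \<le> 4 * e * A"
proof (cases "A = 0")
  case True
  have "b = 0"
  proof (rule ccontr)
    assume "b \<noteq> 0"
    then show False using assms(1)[of "- (e + 1) / b"] True by simp
  qed
  then show ?thesis using True by simp
next
  case False
  then have A: "A > 0" using assms(2) by simp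
  have "0 \<le> (e + (- b / (2 * A)) * b + (- b / (2 * A))^2 * A) * (4 * A)"
    by (intro mult_nonneg_nonneg assms) simp
  also have "\<dots> = 4 * e * A - b^2" using A by (simp add: power2_eq_square field_simps)
  finally show ?thesis by simp
qed

lemma l2sq_expand:
  assumes "L2v M F" "L2v M G"
  shows "l2sq M (\<lambda>x. F x + t *\<^sub>R G x) = l2sq M F + t * (2 * (LINT x|M. F x \<bullet> G x)) + t^2 * l2sq M G"
proof -
  have "l2sq M (\<lambda>x. F x + t *\<^sub>R G x) = (LINT x|M. (norm (F x))^2 + (2 * t) * (F x \<bullet> G x) + t^2 * (norm (G x))^2)"
    unfolding l2sq_def power2_norm_eq_inner
    by (intro Bochner_Integration.integral_cong)
      (auto simp: inner_add_left inner_add_right inner_commute power2_eq_square[of t] algebra_simps)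
  also have "\<dots> = l2sq M F + (2 * t) * (LINT x|M. F x \<bullet> G x) + t^2 * l2sq M G"
    using L2v_sq[OF assms(1)] L2v_sq[OF assms(2)] L2v_inner_integrable[OF assms] by (simp add: l2sq_def)
  finally show ?thesis by simp
qed

lemma L2v_Cauchy_Schwarz:
  assumes "L2v M F" "L2v M G"
  shows "\<bar>(LINT x|M. F x \<bullet> G x)\<bar> \<le> sqrt (l2sq M F) * sqrt (l2sq M G)"
proof -
  have "(2 * (LINT x|M. F x \<bullet> G x))^2 \<le> 4 * l2sq M F * l2sq M G"
    by (rule nonneg_quadratic_discriminant) (auto simp: l2sq_expand[OF assms, symmetric])
  then have "((LINT x|M. F x \<bullet> G x))^2 \<le> l2sq M F * l2sq M G" by (simp add: power_mult_distrib)
  from real_sqrt_le_mono[OF this] show ?thesis by (simp add: real_sqrt_mult)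
qed

lemma l2sq_mono:
  assumes "L2v M F" "G \<in> borel_measurable M" "AE x in M. norm (G x) \<le> K * norm (F x)"
  shows "l2sq M G \<le> K^2 * l2sq M F"
proof -
  have "l2sq M G \<le> (LINT x|M. K^2 * (norm (F x))^2)"
    unfolding l2sq_def
  proof (rule integral_mono_AE[OF L2v_sq[OF L2v_bound[OF assms]]])
    show "integrable M (\<lambda>x. K^2 * (norm (F x))^2)" using L2v_sq[OF assms(1)] by simp
    show "AE x in M. (norm (G x))^2 \<le> K^2 * (norm (F x))^2"
      using assms(3) by eventually_elim (metis norm_ge_zero power_mono power_mult_distrib)
  qed
  then show ?thesis by (simp add: l2sq_def)
qed

lemma L2v_Cauchy_Schwarz_weighted:
  assumes c: "c \<in> borel_measurable M" "AE x in M. \<bar>c x\<bar> \<le> K" "K \<ge> 0" and "L2v M F" "L2v M G"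
  shows "\<bar>(LINT x|M. c x * (F x \<bullet> G x))\<bar> \<le> K * sqrt (l2sq M F) * sqrt (l2sq M G)"
proof -
  have cb: "essbdd M c" using c by (auto simp: essbdd_def)
  note cF = L2v_scale[OF cb assms(4)]
  have "\<bar>(LINT x|M. (c x *\<^sub>R F x) \<bullet> G x)\<bar> \<le> sqrt (l2sq M (\<lambda>x. c x *\<^sub>R F x)) * sqrt (l2sq M G)"
    by (rule L2v_Cauchy_Schwarz[OF cF assms(5)])
  also have "sqrt (l2sq M (\<lambda>x. c x *\<^sub>R F x)) \<le> sqrt (K^2 * l2sq M F)"
    by (intro real_sqrt_le_mono l2sq_mono[OF assms(4) L2v_meas[OF cF]])
      (use c(2) in \<open>auto elim!: eventually_mono intro: mult_right_mono\<close>)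
  also have "\<dots> = K * sqrt (l2sq M F)" using c(3) by (simp add: real_sqrt_mult)
  finally show ?thesis by (simp add: mult_right_mono)
qed

lemma l2_triangle:
  assumes "L2v M F" "L2v M G"
  shows "sqrt (l2sq M (\<lambda>x. F x + G x)) \<le> sqrt (l2sq M F) + sqrt (l2sq M G)"
proof (rule real_le_lsqrt)
  have "l2sq M (\<lambda>x. F x + G x) = l2sq M F + 2 * (LINT x|M. F x \<bullet> G x) + l2sq M G"
    using l2sq_expand[OF assms, of 1] by simp
  also have "\<dots> \<le> l2sq M F + 2 * (sqrt (l2sq M F) * sqrt (l2sq M G)) + l2sq M G"
    using L2v_Cauchy_Schwarz[OF assms] by simp
  also have "\<dots> = (sqrt (l2sq M F) + sqrt (l2sq M G))^2" by (simp add: power2_sum)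
  finally show "l2sq M (\<lambda>x. F x + G x) \<le> (sqrt (l2sq M F) + sqrt (l2sq M G))^2" .
qed auto

lemma l2sq_cmult: "l2sq M (\<lambda>x. k *\<^sub>R F x) = k^2 * l2sq M F"
  by (simp add: l2sq_def power_mult_distrib)

lemma l2sq_minus: "l2sq M (\<lambda>x. G x - F x) = l2sq M (\<lambda>x. F x - G x)"
  by (simp add: l2sq_def norm_minus_commute)

lemma l2_triangle_diff:
  assumes "L2v M F" "L2v M G"
  shows "sqrt (l2sq M F) \<le> sqrt (l2sq M (\<lambda>x. F x - G x)) + sqrt (l2sq M G)"
  using l2_triangle[OF L2v_diff[OF assms] assms(2)] by simp

lemma weighted_integral_tendsto:
  assumes c: "essbdd M c" and F: "\<And>n. L2v M (F n)" "L2v M F0" and G: "L2v M G"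
    and lim: "(\<lambda>n. l2sq M (\<lambda>x. F n x - F0 x)) \<longlonglongrightarrow> 0"
  shows "(\<lambda>n. (LINT x|M. c x * (F n x \<bullet> G x))) \<longlonglongrightarrow> (LINT x|M. c x * (F0 x \<bullet> G x))"
proof -
  obtain K where K: "AE x in M. \<bar>c x\<bar> \<le> K" using c by (auto simp: essbdd_def)
  then have K': "AE x in M. \<bar>c x\<bar> \<le> \<bar>K\<bar>" by eventually_elim linarith
  have cm: "c \<in> borel_measurable M" using c by (simp add: essbdd_def)
  have b: "norm ((LINT x|M. c x * (F n x \<bullet> G x)) - (LINT x|M. c x * (F0 x \<bullet> G x)))
      \<le> \<bar>K\<bar> * sqrt (l2sq M (\<lambda>x. F n x - F0 x)) * sqrt (l2sq M G)" for n
  proof -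
    have "(LINT x|M. c x * (F n x \<bullet> G x)) - (LINT x|M. c x * (F0 x \<bullet> G x))
        = (LINT x|M. c x * ((F n x - F0 x) \<bullet> G x))"
      unfolding inner_diff_left right_diff_distrib
      by (rule Bochner_Integration.integral_diff[symmetric]) (rule L2v_weighted_integrable[OF c _ G] F)+
    then show ?thesis
      using L2v_Cauchy_Schwarz_weighted[OF cm K' _ L2v_diff[OF F(1)[of n] F(2)] G] by simp
  qed
  have "(\<lambda>n. \<bar>K\<bar> * sqrt (l2sq M (\<lambda>x. F n x - F0 x)) * sqrt (l2sq M G)) \<longlonglongrightarrow> \<bar>K\<bar> * sqrt 0 * sqrt (l2sq M G)"
    by (intro tendsto_intros lim)
  then have "(\<lambda>n. (LINT x|M. c x * (F n x \<bullet> G x)) - (LINT x|M. c x * (F0 x \<bullet> G x))) \<longlonglongrightarrow> 0"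
    by (intro Lim_null_comparison[OF always_eventually[OF allI[OF b]]]) simp
  then show ?thesis by (simp add: LIM_zero_iff)
qed

lemma l2norm_tendsto:
  assumes F: "\<And>n. L2v M (F n)" "L2v M F0"
    and lim: "(\<lambda>n. l2sq M (\<lambda>x. F n x - F0 x)) \<longlonglongrightarrow> 0"
  shows "(\<lambda>n. l2sq M (F n)) \<longlonglongrightarrow> l2sq M F0"
proof -
  have b: "norm (sqrt (l2sq M (F n)) - sqrt (l2sq M F0)) \<le> sqrt (l2sq M (\<lambda>x. F n x - F0 x))" for n
    using l2_triangle_diff[OF F(1)[of n] F(2)] l2_triangle_diff[OF F(2) F(1)[of n]] l2sq_minus[of M F0 "F n"] by auto
  have "(\<lambda>n. sqrt (l2sq M (\<lambda>x. F n x - F0 x))) \<longlonglongrightarrow> 0" using tendsto_real_sqrt[OF lim] by simp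
  then have "(\<lambda>n. sqrt (l2sq M (F n)) - sqrt (l2sq M F0)) \<longlonglongrightarrow> 0"
    by (rule Lim_null_comparison[OF always_eventually[OF allI[OF b]]])
  then have "(\<lambda>n. sqrt (l2sq M (F n))) \<longlonglongrightarrow> sqrt (l2sq M F0)" by (simp add: LIM_zero_iff)
  from tendsto_power[OF this, of 2] show ?thesis by simp
qed

text \<open>On a finite measure space L2-Cauchy implies L1-Cauchy, which provides a subsequence
  converging almost everywhere. Fatou's lemma along that subsequence then turns the Cauchy bound
  into a bound on the distance to the limit.\<close>

lemma L2v_complete:
  fixes F :: "nat \<Rightarrow> 'm \<Rightarrow> 'b::euclidean_space"
  assumes fin: "finite_measure M" and F: "\<And>n. L2v M (F n)"
    and Cau: "\<And>e. e > 0 \<Longrightarrow> \<exists>N. \<forall>i\<ge>N. \<forall>j\<ge>N. l2sq M (\<lambda>x. F i x - F j x) < e"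
  obtains F0 where "L2v M F0" "(\<lambda>n. l2sq M (\<lambda>x. F n x - F0 x)) \<longlonglongrightarrow> 0"
proof -
  interpret finite_measure M by fact
  note [measurable] = L2v_meas[OF F]
  have one: "L2v M (\<lambda>x. 1::real)" by (rule L2v_const[OF fin])
  have nrm: "L2v M (\<lambda>x. norm (G x))" if "L2v M G" for G :: "'m \<Rightarrow> 'b"
    using that by (auto simp: L2v_def)
  have int1: "integrable M (\<lambda>x. norm (G x))" if "L2v M G" for G :: "'m \<Rightarrow> 'b"
    using L2v_inner_integrable[OF nrm[OF that] one] by simp
  have L1: "(LINT x|M. norm (G x)) \<le> sqrt (l2sq M G) * sqrt (measure M (space M))" if "L2v M G" for G :: "'m \<Rightarrow> 'b"
  proof -
    have "\<bar>(LINT x|M. norm (G x) \<bullet> (1::real))\<bar> \<le> sqrt (l2sq M (\<lambda>x. norm (G x))) * sqrt (l2sq M (\<lambda>x. 1::real))"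
      by (rule L2v_Cauchy_Schwarz[OF nrm[OF that] one])
    then show ?thesis by (simp add: l2sq_def)
  qed
  have Fint: "integrable M (F n)" for n
    using int1[OF F[of n]] L2v_meas[OF F[of n]] by (simp add: integrable_norm_iff)
  have "\<exists>N. \<forall>i\<ge>N. \<forall>j\<ge>N. (LINT x|M. norm (F i x - F j x)) < e" if e: "e > 0" for e
  proof -
    \<comment> \<open>The square of the tolerance that the factor sqrt (measure M (space M)) still
      turns into something below \<open>e\<close>; adding 1 covers a space of measure zero.\<close>
    define q where "q = (e / (sqrt (measure M (space M)) + 1))^2"
    have s0: "sqrt (measure M (space M)) + 1 > 0" by (simp add: add_nonneg_pos)
    have q: "q > 0" using e s0 by (simp add: q_def)
    obtain N where N: "\<And>i j. i \<ge> N \<Longrightarrow> j \<ge> N \<Longrightarrow> l2sq M (\<lambda>x. F i x - F j x) < q" using Cau[OF q] by blast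
    have "(LINT x|M. norm (F i x - F j x)) < e" if "i \<ge> N" "j \<ge> N" for i j
    proof -
      have "(LINT x|M. norm (F i x - F j x)) \<le> sqrt (l2sq M (\<lambda>x. F i x - F j x)) * sqrt (measure M (space M))"
        by (rule L1[OF L2v_diff[OF F F]])
      also have "\<dots> \<le> sqrt q * sqrt (measure M (space M))"
        using N[OF that] by (intro mult_right_mono real_sqrt_le_mono) auto
      also have "\<dots> = e * (sqrt (measure M (space M)) / (sqrt (measure M (space M)) + 1))"
        using e s0 by (simp add: q_def)
      also have "\<dots> < e * 1" using e s0 by (intro mult_strict_left_mono) (auto simp: divide_less_eq)
      finally show ?thesis by simp
    qed
    then show ?thesis by blast
  qed
  from cauchy_L1_AE_cauchy_subseq[OF Fint this]
  obtain r where r: "strict_mono r" "AE x in M. Cauchy (\<lambda>i. F (r i) x)" by metis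
  define F0 where "F0 x = lim (\<lambda>i. F (r i) x)" for x
  have F0m [measurable]: "F0 \<in> borel_measurable M"
    unfolding F0_def by (rule borel_measurable_lim_metric) measurable
  have lim: "AE x in M. (\<lambda>i. F (r i) x) \<longlonglongrightarrow> F0 x"
    using r(2) by eventually_elim (auto simp: F0_def Cauchy_convergent_iff convergent_LIMSEQ_iff)
  have Fat: "(\<integral>\<^sup>+x. ennreal ((norm (F n x - F0 x))^2) \<partial>M) \<le> ennreal e"
    if N: "\<And>i j. i \<ge> N \<Longrightarrow> j \<ge> N \<Longrightarrow> l2sq M (\<lambda>x. F i x - F j x) < e" and n: "n \<ge> N" for n N e
  proof -
    have "(\<integral>\<^sup>+x. ennreal ((norm (F n x - F0 x))^2) \<partial>M) = (\<integral>\<^sup>+x. liminf (\<lambda>i. ennreal ((norm (F n x - F (r i) x))^2)) \<partial>M)"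
    proof (rule nn_integral_cong_AE)
      show "AE x in M. ennreal ((norm (F n x - F0 x))^2) = liminf (\<lambda>i. ennreal ((norm (F n x - F (r i) x))^2))"
        using lim
      proof eventually_elim
        case (elim x)
        have "(\<lambda>i. ennreal ((norm (F n x - F (r i) x))^2)) \<longlonglongrightarrow> ennreal ((norm (F n x - F0 x))^2)"
          by (intro tendsto_ennrealI tendsto_intros elim)
        from lim_imp_Liminf[OF _ this] show ?case by simp
      qed
    qed
    also have "\<dots> \<le> liminf (\<lambda>i. \<integral>\<^sup>+x. ennreal ((norm (F n x - F (r i) x))^2) \<partial>M)"
      by (rule nn_integral_liminf) measurable
    also have "\<dots> \<le> liminf (\<lambda>i::nat. ennreal e)"
    proof (rule Liminf_mono)
      show "eventually (\<lambda>i. (\<integral>\<^sup>+x. ennreal ((norm (F n x - F (r i) x))^2) \<partial>M) \<le> ennreal e) sequentially"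
        unfolding eventually_sequentially
      proof (intro exI[of _ N] allI impI)
        fix i assume "i \<ge> N"
        then have ri: "r i \<ge> N" using seq_suble[OF r(1), of i] by linarith
        have "(\<integral>\<^sup>+x. ennreal ((norm (F n x - F (r i) x))^2) \<partial>M) = ennreal (l2sq M (\<lambda>x. F n x - F (r i) x))"
          unfolding l2sq_def by (rule nn_integral_eq_integral[OF L2v_sq[OF L2v_diff[OF F F]]]) simp
        also have "\<dots> \<le> ennreal e" using N[OF n ri] by (intro ennreal_leI) simp
        finally show "(\<integral>\<^sup>+x. ennreal ((norm (F n x - F (r i) x))^2) \<partial>M) \<le> ennreal e" .
      qed
    qed
    also have "\<dots> = ennreal e" by (rule Liminf_const) simp
    finally show ?thesis .
  qed
  have D: "L2v M (\<lambda>x. F n x - F0 x)" "l2sq M (\<lambda>x. F n x - F0 x) \<le> e"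
    if N: "\<And>i j. i \<ge> N \<Longrightarrow> j \<ge> N \<Longrightarrow> l2sq M (\<lambda>x. F i x - F j x) < e" and n: "n \<ge> N" for n N e
  proof -
    note f = Fat[OF N n]
    have e0: "e \<ge> 0" using N[OF n n] by (simp add: l2sq_def)
    have i: "integrable M (\<lambda>x. (norm (F n x - F0 x))^2)"
      by (rule integrableI_bounded) (use f in \<open>auto intro: le_less_trans\<close>)
    then show "L2v M (\<lambda>x. F n x - F0 x)" by (simp add: L2v_def)
    have "ennreal (l2sq M (\<lambda>x. F n x - F0 x)) = (\<integral>\<^sup>+x. ennreal ((norm (F n x - F0 x))^2) \<partial>M)"
      unfolding l2sq_def by (rule nn_integral_eq_integral[OF i, symmetric]) simp
    then have "ennreal (l2sq M (\<lambda>x. F n x - F0 x)) \<le> ennreal e" using f by (simp only:)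
    then show "l2sq M (\<lambda>x. F n x - F0 x) \<le> e" using e0 by (simp only: ennreal_le_iff)
  qed
  show thesis
  proof (rule that)
    obtain N where N: "\<And>i j. i \<ge> N \<Longrightarrow> j \<ge> N \<Longrightarrow> l2sq M (\<lambda>x. F i x - F j x) < 1" using Cau[of 1] by auto
    have "L2v M (\<lambda>x. F N x - (F N x - F0 x))" by (rule L2v_diff[OF F D(1)[OF N order_refl]])
    then show "L2v M F0" by simp
    show "(\<lambda>n. l2sq M (\<lambda>x. F n x - F0 x)) \<longlonglongrightarrow> 0"
    proof (rule LIMSEQ_I)
      fix e :: real assume "e > 0"
      then obtain N where N: "\<And>i j. i \<ge> N \<Longrightarrow> j \<ge> N \<Longrightarrow> l2sq M (\<lambda>x. F i x - F j x) < e / 2" using Cau[of "e/2"] by auto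
      have "l2sq M (\<lambda>x. F n x - F0 x) \<le> e / 2" if "n \<ge> N" for n by (rule D(2)[OF N that])
      then show "\<exists>N. \<forall>n\<ge>N. norm (l2sq M (\<lambda>x. F n x - F0 x) - 0) < e" using \<open>e > 0\<close> by (intro exI[of _ N]) force
    qed
  qed
qed

section \<open>The space of weakly differentiable functions with zero trace\<close>

lemma smooth_fun_grad:
  assumes "smooth_fun f"
  shows "(f has_derivative (\<lambda>h. grad f x \<bullet> h)) (at x)"
proof -
  have d: "(f has_derivative frechet_derivative f (at x)) (at x)"
    using smooth_fun_differentiable[OF assms] by (simp add: frechet_derivative_works)
  interpret linear "frechet_derivative f (at x)" using has_derivative_linear[OF d] .
  have "frechet_derivative f (at x) h = grad f x \<bullet> h" for h
  proof -
    have "frechet_derivative f (at x) h = frechet_derivative f (at x) (\<Sum>i\<in>Basis. (h \<bullet> i) *\<^sub>R i)"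
      by (simp only: euclidean_representation)
    also have "\<dots> = (\<Sum>i\<in>Basis. (h \<bullet> i) * frechet_derivative f (at x) i)"
      by (simp add: sum scaleR)
    also have "\<dots> = grad f x \<bullet> h"
      by (simp add: grad_def inner_sum_left inner_commute[of h] mult.commute)
    finally show ?thesis .
  qed
  then have "frechet_derivative f (at x) = (\<lambda>h. grad f x \<bullet> h)" by (rule ext)
  with d show ?thesis by simp
qed

lemma smooth_fun_cont_grad:
  assumes "smooth_fun (f :: 'a::euclidean_space \<Rightarrow> real)"
  shows "continuous_on UNIV (grad f)"
proof -
  have "continuous_on UNIV (\<lambda>x. frechet_derivative f (at x) i)" if "i \<in> Basis" for i
    using smooth_fun_differentiable[OF smooth_fun_pderiv[OF assms that]]
    by (intro continuous_at_imp_continuous_on ballI differentiable_imp_continuous_within) (simp add: pderiv_dir_def)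
  then show ?thesis unfolding grad_def[abs_def] by (intro continuous_intros)
qed

lemma has_derivative_grad:
  assumes "(f has_derivative (\<lambda>h. g \<bullet> h)) (at x)"
  shows "grad f x = g"
  using frechet_derivative_at[OF assms, symmetric] by (simp add: grad_def euclidean_representation)

lemma C1c_grad_eq: "C1c u g \<Longrightarrow> grad u = g"
  using has_derivative_grad[OF C1c_deriv] by blast

lemma smooth_fun_lincomb:
  assumes "smooth_fun f" "smooth_fun g"
  shows "smooth_fun (\<lambda>x. a * f x + b * g x)"
  using assms unfolding smooth_fun_iff_Ck by (intro allI Ck_add Ck_mult Ck_const) auto

lemma grad_lincomb:
  assumes "smooth_fun f" "smooth_fun g"
  shows "grad (\<lambda>x. a * f x + b * g x) = (\<lambda>x. a *\<^sub>R grad f x + b *\<^sub>R grad g x)"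
proof
  fix x
  show "grad (\<lambda>x. a * f x + b * g x) x = a *\<^sub>R grad f x + b *\<^sub>R grad g x"
    by (rule has_derivative_grad, rule has_derivative_eq_rhs,
        rule has_derivative_add[OF has_derivative_mult_right[OF smooth_fun_grad[OF assms(1)]]
          has_derivative_mult_right[OF smooth_fun_grad[OF assms(2)]]])
      (simp add: inner_add_left)
qed

lemma test_fun_smooth: "test_fun \<Omega> \<phi> \<Longrightarrow> smooth_fun \<phi>" by (simp add: test_fun_def)

lemma test_fun_C1c: "test_fun \<Omega> \<phi> \<Longrightarrow> C1c \<phi> (grad \<phi>)"
proof -
  assume t: "test_fun \<Omega> \<phi>"
  note s = test_fun_smooth[OF t]
  have "bounded (closure {x. \<phi> x \<noteq> 0})" using t by (simp add: test_fun_def compact_imp_bounded)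
  then obtain R where "\<And>x. x \<in> closure {x. \<phi> x \<noteq> 0} \<Longrightarrow> norm x \<le> R" by (auto simp: bounded_iff)
  then have "\<phi> x = 0" if "norm x > R" for x
    using that closure_subset[of "{x. \<phi> x \<noteq> 0}"] by force
  then show ?thesis using smooth_fun_grad[OF s] smooth_fun_cont_grad[OF s] by (auto simp: C1c_def)
qed

lemma test_fun_zero:
  assumes "test_fun \<Omega> \<phi>" "x \<notin> \<Omega>"
  shows "\<phi> x = 0" "grad \<phi> x = 0"
proof -
  have x: "x \<in> - closure {x. \<phi> x \<noteq> 0}" using assms by (auto simp: test_fun_def)
  then show "\<phi> x = 0" using closure_subset[of "{x. \<phi> x \<noteq> 0}"] by auto
  have "(\<phi> has_derivative (\<lambda>h. 0)) (at x)"
    by (rule has_derivative_transform_within_open[of "\<lambda>_. 0" _ _ _ "- closure {x. \<phi> x \<noteq> 0}"])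
      (use x closure_subset[of "{x. \<phi> x \<noteq> 0}"] in auto)
  then show "grad \<phi> x = 0" by (intro has_derivative_grad) simp
qed

lemma test_fun_lincomb:
  assumes "test_fun \<Omega> f" "test_fun \<Omega> g"
  shows "test_fun \<Omega> (\<lambda>x. a * f x + b * g x)"
proof -
  let ?S = "\<lambda>f. closure {x. f x \<noteq> (0::real)}"
  have sub: "?S (\<lambda>x. a * f x + b * g x) \<subseteq> ?S f \<union> ?S g"
    unfolding closure_Un[symmetric] by (intro closure_mono) auto
  have "compact (?S f \<union> ?S g)" using assms by (auto simp: test_fun_def)
  then have "compact (?S (\<lambda>x. a * f x + b * g x))"
    using compact_Int_closed[of "?S f \<union> ?S g" "?S (\<lambda>x. a * f x + b * g x)"] sub by (simp add: Int_absorb1)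
  moreover have "?S f \<subseteq> \<Omega>" "?S g \<subseteq> \<Omega>" using assms by (auto simp: test_fun_def)
  ultimately show ?thesis
    using sub smooth_fun_lincomb[of f g a b] assms unfolding test_fun_def by blast
qed

lemma test_fun_zero_fun: "test_fun \<Omega> (\<lambda>x. 0)"
  by (simp add: test_fun_def smooth_fun_iff_Ck)

section \<open>Function spaces on a bounded open set\<close>

locale bounded_open_set =
  fixes \<Omega> :: "'a::euclidean_space set"
  assumes open_Om: "open \<Omega>" and bounded_Om: "bounded \<Omega>"
begin

abbreviation "M \<equiv> lebesgue_on \<Omega>"

lemma Om_sets [simp, measurable]: "\<Omega> \<in> sets lebesgue" "\<Omega> \<in> sets borel" "\<Omega> \<in> lmeasurable"
  using open_Om bounded_Om by (auto simp: lmeasurable_open)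

lemma finite_M: "finite_measure M"
  by (rule finite_measure_lebesgue_on) simp

text \<open>The bridge between the completed measure on \<Omega>, in which the problem is posed, and
  \<open>lborel\<close>, in which the estimates for compactly supported functions are
  proved.\<close>

lemma
  fixes f :: "'a \<Rightarrow> 'b::{banach,second_countable_topology}"
  assumes "f \<in> borel_measurable borel" "\<And>x. x \<notin> \<Omega> \<Longrightarrow> f x = 0"
  shows integral_M_eq: "integral\<^sup>L M f = integral\<^sup>L lborel f"
    and integrable_M_eq: "integrable M f \<longleftrightarrow> integrable lborel f"
proof -
  have e: "(\<lambda>x. indicator \<Omega> x *\<^sub>R f x) = f" using assms(2) by (auto simp: fun_eq_iff split: split_indicator)
  show "integral\<^sup>L M f = integral\<^sup>L lborel f"
    using assms(1) by (subst integral_restrict_space) (auto simp: e integral_completion)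
  show "integrable M f \<longleftrightarrow> integrable lborel f"
    using assms(1) by (subst integrable_restrict_space) (auto simp: e integrable_completion)
qed

lemma borel_M: "f \<in> borel_measurable borel \<Longrightarrow> f \<in> borel_measurable M"
  by (simp add: measurable_completion measurable_restrict_space1)

lemma
  assumes "test_fun \<Omega> \<phi>"
  shows test_fun_L2v: "L2v M \<phi>" and test_fun_grad_L2v: "L2v M (grad \<phi>)"
    and test_fun_l2sq: "l2sq M \<phi> = (LBINT x. (\<phi> x)^2)"
    and test_fun_grad_l2sq: "l2sq M (grad \<phi>) = (LBINT x. (norm (grad \<phi> x))^2)"
proof -
  note C = test_fun_C1c[OF assms]
  have b [measurable]: "\<phi> \<in> borel_measurable borel" "grad \<phi> \<in> borel_measurable borel"
    by (intro borel_cont C1c_cont[OF C] C1c_cont_grad[OF C])+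
  have m: "(\<lambda>x. (norm (\<phi> x))^2) \<in> borel_measurable borel" "(\<lambda>x. (norm (grad \<phi> x))^2) \<in> borel_measurable borel"
    by measurable
  have z: "x \<notin> \<Omega> \<Longrightarrow> (norm (\<phi> x))^2 = 0" "x \<notin> \<Omega> \<Longrightarrow> (norm (grad \<phi> x))^2 = 0" for x
    using test_fun_zero[OF assms] by auto
  have "integrable M (\<lambda>x. (norm (\<phi> x))^2)"
    by (rule integrable_M_eq[THEN iffD2, OF m(1)]) (use z C1c_sq_integrable[OF C] in auto)
  then show "L2v M \<phi>" using borel_M[OF b(1)] by (simp add: L2v_def)
  have "integrable M (\<lambda>x. (norm (grad \<phi> x))^2)"
    by (rule integrable_M_eq[THEN iffD2, OF m(2)]) (use z C1c_grad_integrable(1)[OF C] in auto)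
  then show "L2v M (grad \<phi>)" using borel_M[OF b(2)] by (simp add: L2v_def)
  have "l2sq M \<phi> = (LBINT x. (norm (\<phi> x))^2)"
    unfolding l2sq_def by (rule integral_M_eq[OF m(1)]) (use z in auto)
  then show "l2sq M \<phi> = (LBINT x. (\<phi> x)^2)" by simp
  show "l2sq M (grad \<phi>) = (LBINT x. (norm (grad \<phi> x))^2)"
    unfolding l2sq_def by (rule integral_M_eq[OF m(2)]) (use z in auto)
qed

lemma H10_iff: "H10 \<Omega> u G \<longleftrightarrow> L2v M u \<and> L2v M G \<and>
   (\<exists>\<phi>. (\<forall>n. test_fun \<Omega> (\<phi> n)) \<and> (\<lambda>n. l2sq M (\<lambda>x. \<phi> n x - u x)) \<longlonglongrightarrow> 0
      \<and> (\<lambda>n. l2sq M (\<lambda>x. grad (\<phi> n) x - G x)) \<longlonglongrightarrow> 0)"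
  unfolding H10_def L2_iff_L2v by (auto simp: L2v_def l2sq_def)

lemma H10_test: "test_fun \<Omega> \<phi> \<Longrightarrow> H10 \<Omega> \<phi> (grad \<phi>)"
  unfolding H10_iff using test_fun_L2v test_fun_grad_L2v
  by (auto intro!: exI[of _ "\<lambda>n. \<phi>"] simp: l2sq_def)

lemma H10_L2v: "H10 \<Omega> u G \<Longrightarrow> L2v M u" "H10 \<Omega> u G \<Longrightarrow> L2v M G"
  by (auto simp: H10_iff)

lemma lincomb_l2sq_tendsto:
  fixes F :: "nat \<Rightarrow> 'a \<Rightarrow> 'b::euclidean_space"
  assumes F: "\<And>n. L2v M (F n)" "L2v M F0" "(\<lambda>n. l2sq M (\<lambda>x. F n x - F0 x)) \<longlonglongrightarrow> 0"
    and G: "\<And>n. L2v M (G n)" "L2v M G0" "(\<lambda>n. l2sq M (\<lambda>x. G n x - G0 x)) \<longlonglongrightarrow> 0"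
  shows "(\<lambda>n. l2sq M (\<lambda>x. (a *\<^sub>R F n x + b *\<^sub>R G n x) - (a *\<^sub>R F0 x + b *\<^sub>R G0 x))) \<longlonglongrightarrow> 0"
proof (rule Lim_null_comparison)
  show "(\<lambda>n. 2 * (a^2 * l2sq M (\<lambda>x. F n x - F0 x)) + 2 * (b^2 * l2sq M (\<lambda>x. G n x - G0 x))) \<longlonglongrightarrow> 0"
    using F(3) G(3) by (auto intro!: tendsto_eq_intros)
  have "l2sq M (\<lambda>x. (a *\<^sub>R F n x + b *\<^sub>R G n x) - (a *\<^sub>R F0 x + b *\<^sub>R G0 x))
     \<le> 2 * (a^2 * l2sq M (\<lambda>x. F n x - F0 x)) + 2 * (b^2 * l2sq M (\<lambda>x. G n x - G0 x))" for n
  proof -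
    note f = L2v_cmult[OF L2v_diff[OF F(1)[of n] F(2)], of a] and g = L2v_cmult[OF L2v_diff[OF G(1)[of n] G(2)], of b]
    have "l2sq M (\<lambda>x. (a *\<^sub>R F n x + b *\<^sub>R G n x) - (a *\<^sub>R F0 x + b *\<^sub>R G0 x))
      = l2sq M (\<lambda>x. a *\<^sub>R (F n x - F0 x) + b *\<^sub>R (G n x - G0 x))"
      by (simp add: algebra_simps)
    also have "\<dots> \<le> (LINT x|M. 2 * (norm (a *\<^sub>R (F n x - F0 x)))^2 + 2 * (norm (b *\<^sub>R (G n x - G0 x)))^2)"
      unfolding l2sq_def
      by (intro integral_mono norm_add_sq_le L2v_sq[OF L2v_add[OF f g]] Bochner_Integration.integrable_add
          integrable_mult_right L2v_sq[OF f] L2v_sq[OF g])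
    also have "\<dots> = 2 * l2sq M (\<lambda>x. a *\<^sub>R (F n x - F0 x)) + 2 * l2sq M (\<lambda>x. b *\<^sub>R (G n x - G0 x))"
      unfolding l2sq_def using L2v_sq[OF f] L2v_sq[OF g]
      by (subst Bochner_Integration.integral_add) (simp_all del: norm_scaleR)
    finally show ?thesis by (simp only: l2sq_cmult)
  qed
  then show "eventually (\<lambda>n. norm (l2sq M (\<lambda>x. (a *\<^sub>R F n x + b *\<^sub>R G n x) - (a *\<^sub>R F0 x + b *\<^sub>R G0 x)))
     \<le> 2 * (a^2 * l2sq M (\<lambda>x. F n x - F0 x)) + 2 * (b^2 * l2sq M (\<lambda>x. G n x - G0 x))) sequentially" by simp
qed

lemma H10_lincomb:
  assumes "H10 \<Omega> u G" "H10 \<Omega> v H"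
  shows "H10 \<Omega> (\<lambda>x. a * u x + b * v x) (\<lambda>x. a *\<^sub>R G x + b *\<^sub>R H x)"
proof -
  obtain \<phi> where \<phi>: "\<And>n. test_fun \<Omega> (\<phi> n)" "(\<lambda>n. l2sq M (\<lambda>x. \<phi> n x - u x)) \<longlonglongrightarrow> 0" "(\<lambda>n. l2sq M (\<lambda>x. grad (\<phi> n) x - G x)) \<longlonglongrightarrow> 0"
    using assms(1) unfolding H10_iff by blast
  obtain \<psi> where \<psi>: "\<And>n. test_fun \<Omega> (\<psi> n)" "(\<lambda>n. l2sq M (\<lambda>x. \<psi> n x - v x)) \<longlonglongrightarrow> 0" "(\<lambda>n. l2sq M (\<lambda>x. grad (\<psi> n) x - H x)) \<longlonglongrightarrow> 0"
    using assms(2) unfolding H10_iff by blast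
  note u = H10_L2v[OF assms(1)] and v = H10_L2v[OF assms(2)]
  have 1: "L2v M (\<lambda>x. a * u x + b * v x)"
    using L2v_add[OF L2v_cmult[OF u(1), of a] L2v_cmult[OF v(1), of b]] by simp
  have 2: "L2v M (\<lambda>x. a *\<^sub>R G x + b *\<^sub>R H x)"
    using L2v_add[OF L2v_cmult[OF u(2), of a] L2v_cmult[OF v(2), of b]] by simp
  have 3: "(\<lambda>n. l2sq M (\<lambda>x. (a * \<phi> n x + b * \<psi> n x) - (a * u x + b * v x))) \<longlonglongrightarrow> 0"
    using lincomb_l2sq_tendsto[OF test_fun_L2v[OF \<phi>(1)] u(1) \<phi>(2) test_fun_L2v[OF \<psi>(1)] v(1) \<psi>(2), of a b] by simp
  have 4: "(\<lambda>n. l2sq M (\<lambda>x. grad (\<lambda>x. a * \<phi> n x + b * \<psi> n x) x - (a *\<^sub>R G x + b *\<^sub>R H x))) \<longlonglongrightarrow> 0"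
    unfolding grad_lincomb[OF test_fun_smooth[OF \<phi>(1)] test_fun_smooth[OF \<psi>(1)]]
    by (rule lincomb_l2sq_tendsto[OF test_fun_grad_L2v[OF \<phi>(1)] u(2) \<phi>(3) test_fun_grad_L2v[OF \<psi>(1)] v(2) \<psi>(3)])
  show ?thesis unfolding H10_iff
    by (intro conjI 1 2 exI[of _ "\<lambda>n x. a * \<phi> n x + b * \<psi> n x"] 3 4 allI test_fun_lincomb \<phi> \<psi>)
qed

lemma H10_diff: "H10 \<Omega> u G \<Longrightarrow> H10 \<Omega> v H \<Longrightarrow> H10 \<Omega> (\<lambda>x. u x - v x) (\<lambda>x. G x - H x)"
  using H10_lincomb[of u G v H 1 "-1"] by simp

text \<open>The constant depends only on a ball containing \<Omega>, so it is common to all test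
  functions, and both norms pass to the limit along an approximating sequence.\<close>

lemma poincare:
  obtains P where "P \<ge> 0" "\<And>u G. H10 \<Omega> u G \<Longrightarrow> l2sq M u \<le> P * l2sq M G"
proof -
  obtain R where R: "R \<ge> 0" "\<And>x. x \<in> \<Omega> \<Longrightarrow> norm x \<le> R"
    using bounded_Om unfolding bounded_iff by (metis abs_ge_zero abs_le_D1 abs_le_iff le_cases order_trans)
  define P where "P = (2 * R + 1)^2"
  have t: "l2sq M \<phi> \<le> P * l2sq M (grad \<phi>)" if "test_fun \<Omega> \<phi>" for \<phi>
  proof -
    have "\<phi> x = 0" if "norm x > R" for x using test_fun_zero(1)[OF \<open>test_fun \<Omega> \<phi>\<close>] R(2)[of x] that by force
    from poincare_C1c[OF test_fun_C1c[OF that] this R(1)] show ?thesis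
      by (simp add: test_fun_l2sq[OF that] test_fun_grad_l2sq[OF that] P_def)
  qed
  have "l2sq M u \<le> P * l2sq M G" if H: "H10 \<Omega> u G" for u G
  proof -
    obtain \<phi> where \<phi>: "\<And>n. test_fun \<Omega> (\<phi> n)" "(\<lambda>n. l2sq M (\<lambda>x. \<phi> n x - u x)) \<longlonglongrightarrow> 0" "(\<lambda>n. l2sq M (\<lambda>x. grad (\<phi> n) x - G x)) \<longlonglongrightarrow> 0"
      using H unfolding H10_iff by blast
    note u = H10_L2v[OF H]
    show ?thesis
    proof (rule LIMSEQ_le)
      show "(\<lambda>n. l2sq M (\<phi> n)) \<longlonglongrightarrow> l2sq M u" by (rule l2norm_tendsto[OF test_fun_L2v[OF \<phi>(1)] u(1) \<phi>(2)])
      show "(\<lambda>n. P * l2sq M (grad (\<phi> n))) \<longlonglongrightarrow> P * l2sq M G"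
        by (intro tendsto_intros l2norm_tendsto[OF test_fun_grad_L2v[OF \<phi>(1)] u(2) \<phi>(3)])
      show "\<exists>N. \<forall>n\<ge>N. l2sq M (\<phi> n) \<le> P * l2sq M (grad (\<phi> n))" using t[OF \<phi>(1)] by auto
    qed
  qed
  then show thesis using that[of P] by (simp add: P_def)
qed

lemma admissible_essbdd: "admissible \<Omega> \<alpha> c \<Longrightarrow> essbdd M c"
  by (auto simp: admissible_def essbdd_def)

lemma admissible_coercive:
  assumes "admissible \<Omega> \<alpha> c" "L2v M F"
  shows "\<alpha> * l2sq M F \<le> (LINT x|M. c x * (F x \<bullet> F x))"
proof -
  have "\<alpha> * l2sq M F = (LINT x|M. \<alpha> * (norm (F x))^2)" by (simp add: l2sq_def)
  also have "\<dots> \<le> (LINT x|M. c x * (F x \<bullet> F x))"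
  proof (rule integral_mono_AE)
    show "integrable M (\<lambda>x. \<alpha> * (norm (F x))^2)" using L2v_sq[OF assms(2)] by simp
    show "integrable M (\<lambda>x. c x * (F x \<bullet> F x))"
      by (rule L2v_weighted_integrable[OF admissible_essbdd[OF assms(1)] assms(2,2)])
    have "AE x in M. \<alpha> \<le> c x" using assms(1) by (simp add: admissible_def)
    then show "AE x in M. \<alpha> * (norm (F x))^2 \<le> c x * (F x \<bullet> F x)"
      by eventually_elim (simp add: power2_norm_eq_inner mult_right_mono)
  qed
  finally show ?thesis .
qed

end

section \<open>Existence and uniqueness of weak solutions\<close>

context bounded_open_set
begin

lemma weighted_integral_diff:
  assumes "essbdd M c" "L2v M F" "L2v M G" "L2v M H"
  shows "(LINT x|M. c x * ((F x - G x) \<bullet> H x)) = (LINT x|M. c x * (F x \<bullet> H x)) - (LINT x|M. c x * (G x \<bullet> H x))"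
  unfolding inner_diff_left right_diff_distrib
  by (rule Bochner_Integration.integral_diff) (rule L2v_weighted_integrable[OF assms(1)] assms)+

lemma weighted_integral_commute:
  "(LINT x|M. c x * (F x \<bullet> G x)) = (LINT x|M. c x * (G x \<bullet> F x))"
  by (simp add: inner_commute)

text \<open>Both sides are continuous in the norm that defines \<open>H10\<close>, so the equation
  extends from test functions to their closure.\<close>

lemma weak_sol_from_test:
  assumes c: "essbdd M c" and g: "L2v M g" and u: "H10 \<Omega> u G"
    and t: "\<And>\<phi>. test_fun \<Omega> \<phi> \<Longrightarrow> (LINT x|M. c x * (G x \<bullet> grad \<phi> x)) = (LINT x|M. g x * \<phi> x)"
  shows "weak_sol \<Omega> c g u G"
  unfolding weak_sol_def
proof (intro conjI u allI impI)
  fix v H assume v: "H10 \<Omega> v H"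
  obtain \<phi> where \<phi>: "\<And>n. test_fun \<Omega> (\<phi> n)" "(\<lambda>n. l2sq M (\<lambda>x. \<phi> n x - v x)) \<longlonglongrightarrow> 0" "(\<lambda>n. l2sq M (\<lambda>x. grad (\<phi> n) x - H x)) \<longlonglongrightarrow> 0"
    using v unfolding H10_iff by blast
  note u' = H10_L2v[OF u] and v' = H10_L2v[OF v]
  have "(\<lambda>n. (LINT x|M. c x * (grad (\<phi> n) x \<bullet> G x))) \<longlonglongrightarrow> (LINT x|M. c x * (H x \<bullet> G x))"
    by (rule weighted_integral_tendsto[OF c test_fun_grad_L2v[OF \<phi>(1)] v'(2) u'(2) \<phi>(3)])
  then have l1: "(\<lambda>n. (LINT x|M. g x * \<phi> n x)) \<longlonglongrightarrow> (LINT x|M. c x * (G x \<bullet> H x))"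
    unfolding weighted_integral_commute[of c _ G] t[OF \<phi>(1)] .
  have "(\<lambda>n. (LINT x|M. 1 * (\<phi> n x \<bullet> g x))) \<longlonglongrightarrow> (LINT x|M. 1 * (v x \<bullet> g x))"
    by (rule weighted_integral_tendsto[OF essbdd_const test_fun_L2v[OF \<phi>(1)] v'(1) g \<phi>(2)])
  then have "(\<lambda>n. (LINT x|M. g x * \<phi> n x)) \<longlonglongrightarrow> (LINT x|M. g x * v x)"
    by (simp add: mult.commute)
  from LIMSEQ_unique[OF l1 this] show "(LINT x|M. c x * (G x \<bullet> H x)) = (LINT x|M. g x * v x)" .
qed

text \<open>A minimising sequence \<open>\<phi> n\<close> of test functions for the energy \<open>E\<close> is Cauchy: \<open>E\<close> is quadratic, so
  \<open>E (\<phi> n + t v) \<ge> inf E\<close> for all \<open>t\<close> bounds the first variation \<open>dE (\<phi> n) v\<close> by the discriminant.\<close>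

theorem weak_sol_exists:
  assumes adm: "admissible \<Omega> \<alpha> c" and \<alpha>: "\<alpha> > 0" and g: "L2 \<Omega> g"
  obtains u G where "weak_sol \<Omega> c g u G"
proof -
  note gv = g[unfolded L2_iff_L2v]
  note cb = admissible_essbdd[OF adm]
  define a where "a \<phi> \<psi> = (LINT x|M. c x * (grad \<phi> x \<bullet> grad \<psi> x))" for \<phi> \<psi>
  define l where "l \<phi> = (LINT x|M. g x * \<phi> x)" for \<phi>
  define E where "E \<phi> = a \<phi> \<phi> / 2 - l \<phi>" for \<phi>
  define T where "T = {\<phi>. test_fun \<Omega> \<phi>}"
  have ai: "integrable M (\<lambda>x. c x * (grad \<phi> x \<bullet> grad \<psi> x))" if "\<phi> \<in> T" "\<psi> \<in> T" for \<phi> \<psi>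
    using that by (intro L2v_weighted_integrable[OF cb] test_fun_grad_L2v) (auto simp: T_def)
  have li: "integrable M (\<lambda>x. g x * \<phi> x)" if "\<phi> \<in> T" for \<phi>
    using L2v_inner_integrable[OF gv test_fun_L2v[of \<phi>]] that by (simp add: T_def)
  have acom: "a \<phi> \<psi> = a \<psi> \<phi>" for \<phi> \<psi> by (simp add: a_def inner_commute)
  have Tlin: "(\<lambda>x. p * \<phi> x + q * \<psi> x) \<in> T" if "\<phi> \<in> T" "\<psi> \<in> T" for \<phi> \<psi> p q
    using that test_fun_lincomb by (auto simp: T_def)
  have a_lin: "a (\<lambda>x. p * \<phi> x + q * \<psi> x) \<eta> = p * a \<phi> \<eta> + q * a \<psi> \<eta>" if "\<phi> \<in> T" "\<psi> \<in> T" "\<eta> \<in> T" for \<phi> \<psi> \<eta> p q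
  proof -
    have "a (\<lambda>x. p * \<phi> x + q * \<psi> x) \<eta> = (LINT x|M. p * (c x * (grad \<phi> x \<bullet> grad \<eta> x)) + q * (c x * (grad \<psi> x \<bullet> grad \<eta> x)))"
      unfolding a_def using that by (subst grad_lincomb) (auto simp: T_def test_fun_smooth inner_add_left algebra_simps)
    also have "\<dots> = p * a \<phi> \<eta> + q * a \<psi> \<eta>"
      unfolding a_def using ai[OF that(1,3)] ai[OF that(2,3)] by simp
    finally show ?thesis .
  qed
  have l_lin: "l (\<lambda>x. p * \<phi> x + q * \<psi> x) = p * l \<phi> + q * l \<psi>" if "\<phi> \<in> T" "\<psi> \<in> T" for \<phi> \<psi> p q
  proof -
    have "l (\<lambda>x. p * \<phi> x + q * \<psi> x) = (LINT x|M. p * (g x * \<phi> x) + q * (g x * \<psi> x))"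
      unfolding l_def by (simp add: algebra_simps)
    then show ?thesis unfolding l_def using li[OF that(1)] li[OF that(2)] by simp
  qed
  have E_expand: "E (\<lambda>x. 1 * \<phi> x + t * v x) = E \<phi> + t * (a \<phi> v - l v) + t^2 * (a v v / 2)" if "\<phi> \<in> T" "v \<in> T" for \<phi> v t
  proof -
    let ?w = "\<lambda>x. 1 * \<phi> x + t * v x"
    have w: "?w \<in> T" by (rule Tlin[OF that])
    have "a ?w ?w = a \<phi> ?w + t * a v ?w" using a_lin[OF that w, of 1 t] by simp
    also have "a \<phi> ?w = a \<phi> \<phi> + t * a \<phi> v" using a_lin[OF that that(1), of 1 t] acom by simp
    also have "a v ?w = a \<phi> v + t * a v v" using a_lin[OF that that(2), of 1 t] acom by simp
    finally show ?thesis unfolding E_def using l_lin[OF that, of 1 t]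
      by (simp add: power2_eq_square field_simps)
  qed
  have a_coer: "\<alpha> * l2sq M (grad \<phi>) \<le> a \<phi> \<phi>" if "\<phi> \<in> T" for \<phi>
    unfolding a_def by (rule admissible_coercive[OF adm test_fun_grad_L2v]) (use that in \<open>simp add: T_def\<close>)
  have a_nn: "0 \<le> a \<phi> \<phi>" if "\<phi> \<in> T" for \<phi>
    using a_coer[OF that] \<alpha> l2sq_nonneg[of M "grad \<phi>"] by (meson mult_nonneg_nonneg less_imp_le order_trans)
  obtain P where P: "P \<ge> 0" "\<And>u G. H10 \<Omega> u G \<Longrightarrow> l2sq M u \<le> P * l2sq M G" by (rule poincare) (rule that)
  define K where "K = sqrt (l2sq M g) * sqrt P"
  \<comment> \<open>Coercivity and the Poincare inequality bound the energy below by \<alpha> x^2 /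
    2 - K x, where x is the L2 norm of the gradient; completing the square gives the minimum of this
    parabola.\<close>
  have E_low: "- (K^2 / (2 * \<alpha>)) \<le> E \<phi>" if "\<phi> \<in> T" for \<phi>
  proof -
    define x where "x = sqrt (l2sq M (grad \<phi>))"
    have t: "test_fun \<Omega> \<phi>" using that by (simp add: T_def)
    have "l \<phi> \<le> sqrt (l2sq M g) * sqrt (l2sq M \<phi>)"
      using L2v_Cauchy_Schwarz[OF gv test_fun_L2v[OF t]] unfolding l_def by simp
    also have "\<dots> \<le> sqrt (l2sq M g) * sqrt (P * l2sq M (grad \<phi>))"
      by (intro mult_left_mono real_sqrt_le_mono P(2)[OF H10_test[OF t]]) auto
    also have "\<dots> = K * x" by (simp add: K_def x_def real_sqrt_mult)
    finally have 1: "l \<phi> \<le> K * x" .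
    have 2: "\<alpha> * x^2 \<le> a \<phi> \<phi>" using a_coer[OF that] by (simp add: x_def)
    have "0 \<le> \<alpha> / 2 * (x - K / \<alpha>)^2" using \<alpha> by simp
    also have "\<dots> = \<alpha> * x^2 / 2 - K * x + K^2 / (2 * \<alpha>)" using \<alpha> by (simp add: power2_eq_square field_simps)
    finally show ?thesis using 1 2 unfolding E_def by linarith
  qed
  define m where "m = Inf (E ` T)"
  have bb: "bdd_below (E ` T)" using E_low by (auto intro!: bdd_belowI[of _ "- (K^2 / (2 * \<alpha>))"])
  have m_le: "m \<le> E \<phi>" if "\<phi> \<in> T" for \<phi> unfolding m_def using bb that by (intro cInf_lower) auto
  have Tne: "T \<noteq> {}" using test_fun_zero_fun by (auto simp: T_def)
  have "\<exists>\<phi>\<in>T. E \<phi> < m + 1 / real (Suc n)" for n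
  proof -
    have "Inf (E ` T) < m + 1 / real (Suc n)" by (simp add: m_def)
    then show ?thesis using cInf_less_iff[of "E ` T"] bb Tne by auto
  qed
  then obtain \<phi> where \<phi>: "\<And>n. \<phi> n \<in> T" "\<And>n. E (\<phi> n) < m + 1 / real (Suc n)" by metis
  define \<epsilon> where "\<epsilon> n = 1 / real (Suc n)" for n
  have \<epsilon>: "\<epsilon> n > 0" for n by (simp add: \<epsilon>_def)
  have \<epsilon>lim: "\<epsilon> \<longlonglongrightarrow> 0" using LIMSEQ_inverse_real_of_nat unfolding \<epsilon>_def[abs_def] by (simp add: inverse_eq_divide)
  have var: "(a (\<phi> n) v - l v)^2 \<le> 2 * \<epsilon> n * a v v" if v: "v \<in> T" for n v
  proof -
    have "(a (\<phi> n) v - l v)^2 \<le> 4 * \<epsilon> n * (a v v / 2)"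
    proof (rule nonneg_quadratic_discriminant)
      fix t
      have "m \<le> E (\<phi> n) + t * (a (\<phi> n) v - l v) + t^2 * (a v v / 2)"
        using m_le[OF Tlin[OF \<phi>(1)[of n] v, of 1 t]] unfolding E_expand[OF \<phi>(1) v] .
      then show "0 \<le> \<epsilon> n + t * (a (\<phi> n) v - l v) + t^2 * (a v v / 2)" using \<phi>(2)[of n] unfolding \<epsilon>_def by linarith
    qed (use a_nn[OF v] in simp)
    then show ?thesis by simp
  qed
  define D where "D i j = (\<lambda>x. 1 * \<phi> i x + (-1) * \<phi> j x)" for i j
  have DT: "D i j \<in> T" for i j unfolding D_def by (rule Tlin[OF \<phi>(1) \<phi>(1)])
  \<comment> \<open>The energy of the difference is the difference of the first variations at \<phi>
    i and \<phi> j in the direction \<open>D i j\<close>. Each squared variation is bounded by a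
    multiple of that same energy \<open>A\<close>, so one power of \<open>A\<close> cancels.\<close>
  have Da: "a (D i j) (D i j) \<le> 4 * (\<epsilon> i + \<epsilon> j)" for i j
  proof -
    define A where "A = a (D i j) (D i j)"
    have A0: "A \<ge> 0" unfolding A_def by (rule a_nn[OF DT])
    have "A = a (\<phi> i) (D i j) - a (\<phi> j) (D i j)"
      unfolding A_def using a_lin[OF \<phi>(1)[of i] \<phi>(1)[of j] DT[of i j], of 1 "-1"] by (simp add: D_def)
    also have "\<dots> = (a (\<phi> i) (D i j) - l (D i j)) - (a (\<phi> j) (D i j) - l (D i j))" by simp
    finally have "A^2 = ((a (\<phi> i) (D i j) - l (D i j)) - (a (\<phi> j) (D i j) - l (D i j)))^2" by simp
    also have "\<dots> \<le> 2 * (a (\<phi> i) (D i j) - l (D i j))^2 + 2 * (a (\<phi> j) (D i j) - l (D i j))^2"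
    proof -
      have "(p - q)^2 \<le> 2 * p^2 + 2 * q^2" for p q :: real
        using zero_le_power2[of "p + q"] by (simp add: power2_eq_square algebra_simps)
      then show ?thesis .
    qed
    also have "\<dots> \<le> 2 * (2 * \<epsilon> i * A) + 2 * (2 * \<epsilon> j * A)"
      unfolding A_def by (intro add_mono mult_left_mono var[OF DT]) auto
    also have "\<dots> = (4 * (\<epsilon> i + \<epsilon> j)) * A" by (simp add: algebra_simps)
    finally have "A * A \<le> (4 * (\<epsilon> i + \<epsilon> j)) * A" by (simp add: power2_eq_square)
    then have "A \<le> 4 * (\<epsilon> i + \<epsilon> j)"
      using A0 \<epsilon>[of i] \<epsilon>[of j] by (cases "A = 0") auto
    then show ?thesis by (simp add: A_def)
  qed
  have Dg: "l2sq M (\<lambda>x. grad (\<phi> i) x - grad (\<phi> j) x) \<le> 4 / \<alpha> * (\<epsilon> i + \<epsilon> j)" for i j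
  proof -
    have "grad (D i j) = (\<lambda>x. grad (\<phi> i) x - grad (\<phi> j) x)"
      unfolding D_def using \<phi>(1) by (subst grad_lincomb) (auto simp: T_def intro: test_fun_smooth)
    then show ?thesis using order_trans[OF a_coer[OF DT[of i j]] Da[of i j]] \<alpha> by (simp add: field_simps)
  qed
  have Df: "l2sq M (\<lambda>x. \<phi> i x - \<phi> j x) \<le> P * (4 / \<alpha> * (\<epsilon> i + \<epsilon> j))" for i j
  proof -
    have "H10 \<Omega> (\<lambda>x. \<phi> i x - \<phi> j x) (\<lambda>x. grad (\<phi> i) x - grad (\<phi> j) x)"
      using \<phi>(1) by (intro H10_diff H10_test) (auto simp: T_def)
    from order_trans[OF P(2)[OF this] mult_left_mono[OF Dg P(1)]] show ?thesis .
  qed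
  have small: "\<exists>N. \<forall>i\<ge>N. \<forall>j\<ge>N. q * (\<epsilon> i + \<epsilon> j) < e" if e: "e > 0" and q: "q \<ge> 0" for q e :: real
  proof -
    have "(\<lambda>n. q * \<epsilon> n) \<longlonglongrightarrow> q * 0" by (intro tendsto_intros \<epsilon>lim)
    then have "eventually (\<lambda>n. q * \<epsilon> n < e / 2) sequentially" using e by (intro order_tendstoD) auto
    then obtain N where N: "\<And>n. n \<ge> N \<Longrightarrow> q * \<epsilon> n < e / 2" by (auto simp: eventually_sequentially)
    show ?thesis
    proof (intro exI[of _ N] allI impI)
      fix i j assume "i \<ge> N" "j \<ge> N"
      then show "q * (\<epsilon> i + \<epsilon> j) < e" using N[of i] N[of j] by (simp add: distrib_left)
    qed
  qed
  have tf: "test_fun \<Omega> (\<phi> n)" for n using \<phi>(1) by (simp add: T_def)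
  obtain u where u: "L2v M u" "(\<lambda>n. l2sq M (\<lambda>x. \<phi> n x - u x)) \<longlonglongrightarrow> 0"
  proof (rule L2v_complete[OF finite_M test_fun_L2v[OF tf]])
    fix e :: real assume "e > 0"
    then obtain N where N: "\<forall>i\<ge>N. \<forall>j\<ge>N. P * (4 / \<alpha>) * (\<epsilon> i + \<epsilon> j) < e"
      using small[of e "P * (4 / \<alpha>)"] P(1) \<alpha> by auto
    then show "\<exists>N. \<forall>i\<ge>N. \<forall>j\<ge>N. l2sq M (\<lambda>x. \<phi> i x - \<phi> j x) < e" 
      using N by (intro exI[of _ N] allI impI le_less_trans[OF Df]) (simp only: mult.assoc)
  qed (rule that)
  obtain G where G: "L2v M G" "(\<lambda>n. l2sq M (\<lambda>x. grad (\<phi> n) x - G x)) \<longlonglongrightarrow> 0"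
  proof (rule L2v_complete[OF finite_M test_fun_grad_L2v[OF tf]])
    fix e :: real assume "e > 0"
    then obtain N where N: "\<forall>i\<ge>N. \<forall>j\<ge>N. 4 / \<alpha> * (\<epsilon> i + \<epsilon> j) < e"
      using small[of e "4 / \<alpha>"] \<alpha> by auto
    then show "\<exists>N. \<forall>i\<ge>N. \<forall>j\<ge>N. l2sq M (\<lambda>x. grad (\<phi> i) x - grad (\<phi> j) x) < e" 
      using N by (intro exI[of _ N] allI impI le_less_trans[OF Dg]) blast
  qed (rule that)
  have H: "H10 \<Omega> u G" unfolding H10_iff using u G tf by blast
  have "weak_sol \<Omega> c g u G"
  proof (rule weak_sol_from_test[OF cb gv H])
    fix v assume v: "test_fun \<Omega> v"
    have vT: "v \<in> T" using v by (simp add: T_def)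
    have "(\<lambda>n. a (\<phi> n) v) \<longlonglongrightarrow> (LINT x|M. c x * (G x \<bullet> grad v x))"
      unfolding a_def by (rule weighted_integral_tendsto[OF cb test_fun_grad_L2v[OF tf] G(1) test_fun_grad_L2v[OF v] G(2)])
    then have l1: "(\<lambda>n. (a (\<phi> n) v - l v)^2) \<longlonglongrightarrow> ((LINT x|M. c x * (G x \<bullet> grad v x)) - l v)^2"
      by (intro tendsto_intros)
    have "(\<lambda>n. 2 * \<epsilon> n * a v v) \<longlonglongrightarrow> 2 * 0 * a v v" by (intro tendsto_intros \<epsilon>lim)
    from LIMSEQ_le[OF l1 this] var[OF vT] have "((LINT x|M. c x * (G x \<bullet> grad v x)) - l v)^2 \<le> 0" by auto
    then show "(LINT x|M. c x * (G x \<bullet> grad v x)) = (LINT x|M. g x * v x)" by (simp add: l_def)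
  qed
  then show thesis by (rule that)
qed

lemma weak_sol_unique:
  assumes adm: "admissible \<Omega> \<alpha> c" and \<alpha>: "\<alpha> > 0"
    and u: "weak_sol \<Omega> c g u G" and v: "weak_sol \<Omega> c g v H"
  shows "l2sq M (\<lambda>x. u x - v x) = 0"
proof -
  have uH: "H10 \<Omega> u G" and vH: "H10 \<Omega> v H" using u v by (auto simp: weak_sol_def)
  note u' = H10_L2v[OF uH] and v' = H10_L2v[OF vH]
  note d = H10_diff[OF uH vH]
  note cb = admissible_essbdd[OF adm]
  have "\<alpha> * l2sq M (\<lambda>x. G x - H x) \<le> (LINT x|M. c x * ((G x - H x) \<bullet> (G x - H x)))"
    by (rule admissible_coercive[OF adm L2v_diff[OF u'(2) v'(2)]])
  also have "\<dots> = (LINT x|M. c x * (G x \<bullet> (G x - H x))) - (LINT x|M. c x * (H x \<bullet> (G x - H x)))"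
    by (rule weighted_integral_diff[OF cb u'(2) v'(2) L2v_diff[OF u'(2) v'(2)]])
  also have "\<dots> = 0" using u v d by (auto simp: weak_sol_def)
  finally have "\<alpha> * l2sq M (\<lambda>x. G x - H x) \<le> 0" .
  then have z: "l2sq M (\<lambda>x. G x - H x) = 0" using \<alpha> l2sq_nonneg[of M "\<lambda>x. G x - H x"] by (simp add: mult_le_0_iff)
  obtain P where "\<And>u G. H10 \<Omega> u G \<Longrightarrow> l2sq M u \<le> P * l2sq M G" by (rule poincare) (rule that)
  from this[OF d] z show ?thesis using l2sq_nonneg[of M "\<lambda>x. u x - v x"] by simp
qed

text \<open>States are unique only up to null sets, but the description operator in
  \<open>Jfun\<close> ranges over cost values, and these depend on the state only through an L2
  norm.\<close>

lemma Jfun_eq: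
  assumes adm: "admissible \<Omega> \<alpha> c" and \<alpha>: "\<alpha> > 0" and yd: "L2 \<Omega> yd"
    and y: "weak_sol \<Omega> c f y Gy"
  shows "Jfun \<Omega> f yd c = 1/2 * l2sq M (\<lambda>x. y x - yd x)"
  unfolding Jfun_def
proof (rule the_equality)
  have e: "(LINT x|M. (u x - yd x)^2) = l2sq M (\<lambda>x. u x - yd x)" for u by (simp add: l2sq_def)
  show "\<exists>u G. weak_sol \<Omega> c f u G \<and> 1/2 * l2sq M (\<lambda>x. y x - yd x) = 1/2 * (LINT x|M. (u x - yd x)^2)"
    using y e by auto
  fix j assume "\<exists>u G. weak_sol \<Omega> c f u G \<and> j = 1/2 * (LINT x|M. (u x - yd x)^2)"
  then obtain u G where u: "weak_sol \<Omega> c f u G" "j = 1/2 * l2sq M (\<lambda>x. u x - yd x)" using e by auto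
  have L: "L2v M u" "L2v M y" "L2v M yd" using u(1) y yd H10_L2v by (auto simp: weak_sol_def L2_iff_L2v)
  have z: "l2sq M (\<lambda>x. u x - y x) = 0" "l2sq M (\<lambda>x. y x - u x) = 0"
    using weak_sol_unique[OF adm \<alpha> u(1) y] weak_sol_unique[OF adm \<alpha> y u(1)] by auto
  have "sqrt (l2sq M (\<lambda>x. u x - yd x)) \<le> sqrt (l2sq M (\<lambda>x. y x - yd x))"
    using l2_triangle[OF L2v_diff[OF L(1,2)] L2v_diff[OF L(2,3)]] z by simp
  moreover have "sqrt (l2sq M (\<lambda>x. y x - yd x)) \<le> sqrt (l2sq M (\<lambda>x. u x - yd x))"
    using l2_triangle[OF L2v_diff[OF L(2,1)] L2v_diff[OF L(1,3)]] z by simp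
  ultimately show "j = 1/2 * l2sq M (\<lambda>x. y x - yd x)" using u(2) by simp
qed

end

section \<open>Lebesgue points and radial test functions\<close>

lemma lborel_integral_affine:
  fixes f :: "'a::euclidean_space \<Rightarrow> real"
  assumes [measurable]: "f \<in> borel_measurable borel" and r: "r > 0"
  shows "integral\<^sup>L lborel f = r ^ DIM('a) * (LBINT z. f (x0 + r *\<^sub>R z))"
proof -
  have "integral\<^sup>L lborel f = integral\<^sup>L (density (distr lborel borel (\<lambda>x. x0 + r *\<^sub>R x)) (\<lambda>_. ennreal (\<bar>r\<bar> ^ DIM('a)))) f"
    using lborel_affine[of r x0] r by simp
  also have "\<dots> = integral\<^sup>L (distr lborel borel (\<lambda>x. x0 + r *\<^sub>R x)) (\<lambda>x. (\<bar>r\<bar> ^ DIM('a)) *\<^sub>R f x)"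
    by (rule integral_density) auto
  also have "\<dots> = (LBINT z. (\<bar>r\<bar> ^ DIM('a)) *\<^sub>R f (x0 + r *\<^sub>R z))"
    by (rule integral_distr) auto
  finally show ?thesis using r by simp
qed

lemma lborel_integrable_affine:
  fixes f :: "'a::euclidean_space \<Rightarrow> real"
  assumes [measurable]: "f \<in> borel_measurable borel" and r: "r > 0" and i: "integrable lborel (\<lambda>z. f (x0 + r *\<^sub>R z))"
  shows "integrable lborel f"
proof -
  have "integrable (distr lborel borel (\<lambda>x. x0 + r *\<^sub>R x)) f"
    using i by (subst integrable_distr_eq) auto
  then have "integrable (density (distr lborel borel (\<lambda>x. x0 + r *\<^sub>R x)) (\<lambda>_. ennreal (\<bar>r\<bar> ^ DIM('a)))) f"
    by (subst integrable_density) auto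
  then show ?thesis using lborel_affine[of r x0] r by simp
qed

context bounded_open_set
begin

lemma M_ball_integral:
  assumes "ball x0 r \<subseteq> \<Omega>"
  shows "(LINT x|M. indicator (ball x0 r) x * k) = measure lebesgue (ball x0 r) * (k::real)"
proof -
  have "(LINT x|M. indicator (ball x0 r) x * k) = (LBINT x. indicator (ball x0 r) x * k)"
  proof (rule integral_M_eq)
    have [measurable]: "ball x0 r \<in> sets borel" by simp
    show "(\<lambda>x. indicator (ball x0 r) x * k) \<in> borel_measurable borel" by measurable
  qed (use assms in \<open>auto split: split_indicator\<close>)
  then show ?thesis by simp
qed


lemma essbdd_ball: "essbdd M (indicator (ball x r))"
proof -
  have "(indicator (ball x r) :: 'a \<Rightarrow> real) \<in> borel_measurable M" by (intro borel_M borel_measurable_indicator) auto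
  then show ?thesis
    by (auto simp: essbdd_def intro!: exI[of _ 1] AE_I2 split: split_indicator)
qed

text \<open>Expanding |F z - F x|^2 leaves only averages of |F|^2 and of the components of F, to
  which the differentiation theorem applies directly; the limits cancel. The functions are extended
  by zero outside \<Omega>, which is harmless since small balls around x stay inside.\<close>

lemma L2_lebesgue_points:
  fixes F :: "'a \<Rightarrow> 'b::euclidean_space"
  assumes F: "L2v M F"
  shows "AE x in M. ((\<lambda>r. l2sq M (\<lambda>z. indicator (ball x r) z *\<^sub>R (F z - F x)) / r ^ DIM('a)) \<longlongrightarrow> 0) (at_right 0)"
proof -
  define f1 where "f1 x = indicator \<Omega> x * (norm (F x))^2" for x
  define f2 where "f2 i x = indicator \<Omega> x * (F x \<bullet> i)" for i x
  define v where "v = measure lebesgue (ball (0::'a) 1)"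
  have v0: "v > 0" by (simp add: v_def)
  have i1: "integrable lebesgue f1"
    using L2v_sq[OF F] unfolding f1_def by (subst (asm) integrable_restrict_space) auto
  have i2: "integrable lebesgue (f2 i)" for i
    using L2v_inner_integrable[OF F L2v_const[OF finite_M, of i]] unfolding f2_def
    by (subst (asm) integrable_restrict_space) auto
  define A where "A f x r = (LINT y|lebesgue. indicator (ball x r) y * f y)" for f :: "'a \<Rightarrow> real" and x :: 'a and r
  have d1: "AE x in lebesgue. ((\<lambda>r. A f1 x r / measure lebesgue (ball x r)) \<longlongrightarrow> f1 x) (at_right 0)"
    unfolding A_def by (rule lebesgue_differentiation[OF i1])
  have d2: "AE x in lebesgue. \<forall>i\<in>Basis. ((\<lambda>r. A (f2 i) x r / measure lebesgue (ball x r)) \<longlongrightarrow> f2 i x) (at_right 0)"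
    by (rule AE_finite_allI[OF finite_Basis]) (unfold A_def, rule lebesgue_differentiation[OF i2])
  have "AE x in lebesgue. x \<in> \<Omega> \<longrightarrow> ((\<lambda>r. l2sq M (\<lambda>z. indicator (ball x r) z *\<^sub>R (F z - F x)) / r ^ DIM('a)) \<longlongrightarrow> 0) (at_right 0)"
    using d1 d2
  proof (eventually_elim, intro impI)
    fix x assume e1: "((\<lambda>r. A f1 x r / measure lebesgue (ball x r)) \<longlongrightarrow> f1 x) (at_right 0)"
      and e2: "\<forall>i\<in>Basis. ((\<lambda>r. A (f2 i) x r / measure lebesgue (ball x r)) \<longlongrightarrow> f2 i x) (at_right 0)"
      and x: "x \<in> \<Omega>"
    obtain d where d: "d > 0" "ball x d \<subseteq> \<Omega>" using open_Om x open_contains_ball by blast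
    have mb: "measure lebesgue (ball x r) = r ^ DIM('a) * v" if "r > 0" for r
      using content_ball_conv_unit_ball[of r x] that by (simp add: v_def)
    have form: "l2sq M (\<lambda>z. indicator (ball x r) z *\<^sub>R (F z - F x)) =
        A f1 x r - 2 * (\<Sum>i\<in>Basis. (F x \<bullet> i) * A (f2 i) x r) + (norm (F x))^2 * measure lebesgue (ball x r)" if r: "0 < r" "r < d" for r
    proof -
      have sub: "ball x r \<subseteq> \<Omega>" using d r by (meson order_trans subset_ball less_imp_le)
      have "l2sq M (\<lambda>z. indicator (ball x r) z *\<^sub>R (F z - F x)) = (LINT z|lebesgue. indicator \<Omega> z *\<^sub>R (norm (indicator (ball x r) z *\<^sub>R (F z - F x)))^2)"
        unfolding l2sq_def by (subst integral_restrict_space) auto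
      also have "\<dots> = (LINT z|lebesgue. indicator (ball x r) z * f1 z - 2 * (\<Sum>i\<in>Basis. (F x \<bullet> i) * (indicator (ball x r) z * f2 i z)) + (norm (F x))^2 * indicator (ball x r) z)"
      proof (intro Bochner_Integration.integral_cong refl)
        fix z
        show "indicator \<Omega> z *\<^sub>R (norm (indicator (ball x r) z *\<^sub>R (F z - F x)))^2 = indicator (ball x r) z * f1 z - 2 * (\<Sum>i\<in>Basis. (F x \<bullet> i) * (indicator (ball x r) z * f2 i z)) + (norm (F x))^2 * indicator (ball x r) z"
        proof (cases "z \<in> ball x r")
          case True
          then have zO: "z \<in> \<Omega>" using sub by auto
          have "(\<Sum>i\<in>Basis. (F x \<bullet> i) * (F z \<bullet> i)) = F x \<bullet> F z" by (rule euclidean_inner[symmetric])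
          then show ?thesis using True zO
            by (simp add: f1_def f2_def power2_norm_eq_inner inner_diff_left inner_diff_right inner_commute)
        qed simp
      qed
      also have "\<dots> = A f1 x r - 2 * (\<Sum>i\<in>Basis. (F x \<bullet> i) * A (f2 i) x r) + (norm (F x))^2 * measure lebesgue (ball x r)"
      proof -
        have b: "integrable lebesgue (indicator (ball x r) :: 'a \<Rightarrow> real)"
          by (intro integrable_real_indicator) (auto simp: emeasure_lborel_ball_finite[unfolded infinity_ennreal_def])
        note g1 = integrable_ball_mult[OF i1, of x r] and g2 = integrable_ball_mult[OF i2, of x r]
        show ?thesis unfolding A_def using g1 g2 b by simp
      qed
      finally show ?thesis .
    qed
    have "((\<lambda>r. A f1 x r / measure lebesgue (ball x r) - 2 * (\<Sum>i\<in>Basis. (F x \<bullet> i) * (A (f2 i) x r / measure lebesgue (ball x r))) + (norm (F x))^2) \<longlongrightarrow>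
        f1 x - 2 * (\<Sum>i\<in>Basis. (F x \<bullet> i) * f2 i x) + (norm (F x))^2) (at_right 0)"
      by (intro tendsto_intros e1 e2[rule_format])
    also have "f1 x - 2 * (\<Sum>i\<in>Basis. (F x \<bullet> i) * f2 i x) + (norm (F x))^2 = 0"
      using x by (simp add: f1_def f2_def power2_norm_eq_inner euclidean_inner[of "F x" "F x"])
    finally have "((\<lambda>r. (A f1 x r / measure lebesgue (ball x r) - 2 * (\<Sum>i\<in>Basis. (F x \<bullet> i) * (A (f2 i) x r / measure lebesgue (ball x r))) + (norm (F x))^2) * v) \<longlongrightarrow> 0 * v) (at_right 0)"
      by (intro tendsto_intros)
    then have "((\<lambda>r. (A f1 x r / measure lebesgue (ball x r) - 2 * (\<Sum>i\<in>Basis. (F x \<bullet> i) * (A (f2 i) x r / measure lebesgue (ball x r))) + (norm (F x))^2) * v) \<longlongrightarrow> 0) (at_right 0)"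
      by simp
    then show "((\<lambda>r. l2sq M (\<lambda>z. indicator (ball x r) z *\<^sub>R (F z - F x)) / r ^ DIM('a)) \<longlongrightarrow> 0) (at_right 0)"
    proof (rule Lim_transform_eventually)
      show "eventually (\<lambda>r. (A f1 x r / measure lebesgue (ball x r) - 2 * (\<Sum>i\<in>Basis. (F x \<bullet> i) * (A (f2 i) x r / measure lebesgue (ball x r))) + (norm (F x))^2) * v
          = l2sq M (\<lambda>z. indicator (ball x r) z *\<^sub>R (F z - F x)) / r ^ DIM('a)) (at_right 0)"
        unfolding eventually_at_right_field
      proof (intro exI[of _ d] conjI allI impI d)
        fix r assume r: "0 < r" "r < d"
        have "(\<Sum>i\<in>Basis. (F x \<bullet> i) * (A (f2 i) x r / (r ^ DIM('a) * v))) = (\<Sum>i\<in>Basis. (F x \<bullet> i) * A (f2 i) x r) / (r ^ DIM('a) * v)"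
          by (simp add: sum_divide_distrib)
        then show "(A f1 x r / measure lebesgue (ball x r) - 2 * (\<Sum>i\<in>Basis. (F x \<bullet> i) * (A (f2 i) x r / measure lebesgue (ball x r))) + (norm (F x))^2) * v
          = l2sq M (\<lambda>z. indicator (ball x r) z *\<^sub>R (F z - F x)) / r ^ DIM('a)"
          unfolding form[OF r] mb[OF r(1)] using v0 r by (simp add: field_simps)
      qed
    qed
  qed
  then show ?thesis by (subst AE_restrict_space_iff) auto
qed

lemma test_fun_radial:
  assumes \<Phi>: "\<And>n. Ck n \<Phi>" "\<And>s. s \<ge> R \<Longrightarrow> \<Phi> s = 0" and R: "R > 0" "cball x0 (sqrt R) \<subseteq> \<Omega>"
  shows "test_fun \<Omega> (\<lambda>x. (e \<bullet> (x - x0)) * \<Phi> ((norm (x - x0))^2))"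
proof -
  have "smooth_fun (\<lambda>x. (e \<bullet> (x - x0)) * \<Phi> ((norm (x - x0))^2))"
    unfolding smooth_fun_iff_Ck by (intro allI Ck_mult Ck_inner_affine Ck_compose[OF \<Phi>(1) Ck_norm_sq])
  moreover have sub: "{x. (e \<bullet> (x - x0)) * \<Phi> ((norm (x - x0))^2) \<noteq> 0} \<subseteq> cball x0 (sqrt R)"
  proof
    fix x assume "x \<in> {x. (e \<bullet> (x - x0)) * \<Phi> ((norm (x - x0))^2) \<noteq> 0}"
    then have "(norm (x - x0))^2 < R" using \<Phi>(2) not_le by auto
    then have "norm (x - x0) \<le> sqrt R" by (simp add: real_le_rsqrt)
    then show "x \<in> cball x0 (sqrt R)" by (simp add: dist_norm norm_minus_commute)
  qed
  then have "closure {x. (e \<bullet> (x - x0)) * \<Phi> ((norm (x - x0))^2) \<noteq> 0} \<subseteq> cball x0 (sqrt R)"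
    by (rule closure_minimal) simp
  moreover have "compact (closure {x. (e \<bullet> (x - x0)) * \<Phi> ((norm (x - x0))^2) \<noteq> 0})"
    using bounded_subset[OF bounded_cball sub] by (simp add: compact_closure)
  ultimately show ?thesis using R(2) unfolding test_fun_def by blast
qed

lemma L2v_cont_compact_support:
  fixes F :: "'a \<Rightarrow> 'b::euclidean_space"
  assumes "continuous_on UNIV F" "\<And>x. norm x > R \<Longrightarrow> F x = 0"
  shows "L2v M F"
proof -
  obtain B where B: "\<And>x. norm (F x) \<le> B" using bounded_cont_compact_support[OF assms] by blast
  show ?thesis
    by (rule L2v_bound[OF L2v_const[OF finite_M, of "1::real"], of _ B])
      (use B borel_M[OF borel_cont[OF assms(1)]] in auto)
qed

text \<open>\<open>radial_identity\<close> is applied to test functions approximating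
  \<open>v\<close>, and both sides pass to the limit in the gradient. The radial profile may reach
  beyond \<Omega>, because the approximants vanish there.\<close>

lemma H10_radial_identity:
  fixes \<Phi> \<Phi>' :: "real \<Rightarrow> real" and x0 e :: 'a
  assumes \<Phi>: "\<And>s. (\<Phi> has_real_derivative \<Phi>' s) (at s)" "continuous_on UNIV \<Phi>'" "\<And>s. s \<ge> R \<Longrightarrow> \<Phi> s = 0"
    and H: "H10 \<Omega> v V"
  defines "g \<equiv> \<lambda>x. \<Phi> ((norm (x - x0))^2) *\<^sub>R e + (2 * \<Phi>' ((norm (x - x0))^2) * (e \<bullet> (x - x0))) *\<^sub>R (x - x0)"
    and "k \<equiv> \<lambda>x. real DIM('a) * \<Phi> ((norm (x - x0))^2) + 2 * (norm (x - x0))^2 * \<Phi>' ((norm (x - x0))^2)"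
  shows "(LINT x|M. V x \<bullet> g x) = (LINT x|M. k x * (V x \<bullet> e))"
    "essbdd M k" "L2v M g"
proof -
  have Cg: "C1c (\<lambda>x. (e \<bullet> (x - x0)) * \<Phi> ((norm (x - x0))^2)) g"
    unfolding g_def by (rule C1c_radial[OF \<Phi>])
  have c\<Phi>: "continuous_on UNIV \<Phi>"
    using DERIV_isCont[OF \<Phi>(1)] by (simp add: continuous_at_imp_continuous_on)
  have ck: "continuous_on UNIV k" unfolding k_def
    by (intro continuous_intros continuous_on_compose2[OF c\<Phi>] continuous_on_compose2[OF \<Phi>(2)]) auto
  show kb: "essbdd M k"
  proof -
    have "compact (k ` closure \<Omega>)"
      by (intro compact_continuous_image continuous_on_subset[OF ck]) (use bounded_Om in \<open>auto simp: compact_closure\<close>)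
    then obtain B where B: "\<And>x. x \<in> closure \<Omega> \<Longrightarrow> \<bar>k x\<bar> \<le> B"
      by (metis bounded_iff compact_imp_bounded imageI real_norm_def)
    have "AE x in M. \<bar>k x\<bar> \<le> B"
      by (rule AE_I2) (use B closure_subset[of \<Omega>] in \<open>auto simp: space_restrict_space\<close>)
    then show ?thesis using borel_M[OF borel_cont[OF ck]] by (auto simp: essbdd_def)
  qed
  show gL: "L2v M g"
  proof -
    obtain R1 where "\<And>x. norm x > R1 \<Longrightarrow> g x = 0" using C1c_support[OF Cg] by metis
    then show ?thesis by (rule L2v_cont_compact_support[OF C1c_cont_grad[OF Cg]])
  qed
  note [measurable] = borel_cont[OF C1c_cont_grad[OF Cg]] borel_cont[OF ck]
  have t: "(LINT x|M. 1 * (grad \<phi> x \<bullet> g x)) = (LINT x|M. k x * (grad \<phi> x \<bullet> e))" if "test_fun \<Omega> \<phi>" for \<phi>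
  proof -
    note C = test_fun_C1c[OF that]
    note [measurable] = borel_cont[OF C1c_cont_grad[OF C]]
    have "(LINT x|M. 1 * (grad \<phi> x \<bullet> g x)) = (LBINT x. 1 * (grad \<phi> x \<bullet> g x))"
      by (rule integral_M_eq) (use test_fun_zero[OF that] in \<open>simp_all\<close>)
    also have "\<dots> = (LBINT x. g x \<bullet> grad \<phi> x)" by (simp add: inner_commute)
    also have "\<dots> = (LBINT x. k x * (grad \<phi> x \<bullet> e))"
      unfolding g_def k_def by (rule radial_identity[OF \<Phi> C])
    also have "\<dots> = (LINT x|M. k x * (grad \<phi> x \<bullet> e))"
      by (rule integral_M_eq[symmetric]) (use test_fun_zero[OF that] in \<open>simp_all\<close>)
    finally show ?thesis .
  qed
  obtain \<phi> where \<phi>: "\<And>n. test_fun \<Omega> (\<phi> n)" "(\<lambda>n. l2sq M (\<lambda>x. grad (\<phi> n) x - V x)) \<longlonglongrightarrow> 0"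
    using H unfolding H10_iff by blast
  note V = H10_L2v(2)[OF H]
  have l1: "(\<lambda>n. (LINT x|M. 1 * (grad (\<phi> n) x \<bullet> g x))) \<longlonglongrightarrow> (LINT x|M. 1 * (V x \<bullet> g x))"
    by (rule weighted_integral_tendsto[OF essbdd_const test_fun_grad_L2v[OF \<phi>(1)] V gL \<phi>(2)])
  have l2: "(\<lambda>n. (LINT x|M. k x * (grad (\<phi> n) x \<bullet> e))) \<longlonglongrightarrow> (LINT x|M. k x * (V x \<bullet> e))"
    by (rule weighted_integral_tendsto[OF kb test_fun_grad_L2v[OF \<phi>(1)] V L2v_const[OF finite_M] \<phi>(2)])
  from LIMSEQ_unique[OF l1[unfolded t[OF \<phi>(1)]] l2] show "(LINT x|M. V x \<bullet> g x) = (LINT x|M. k x * (V x \<bullet> e))" by simp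
qed

end

section \<open>Blow-up at a Lebesgue point\<close>

text \<open>The recurring error shape below: \<open>s\<close> is the L2 size of a ball of radius r,
  and \<open>t\<close> an L2 oscillation at a Lebesgue point, which is of smaller order than
  \<open>s\<close>.\<close>

lemma square_product_tendsto:
  fixes x s t :: "nat \<Rightarrow> real"
  assumes "\<And>n. s n > 0" "\<And>n. \<bar>x n\<bar> \<le> K * s n * t n" "(\<lambda>n. t n / s n) \<longlonglongrightarrow> 0"
  shows "(\<lambda>n. x n / (s n)^2) \<longlonglongrightarrow> 0"
proof (rule Lim_null_comparison)
  show "(\<lambda>n. K * (t n / s n)) \<longlonglongrightarrow> 0" using tendsto_mult[OF tendsto_const assms(3), of K] by simp
  have "norm (x n / (s n)^2) \<le> K * (t n / s n)" for n
  proof -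
    have "norm (x n / (s n)^2) = \<bar>x n\<bar> / (s n)^2" by simp
    also have "\<dots> \<le> (K * s n * t n) / (s n)^2" using assms(2) by (intro divide_right_mono) auto
    also have "\<dots> = K * (t n / s n)" using assms(1)[of n] by (simp add: power2_eq_square)
    finally show ?thesis .
  qed
  then show "eventually (\<lambda>n. norm (x n / (s n)^2) \<le> K * (t n / s n)) sequentially" by simp
qed

text \<open>A fixed Lebesgue point and a sequence of radii: compactness is stated for sequences, and
  a state has to be chosen for every perturbation. \<open>LYb\<close> demands its bound for every
  index, so that the energy estimate holds for all n and not just eventually.\<close>

locale blowup = bounded_open_set \<Omega> for \<Omega> :: "'a::euclidean_space set" +
  fixes \<alpha> b :: real and a f yd y p :: "'a \<Rightarrow> real" and Gy Gp :: "'a \<Rightarrow> 'a" and x0 :: 'a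
    and r :: "nat \<Rightarrow> real" and ys :: "nat \<Rightarrow> 'a \<Rightarrow> real" and Gs :: "nat \<Rightarrow> 'a \<Rightarrow> 'a"
  assumes \<alpha>: "\<alpha> > 0" and yd: "L2 \<Omega> yd" and adm: "admissible \<Omega> \<alpha> a" and b\<alpha>: "b \<ge> \<alpha>"
    and y: "weak_sol \<Omega> a f y Gy" and p: "weak_sol \<Omega> a (\<lambda>x. y x - yd x) p Gp"
    and ys: "\<And>n. weak_sol \<Omega> (\<lambda>x. a x + indicator (ball x0 (r n)) x * (b - a x)) f (ys n) (Gs n)"
    and r0: "\<And>n. r n > 0" and rlim: "r \<longlonglongrightarrow> 0" and rsub: "\<And>n. ball x0 (r n) \<subseteq> \<Omega>"
    and x0: "x0 \<in> \<Omega>" and ax0: "a x0 \<ge> \<alpha>"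
    and LYb: "\<And>n. l2sq M (\<lambda>z. indicator (ball x0 (r n)) z *\<^sub>R (Gy z - Gy x0)) / r n ^ DIM('a) \<le> 1"
    and LY: "((\<lambda>r. l2sq M (\<lambda>z. indicator (ball x0 r) z *\<^sub>R (Gy z - Gy x0)) / r ^ DIM('a)) \<longlongrightarrow> 0) (at_right 0)"
    and LP: "((\<lambda>r. l2sq M (\<lambda>z. indicator (ball x0 r) z *\<^sub>R (Gp z - Gp x0)) / r ^ DIM('a)) \<longlongrightarrow> 0) (at_right 0)"
    and LA: "((\<lambda>r. l2sq M (\<lambda>z. indicator (ball x0 r) z *\<^sub>R (a z - a x0)) / r ^ DIM('a)) \<longlongrightarrow> 0) (at_right 0)"
begin

definition w where "w n x = ys n x - y x"
definition W where "W n x = Gs n x - Gy x"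
definition \<delta> where "\<delta> x = b - a x"
text \<open>The L2 scale of the ball: gradients restricted to it will have norm O(s n), and
  quantities of order (s n)^2 are those that survive division by r^d.\<close>

definition s where "s n = sqrt (r n ^ DIM('a))"
abbreviation "I n \<equiv> (indicator (ball x0 (r n)) :: 'a \<Rightarrow> real)"
definition v where "v = measure lebesgue (ball (0::'a) 1)"

lemma s0: "s n > 0" using r0 by (simp add: s_def)

lemma s_sq: "(s n)^2 = r n ^ DIM('a)" using r0[of n] by (simp add: s_def)

lemma v0: "v > 0" by (simp add: v_def)

lemma vball: "measure lebesgue (ball x0 (r n)) = v * (s n)^2"
  using content_ball_conv_unit_ball[of "r n" x0] r0[of n] by (simp add: v_def s_sq mult.commute)

lemma H: "H10 \<Omega> y Gy" "H10 \<Omega> p Gp" "H10 \<Omega> (ys n) (Gs n)" "H10 \<Omega> (w n) (W n)"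
proof -
  show 1: "H10 \<Omega> y Gy" "H10 \<Omega> p Gp" and 2: "H10 \<Omega> (ys n) (Gs n)" using y p ys by (auto simp: weak_sol_def)
  show "H10 \<Omega> (w n) (W n)" unfolding w_def[abs_def] W_def[abs_def] by (rule H10_diff[OF 2 1(1)])
qed

lemmas HL = H10_L2v(1)[OF H(1)] H10_L2v(1)[OF H(2)] H10_L2v(1)[OF H(3)] H10_L2v(1)[OF H(4)]
  H10_L2v(2)[OF H(1)] H10_L2v(2)[OF H(2)] H10_L2v(2)[OF H(3)] H10_L2v(2)[OF H(4)]

lemma ab: "essbdd M a" by (rule admissible_essbdd[OF adm])

lemma db: "essbdd M \<delta>"
  using essbdd_add[OF essbdd_const[of M b] essbdd_mult[OF essbdd_const[of M "-1"] ab]] by (simp add: \<delta>_def[abs_def])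

definition K where "K = (SOME K. K \<ge> 0 \<and> (AE x in M. \<bar>\<delta> x\<bar> \<le> K))"

lemma K: "K \<ge> 0" "AE x in M. \<bar>\<delta> x\<bar> \<le> K"
proof -
  obtain k where "AE x in M. \<bar>\<delta> x\<bar> \<le> k" using db by (auto simp: essbdd_def)
  then have "AE x in M. \<bar>\<delta> x\<bar> \<le> \<bar>k\<bar>" by eventually_elim linarith
  then have "\<exists>k. k \<ge> 0 \<and> (AE x in M. \<bar>\<delta> x\<bar> \<le> k)" by (intro exI[of _ "\<bar>k\<bar>"]) auto
  from someI_ex[OF this] show "K \<ge> 0" "AE x in M. \<bar>\<delta> x\<bar> \<le> K" by (auto simp: K_def)
qed

text \<open>The indicator is idempotent, so it can be attached to both factors and both norms become
  local.\<close>

lemma Id_bound: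
  assumes "L2v M F" "L2v M G"
  shows "\<bar>(LINT x|M. I n x * \<delta> x * (F x \<bullet> G x))\<bar> \<le> K * sqrt (l2sq M (\<lambda>x. I n x *\<^sub>R F x)) * sqrt (l2sq M (\<lambda>x. I n x *\<^sub>R G x))"
proof -
  have "(\<lambda>x. I n x * \<delta> x * (F x \<bullet> G x)) = (\<lambda>x. \<delta> x * ((I n x *\<^sub>R F x) \<bullet> (I n x *\<^sub>R G x)))"
    by (auto simp: fun_eq_iff split: split_indicator)
  then show ?thesis
    using L2v_Cauchy_Schwarz_weighted[OF _ K(2,1) L2v_scale[OF essbdd_ball assms(1)] L2v_scale[OF essbdd_ball assms(2)]] db
    by (simp add: essbdd_def)
qed

lemma I_l2sq_le: "L2v M F \<Longrightarrow> l2sq M (\<lambda>x. indicator (ball x0 \<rho>) x *\<^sub>R F x) \<le> l2sq M F"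
  using l2sq_mono[of M F "\<lambda>x. indicator (ball x0 \<rho>) x *\<^sub>R F x" 1] L2v_meas[OF L2v_scale[OF essbdd_ball[of x0 \<rho>], of F]]
  by (auto intro!: AE_I2 split: split_indicator)

lemma Idb: "essbdd M (\<lambda>x. I n x * \<delta> x)" by (rule essbdd_mult[OF essbdd_ball db])

definition an where "an n x = a x + I n x * \<delta> x"

lemma anb: "essbdd M (an n)" unfolding an_def[abs_def] by (rule essbdd_add[OF ab Idb])

lemma an_adm: "admissible \<Omega> \<alpha> (an n)"
proof -
  have "AE x in M. \<alpha> \<le> a x" using adm by (simp add: admissible_def)
  then have "AE x in M. \<alpha> \<le> an n x"
    by eventually_elim (use b\<alpha> in \<open>auto simp: an_def \<delta>_def split: split_indicator\<close>)
  then show ?thesis using anb[of n] by (auto simp: admissible_def essbdd_def)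
qed

text \<open>Subtracting the two state equations can be arranged in two ways. With the perturbed
  coefficient on the left, the right side contains the known field \<open>Gy\<close>; this version
  serves the energy estimate and the corrector. With the unperturbed coefficient on the left, the
  right side contains \<open>Gs n\<close>; this version pairs with solutions of the unperturbed
  equation.\<close>

lemma w_eq:
  assumes V: "H10 \<Omega> u V"
  shows "(LINT x|M. an n x * (W n x \<bullet> V x)) = - (LINT x|M. I n x * \<delta> x * (Gy x \<bullet> V x))"
    and "(LINT x|M. a x * (W n x \<bullet> V x)) = - (LINT x|M. I n x * \<delta> x * (Gs n x \<bullet> V x))"
proof -
  note VL = H10_L2v(2)[OF V]
  have e: "(LINT x|M. an n x * (Gs n x \<bullet> V x)) = (LINT x|M. a x * (Gy x \<bullet> V x))"
    using ys[of n] y V unfolding weak_sol_def an_def \<delta>_def by auto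
  have sp: "(LINT x|M. an n x * (F x \<bullet> V x)) = (LINT x|M. a x * (F x \<bullet> V x)) + (LINT x|M. I n x * \<delta> x * (F x \<bullet> V x))"
    if "L2v M F" for F
    unfolding an_def distrib_right
    by (rule Bochner_Integration.integral_add[OF L2v_weighted_integrable[OF ab that VL] L2v_weighted_integrable[OF Idb that VL]])
  show "(LINT x|M. an n x * (W n x \<bullet> V x)) = - (LINT x|M. I n x * \<delta> x * (Gy x \<bullet> V x))"
    unfolding W_def weighted_integral_diff[OF anb HL(7,5) VL] e sp[OF HL(5)] by simp
  show "(LINT x|M. a x * (W n x \<bullet> V x)) = - (LINT x|M. I n x * \<delta> x * (Gs n x \<bullet> V x))"
    unfolding W_def weighted_integral_diff[OF ab HL(7,5) VL] using e unfolding sp[OF HL(7)] by simp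
qed

lemma IGy_bound: "sqrt (l2sq M (\<lambda>x. I n x *\<^sub>R Gy x)) \<le> (1 + norm (Gy x0) * sqrt v) * s n"
proof -
  have L1: "L2v M (\<lambda>x. I n x *\<^sub>R (Gy x - Gy x0))"
    by (rule L2v_scale[OF essbdd_ball L2v_diff[OF HL(5) L2v_const[OF finite_M]]])
  have L2: "L2v M (\<lambda>x. I n x *\<^sub>R Gy x0)" by (rule L2v_scale[OF essbdd_ball L2v_const[OF finite_M]])
  have "sqrt (l2sq M (\<lambda>x. I n x *\<^sub>R Gy x)) \<le> sqrt (l2sq M (\<lambda>x. I n x *\<^sub>R (Gy x - Gy x0))) + sqrt (l2sq M (\<lambda>x. I n x *\<^sub>R Gy x0))"
    using l2_triangle[OF L1 L2] by (simp add: scaleR_right_diff_distrib)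
  also have "sqrt (l2sq M (\<lambda>x. I n x *\<^sub>R (Gy x - Gy x0))) \<le> sqrt ((s n)^2)"
    using LYb[of n] r0[of n] by (intro real_sqrt_le_mono) (simp add: s_sq divide_le_eq)
  also have "\<dots> = s n" using s0[of n] by simp
  also have "l2sq M (\<lambda>x. I n x *\<^sub>R Gy x0) = (LINT x|M. I n x * (norm (Gy x0))^2)"
    unfolding l2sq_def by (intro Bochner_Integration.integral_cong) (auto split: split_indicator)
  also have "\<dots> = v * (s n)^2 * (norm (Gy x0))^2" unfolding M_ball_integral[OF rsub] vball ..
  also have "sqrt (v * (s n)^2 * (norm (Gy x0))^2) = norm (Gy x0) * sqrt v * s n"
    using s0[of n] by (simp add: real_sqrt_mult)
  finally show ?thesis by (simp add: algebra_simps)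
qed

definition C1 where "C1 = K / \<alpha> * (1 + norm (Gy x0) * sqrt v)"
definition C2 where "C2 = (1 + norm (Gy x0) * sqrt v) + C1"

lemma C12: "C1 \<ge> 0" "C2 \<ge> 0"
  using K(1) \<alpha> v0 by (auto simp: C1_def C2_def intro!: add_nonneg_nonneg mult_nonneg_nonneg)

text \<open>\<open>w n\<close> tests its own equation: coercivity on the left, a source of norm O(s
  n) living on the ball on the right.\<close>

lemma W_bound: "sqrt (l2sq M (W n)) \<le> C1 * s n"
proof -
  define q where "q = sqrt (l2sq M (W n))"
  have "\<alpha> * l2sq M (W n) \<le> (LINT x|M. an n x * (W n x \<bullet> W n x))"
    by (rule admissible_coercive[OF an_adm HL(8)])
  also have "\<dots> \<le> \<bar>(LINT x|M. I n x * \<delta> x * (Gy x \<bullet> W n x))\<bar>"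
    unfolding w_eq(1)[OF H(4)] by simp
  also have "\<dots> \<le> K * sqrt (l2sq M (\<lambda>x. I n x *\<^sub>R Gy x)) * sqrt (l2sq M (\<lambda>x. I n x *\<^sub>R W n x))"
    by (rule Id_bound[OF HL(5) HL(8)])
  also have "\<dots> \<le> K * ((1 + norm (Gy x0) * sqrt v) * s n) * q"
    unfolding q_def using K(1) s0[of n] v0
    by (intro mult_mono mult_left_mono IGy_bound real_sqrt_le_mono I_l2sq_le HL(8) mult_nonneg_nonneg) auto
  finally have "(\<alpha> * q) * q \<le> (K * ((1 + norm (Gy x0) * sqrt v) * s n)) * q"
    by (simp add: q_def mult.assoc)
  then have "q = 0 \<or> \<alpha> * q \<le> K * ((1 + norm (Gy x0) * sqrt v) * s n)"
    using real_sqrt_ge_zero[OF l2sq_nonneg[of M "W n"], folded q_def] by (auto simp: mult_le_cancel_right)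
  moreover have "0 \<le> C1 * s n" using C12 s0[of n] by simp
  ultimately show ?thesis unfolding q_def[symmetric] C1_def using \<alpha> by (auto simp: field_simps)
qed

lemma IGs_bound: "sqrt (l2sq M (\<lambda>x. I n x *\<^sub>R Gs n x)) \<le> C2 * s n"
proof -
  have "sqrt (l2sq M (\<lambda>x. I n x *\<^sub>R Gs n x)) \<le> sqrt (l2sq M (\<lambda>x. I n x *\<^sub>R Gy x)) + sqrt (l2sq M (\<lambda>x. I n x *\<^sub>R W n x))"
    using l2_triangle[OF L2v_scale[OF essbdd_ball HL(5)] L2v_scale[OF essbdd_ball HL(8)], of x0 "r n" x0 "r n"]
    by (simp add: W_def scaleR_right_diff_distrib)
  also have "sqrt (l2sq M (\<lambda>x. I n x *\<^sub>R W n x)) \<le> sqrt (l2sq M (W n))"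
    by (intro real_sqrt_le_mono I_l2sq_le HL(8))
  also note W_bound[of n]
  also note IGy_bound[of n]
  finally show ?thesis by (simp add: C2_def algebra_simps)
qed

text \<open>The dilation by \<rho> is needed because the corrector is supported in a fixed multiple
  of the ball, while the normalisation stays that of the ball itself.\<close>

lemma lim_scaled:
  assumes "((\<lambda>r. l2sq M (\<lambda>z. indicator (ball x0 r) z *\<^sub>R F z) / r ^ DIM('a)) \<longlongrightarrow> 0) (at_right 0)" "\<rho> > 0"
  shows "(\<lambda>n. sqrt (l2sq M (\<lambda>z. indicator (ball x0 (\<rho> * r n)) z *\<^sub>R F z)) / s n) \<longlonglongrightarrow> 0"
proof -
  have "filterlim (\<lambda>n. \<rho> * r n) (at_right 0) sequentially"
    unfolding filterlim_at
  proof
    show "eventually (\<lambda>n. \<rho> * r n \<in> {0<..} \<and> \<rho> * r n \<noteq> 0) sequentially"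
      using r0 assms(2) by (intro always_eventually allI) (simp add: less_imp_neq[THEN not_sym])
    show "(\<lambda>n. \<rho> * r n) \<longlonglongrightarrow> 0" using tendsto_mult[OF tendsto_const rlim, of \<rho>] by simp
  qed
  from filterlim_compose[OF assms(1) this]
  have "(\<lambda>n. \<rho> ^ DIM('a) * (l2sq M (\<lambda>z. indicator (ball x0 (\<rho> * r n)) z *\<^sub>R F z) / (\<rho> * r n) ^ DIM('a))) \<longlonglongrightarrow> \<rho> ^ DIM('a) * 0"
    by (intro tendsto_mult tendsto_const)
  moreover have "\<rho> ^ DIM('a) * (X / (\<rho> * r n) ^ DIM('a)) = X / (s n)^2" for X n
    using assms(2) r0[of n] by (simp add: power_mult_distrib s_sq)
  ultimately have "(\<lambda>n. l2sq M (\<lambda>z. indicator (ball x0 (\<rho> * r n)) z *\<^sub>R F z) / (s n)^2) \<longlonglongrightarrow> 0" by simp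
  from tendsto_real_sqrt[OF this] show ?thesis using s0 by (simp add: real_sqrt_divide less_imp_le)
qed

lemmas lim_scaled_1 = lim_scaled[where \<rho>=1, simplified]

lemma shrinking_ball_tendsto:
  fixes Q :: "'a \<Rightarrow> 'a"
  assumes Q: "L2v M Q"
  shows "(\<lambda>n. l2sq M (\<lambda>x. I n x *\<^sub>R Q x)) \<longlonglongrightarrow> 0"
proof -
  have "(\<lambda>n. l2sq M (\<lambda>x. I n x *\<^sub>R Q x)) \<longlonglongrightarrow> (LINT x|M. 0)"
    unfolding l2sq_def
  proof (rule integral_dominated_convergence[where w="\<lambda>x. (norm (Q x))^2"])
    show "(\<lambda>x. (norm (I n x *\<^sub>R Q x))^2) \<in> borel_measurable M" for n
      using L2v_sq[OF L2v_scale[OF essbdd_ball Q]] by (rule borel_measurable_integrable)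
    have "AE x in lebesgue. x \<noteq> x0" by (rule AE_completion) (simp add: AE_lborel_singleton)
    then have "AE x in M. x \<noteq> x0" by (subst AE_restrict_space_iff) auto
    then show "AE x in M. (\<lambda>n. (norm (I n x *\<^sub>R Q x))^2) \<longlonglongrightarrow> 0"
    proof eventually_elim
      case (elim x)
      then have "dist x0 x > 0" by simp
      from order_tendstoD(2)[OF rlim this] have "eventually (\<lambda>n. r n < dist x0 x) sequentially" .
      then have "eventually (\<lambda>n. 0 = (norm (I n x *\<^sub>R Q x))^2) sequentially"
        by eventually_elim (auto split: split_indicator)
      then show ?case by (rule Lim_transform_eventually[rotated]) simp
    qed
    show "AE x in M. norm ((norm (I n x *\<^sub>R Q x))^2) \<le> (norm (Q x))^2" for n
      by (intro AE_I2) (auto split: split_indicator)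
  qed (use L2v_sq[OF Q] in auto)
  then show ?thesis by simp
qed

text \<open>With \<open>q\<close> solving the unperturbed equation for the source \<open>g\<close>,
  the pairing becomes an integral over the ball of \<open>Gs n\<close>, of size O(s n), against the
  fixed field \<open>Q\<close>, whose norm on the ball tends to 0. Convergence for each fixed
  \<open>g\<close> is all that the local means in \<open>rellich_sequence\<close> require.\<close>

lemma duality_tendsto:
  fixes g :: "'a \<Rightarrow> real"
  assumes g: "L2v M g"
  shows "(\<lambda>n. (LINT x|M. g x * w n x) / s n) \<longlonglongrightarrow> 0"
proof -
  obtain q Q where q: "weak_sol \<Omega> a g q Q"
    using weak_sol_exists[OF adm \<alpha>] g unfolding L2_iff_L2v by blast
  then have qH: "H10 \<Omega> q Q" by (simp add: weak_sol_def)
  note QL = H10_L2v(2)[OF qH]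
  show ?thesis
  proof (rule Lim_null_comparison)
    have "(\<lambda>n. K * C2 * sqrt (l2sq M (\<lambda>x. I n x *\<^sub>R Q x))) \<longlonglongrightarrow> K * C2 * sqrt 0"
      by (intro tendsto_intros shrinking_ball_tendsto QL)
    then show "(\<lambda>n. K * C2 * sqrt (l2sq M (\<lambda>x. I n x *\<^sub>R Q x))) \<longlonglongrightarrow> 0" by simp
    have "norm ((LINT x|M. g x * w n x) / s n) \<le> K * C2 * sqrt (l2sq M (\<lambda>x. I n x *\<^sub>R Q x))" for n
    proof -
      have "(LINT x|M. g x * w n x) = (LINT x|M. a x * (Q x \<bullet> W n x))"
        using q H(4)[of n] unfolding weak_sol_def by auto
      also have "\<dots> = - (LINT x|M. I n x * \<delta> x * (Gs n x \<bullet> Q x))"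
        using w_eq(2)[OF qH] by (simp add: inner_commute)
      finally have "\<bar>(LINT x|M. g x * w n x)\<bar> \<le> K * sqrt (l2sq M (\<lambda>x. I n x *\<^sub>R Gs n x)) * sqrt (l2sq M (\<lambda>x. I n x *\<^sub>R Q x))"
        using Id_bound[OF HL(7) QL] by simp
      also have "\<dots> \<le> K * (C2 * s n) * sqrt (l2sq M (\<lambda>x. I n x *\<^sub>R Q x))"
        using K(1) by (intro mult_right_mono mult_left_mono IGs_bound) auto
      finally show ?thesis using s0[of n] by (simp add: divide_le_eq mult_ac)
    qed
    then show "eventually (\<lambda>n. norm ((LINT x|M. g x * w n x) / s n) \<le> K * C2 * sqrt (l2sq M (\<lambda>x. I n x *\<^sub>R Q x))) sequentially" by simp
  qed
qed

text \<open>The quotients w n / s n are bounded in \<open>H10\<close> and converge weakly to 0. As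
  the compactness lemma speaks about C1 functions, each quotient is replaced by a test function
  within 1 / (n + 1), an error that vanishes in the limit.\<close>

lemma w_small: "(\<lambda>n. l2sq M (w n) / (s n)^2) \<longlonglongrightarrow> 0"
proof -
  define u where "u n x = w n x / s n" for n x
  define U where "U n x = (1 / s n) *\<^sub>R W n x" for n x
  have uH: "H10 \<Omega> (u n) (U n)" for n
    using H10_lincomb[OF H(4)[of n] H(4)[of n], of "1 / s n" 0] by (simp add: u_def[abs_def] U_def[abs_def])
  note uL = H10_L2v[OF uH]
  have usq: "l2sq M (u n) = l2sq M (w n) / (s n)^2" for n
    using l2sq_cmult[of M "1 / s n" "w n"] by (simp add: u_def[abs_def] power_divide)
  have Usq: "l2sq M (U n) \<le> C1^2" for n
  proof -
    have "l2sq M (W n) = (sqrt (l2sq M (W n)))^2" by simp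
    also have "\<dots> \<le> (C1 * s n)^2" by (intro power_mono W_bound) simp
    finally show ?thesis
      using s0[of n] by (simp add: U_def[abs_def] l2sq_cmult power_divide power_mult_distrib divide_le_eq)
  qed
  have "\<exists>\<phi>. test_fun \<Omega> \<phi> \<and> l2sq M (\<lambda>x. \<phi> x - u n x) < 1 / real (Suc n) \<and> l2sq M (\<lambda>x. grad \<phi> x - U n x) < 1 / real (Suc n)" for n
  proof -
    obtain \<phi> where \<phi>: "\<And>k. test_fun \<Omega> (\<phi> k)" "(\<lambda>k. l2sq M (\<lambda>x. \<phi> k x - u n x)) \<longlonglongrightarrow> 0" "(\<lambda>k. l2sq M (\<lambda>x. grad (\<phi> k) x - U n x)) \<longlonglongrightarrow> 0"
      using uH[of n] unfolding H10_iff by blast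
    have "eventually (\<lambda>k. l2sq M (\<lambda>x. \<phi> k x - u n x) < 1 / real (Suc n) \<and> l2sq M (\<lambda>x. grad (\<phi> k) x - U n x) < 1 / real (Suc n)) sequentially"
      using order_tendstoD(2)[OF \<phi>(2), of "1 / real (Suc n)"] order_tendstoD(2)[OF \<phi>(3), of "1 / real (Suc n)"]
      by (auto intro: eventually_conj)
    then show ?thesis using \<phi>(1) by (auto simp: eventually_sequentially)
  qed
  then obtain \<phi> where \<phi>: "\<And>n. test_fun \<Omega> (\<phi> n)" "\<And>n. l2sq M (\<lambda>x. \<phi> n x - u n x) < 1 / real (Suc n)"
      "\<And>n. l2sq M (\<lambda>x. grad (\<phi> n) x - U n x) < 1 / real (Suc n)" by metis
  note \<phi>L = test_fun_L2v[OF \<phi>(1)] test_fun_grad_L2v[OF \<phi>(1)]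
  have l0: "(\<lambda>n. 1 / real (Suc n)) \<longlonglongrightarrow> 0"
    using LIMSEQ_inverse_real_of_nat by (simp add: inverse_eq_divide)
  have l1: "(\<lambda>n. sqrt (l2sq M (\<lambda>x. \<phi> n x - u n x))) \<longlonglongrightarrow> 0"
  proof -
    have "(\<lambda>n. l2sq M (\<lambda>x. \<phi> n x - u n x)) \<longlonglongrightarrow> 0"
      by (rule Lim_null_comparison[OF _ l0]) (use \<phi>(2) in \<open>auto intro!: always_eventually less_imp_le\<close>)
    from tendsto_real_sqrt[OF this] show ?thesis by simp
  qed
  obtain R where R: "R \<ge> 0" "\<And>x. x \<in> \<Omega> \<Longrightarrow> norm x \<le> R"
    using bounded_Om unfolding bounded_iff by (metis abs_ge_zero abs_le_D1 abs_le_iff le_cases order_trans)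
  have "(\<lambda>n. (LBINT x. (\<phi> n x)^2)) \<longlonglongrightarrow> 0"
  \<comment> \<open>The constant (1 + C1)^2 combines the bound C1 for the scaled gradients with an
    approximation error of at most 1.\<close>
  proof (rule rellich_sequence[where u=\<phi> and g="\<lambda>n. grad (\<phi> n)" and R=R and K="(1 + C1)^2"])
    show "C1c (\<phi> n) (grad (\<phi> n))" for n by (rule test_fun_C1c[OF \<phi>(1)])
    show "\<phi> n x = 0" if "norm x > R" for n x using test_fun_zero(1)[OF \<phi>(1)] R(2)[of x] that by force
    show "R \<ge> 0" by (rule R)
    show "(LBINT x. (norm (grad (\<phi> n) x))^2) \<le> (1 + C1)^2" for n
    proof -
      have "sqrt (l2sq M (grad (\<phi> n))) \<le> sqrt (l2sq M (\<lambda>x. grad (\<phi> n) x - U n x)) + sqrt (l2sq M (U n))"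
        by (rule l2_triangle_diff[OF \<phi>L(2) uL(2)])
      also have "\<dots> \<le> sqrt 1 + sqrt (C1^2)"
      proof (intro add_mono real_sqrt_le_mono Usq)
        have "1 / real (Suc n) \<le> 1" by simp
        then show "l2sq M (\<lambda>x. grad (\<phi> n) x - U n x) \<le> 1" using \<phi>(3)[of n] by linarith
      qed
      finally have "sqrt (l2sq M (grad (\<phi> n))) \<le> 1 + C1" using C12 by simp
      then have "(sqrt (l2sq M (grad (\<phi> n))))^2 \<le> (1 + C1)^2" by (intro power_mono) auto
      then show ?thesis by (simp add: test_fun_grad_l2sq[OF \<phi>(1)])
    qed
    fix x :: 'a and \<epsilon> :: real assume "\<epsilon> > 0"
    define g where "g = (indicator (ball x \<epsilon>) :: 'a \<Rightarrow> real)"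
    have gL: "L2v M g" using L2v_scale[OF essbdd_ball[of x \<epsilon>] L2v_const[OF finite_M, of "1::real"]] by (simp add: g_def)
    have e: "integral\<^sup>L lborel (\<lambda>y. if norm (y - x) < \<epsilon> then \<phi> n y else 0)
       = (LINT x|M. g x \<bullet> (\<phi> n x - u n x)) + (LINT x|M. g x * w n x) / s n" for n
    proof -
      note [measurable] = borel_cont[OF C1c_cont[OF test_fun_C1c[OF \<phi>(1)]]]
      have "integral\<^sup>L lborel (\<lambda>y. if norm (y - x) < \<epsilon> then \<phi> n y else 0) = integral\<^sup>L M (\<lambda>y. if norm (y - x) < \<epsilon> then \<phi> n y else 0)"
        by (rule integral_M_eq[symmetric]) (use test_fun_zero(1)[OF \<phi>(1)] in \<open>measurable, simp_all\<close>)
      also have "\<dots> = (LINT x|M. g x \<bullet> (\<phi> n x - u n x) + g x \<bullet> u n x)"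
        by (intro Bochner_Integration.integral_cong) (auto simp: g_def dist_norm norm_minus_commute algebra_simps)
      also have "\<dots> = (LINT x|M. g x \<bullet> (\<phi> n x - u n x)) + (LINT x|M. g x \<bullet> u n x)"
        by (rule Bochner_Integration.integral_add[OF L2v_inner_integrable[OF gL L2v_diff[OF \<phi>L(1) uL(1)]] L2v_inner_integrable[OF gL uL(1)]])
      also have "(LINT x|M. g x \<bullet> u n x) = (LINT x|M. g x * w n x) / s n"
        by (simp add: u_def)
      finally show ?thesis .
    qed
    have "(\<lambda>n. (LINT x|M. g x \<bullet> (\<phi> n x - u n x))) \<longlonglongrightarrow> 0"
    proof (rule Lim_null_comparison)
      show "(\<lambda>n. sqrt (l2sq M g) * sqrt (l2sq M (\<lambda>x. \<phi> n x - u n x))) \<longlonglongrightarrow> 0"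
        using tendsto_mult[OF tendsto_const l1, of "sqrt (l2sq M g)"] by simp
      show "eventually (\<lambda>n. norm ((LINT x|M. g x \<bullet> (\<phi> n x - u n x))) \<le> sqrt (l2sq M g) * sqrt (l2sq M (\<lambda>x. \<phi> n x - u n x))) sequentially"
        using L2v_Cauchy_Schwarz[OF gL L2v_diff[OF \<phi>L(1) uL(1)]] by (intro always_eventually allI) simp
    qed
    from tendsto_add[OF this duality_tendsto[OF gL]]
    show "(\<lambda>n. integral\<^sup>L lborel (\<lambda>y. if norm (y - x) < \<epsilon> then \<phi> n y else 0)) \<longlonglongrightarrow> 0"
      unfolding e by simp
  qed
  then have "(\<lambda>n. sqrt (l2sq M (\<phi> n))) \<longlonglongrightarrow> 0"
    using tendsto_real_sqrt unfolding test_fun_l2sq[OF \<phi>(1)] by fastforce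
  from tendsto_add[OF l1 this] have l3: "(\<lambda>n. sqrt (l2sq M (\<lambda>x. \<phi> n x - u n x)) + sqrt (l2sq M (\<phi> n))) \<longlonglongrightarrow> 0" by simp
  have "(\<lambda>n. sqrt (l2sq M (u n))) \<longlonglongrightarrow> 0"
  proof (rule Lim_null_comparison[OF _ l3])
    have "sqrt (l2sq M (u n)) \<le> sqrt (l2sq M (\<lambda>x. \<phi> n x - u n x)) + sqrt (l2sq M (\<phi> n))" for n
      using l2_triangle_diff[OF uL(1) \<phi>L(1), of n n] l2sq_minus[of M "\<phi> n" "u n"] by simp
    then show "eventually (\<lambda>n. norm (sqrt (l2sq M (u n))) \<le> sqrt (l2sq M (\<lambda>x. \<phi> n x - u n x)) + sqrt (l2sq M (\<phi> n))) sequentially" by simp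
  qed
  from tendsto_power[OF this, of 2] show ?thesis by (simp add: usq)
qed

section \<open>The mean gradient of \<open>w\<close> over the ball, by testing with the
  corrector\<close>

definition "e = Gp x0"
definition "X n = (LINT x|M. I n x * (W n x \<bullet> e))"

lemma constL: "L2v M (\<lambda>x. k)" by (rule L2v_const[OF finite_M])

lemma aL: "L2v M (\<lambda>x. a x - k)"
proof -
  have "L2v M (\<lambda>x. (a x - k) *\<^sub>R (1::real))"
    using essbdd_add[OF ab essbdd_const[of M "-k"]] by (intro L2v_scale constL) simp
  then show ?thesis by simp
qed

lemma aosc_b: "essbdd M (\<lambda>x. a x - k)"
  using essbdd_add[OF ab essbdd_const[of M "-k"]] by simp

lemma I_const_l2sq:
  fixes k :: "'b::euclidean_space"
  shows "sqrt (l2sq M (\<lambda>x. I n x *\<^sub>R k)) = norm k * sqrt v * s n"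
proof -
  have "l2sq M (\<lambda>x. I n x *\<^sub>R k) = (LINT x|M. I n x * (norm k)^2)"
    unfolding l2sq_def by (intro Bochner_Integration.integral_cong) (auto split: split_indicator)
  also have "\<dots> = v * (s n)^2 * (norm k)^2" unfolding M_ball_integral[OF rsub] vball ..
  finally show ?thesis using s0[of n] by (simp add: real_sqrt_mult)
qed

lemma I_bound:
  assumes "L2v M F" "L2v M G"
  shows "\<bar>(LINT x|M. I n x * (F x \<bullet> G x))\<bar> \<le> sqrt (l2sq M (\<lambda>x. I n x *\<^sub>R F x)) * sqrt (l2sq M (\<lambda>x. I n x *\<^sub>R G x))"
proof -
  have "(\<lambda>x. I n x * (F x \<bullet> G x)) = (\<lambda>x. (I n x *\<^sub>R F x) \<bullet> (I n x *\<^sub>R G x))"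
    by (auto simp: fun_eq_iff split: split_indicator)
  then show ?thesis
    using L2v_Cauchy_Schwarz[OF L2v_scale[OF essbdd_ball assms(1)] L2v_scale[OF essbdd_ball assms(2)]] by simp
qed

definition "ta \<rho> n = sqrt (l2sq M (\<lambda>z. indicator (ball x0 (\<rho> * r n)) z *\<^sub>R (a z - a x0)))"

lemma ta_lim: "\<rho> > 0 \<Longrightarrow> (\<lambda>n. ta \<rho> n / s n) \<longlonglongrightarrow> 0"
  unfolding ta_def by (rule lim_scaled[OF LA])

text \<open>The price of freezing the coefficient at x0. The oscillation of \<open>a\<close> is
  small only in the L2 mean and \<open>F\<close> lies in L2, which leaves a supremum bound, and a
  support of size comparable to r, to be asked of \<open>g\<close>.\<close>

lemma osc_bound:
  fixes F g :: "'a \<Rightarrow> 'a"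
  assumes F: "L2v M F" and g: "g \<in> borel_measurable M" "\<And>x. norm (g x) \<le> c * indicator (ball x0 (\<rho> * r n)) x" "c \<ge> 0"
  shows "\<bar>(LINT x|M. (a x - a x0) * (F x \<bullet> g x))\<bar> \<le> c * sqrt (l2sq M F) * ta \<rho> n"
proof -
  have gb: "norm (g x) \<le> c" for x using g(2)[of x] g(3) by (auto split: split_indicator_asm)
  have gL: "L2v M g"
    by (rule L2v_bound[OF constL[of "1::real"] g(1), of c]) (use gb in simp)
  have agL: "L2v M (\<lambda>x. (a x - a x0) *\<^sub>R g x)" by (rule L2v_scale[OF aosc_b gL])
  have "l2sq M (\<lambda>x. (a x - a x0) *\<^sub>R g x) \<le> c^2 * l2sq M (\<lambda>z. indicator (ball x0 (\<rho> * r n)) z *\<^sub>R (a z - a x0))"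
  proof (rule l2sq_mono[OF L2v_scale[OF essbdd_ball aL] L2v_meas[OF agL]], rule AE_I2)
    fix x
    show "norm ((a x - a x0) *\<^sub>R g x) \<le> c * norm (indicator (ball x0 (\<rho> * r n)) x *\<^sub>R (a x - a x0))"
      using mult_left_mono[OF g(2)[of x], of "\<bar>a x - a x0\<bar>"] by (simp add: abs_mult mult_ac)
  qed
  from real_sqrt_le_mono[OF this] have "sqrt (l2sq M (\<lambda>x. (a x - a x0) *\<^sub>R g x)) \<le> c * ta \<rho> n"
    using g(3) by (simp add: real_sqrt_mult ta_def)
  then have "sqrt (l2sq M F) * sqrt (l2sq M (\<lambda>x. (a x - a x0) *\<^sub>R g x)) \<le> sqrt (l2sq M F) * (c * ta \<rho> n)"
    by (intro mult_left_mono) auto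
  moreover have "\<bar>(LINT x|M. (a x - a x0) * (F x \<bullet> g x))\<bar> \<le> sqrt (l2sq M F) * sqrt (l2sq M (\<lambda>x. (a x - a x0) *\<^sub>R g x))"
    using L2v_Cauchy_Schwarz[OF F agL] by simp
  ultimately show ?thesis by (simp add: mult_ac)
qed

lemma delta_split:
  assumes "L2v M F"
  shows "(LINT x|M. I n x * \<delta> x * (F x \<bullet> k)) = \<delta> x0 * (LINT x|M. I n x * (F x \<bullet> k)) - (LINT x|M. (a x - a x0) * (F x \<bullet> (I n x *\<^sub>R k)))"
proof -
  have i1: "integrable M (\<lambda>x. I n x * (F x \<bullet> k))" by (rule L2v_weighted_integrable[OF essbdd_ball assms constL])
  have i2: "integrable M (\<lambda>x. (a x - a x0) * (F x \<bullet> (I n x *\<^sub>R k)))"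
    by (rule L2v_weighted_integrable[OF aosc_b assms L2v_scale[OF essbdd_ball constL]])
  have "(\<lambda>x. I n x * \<delta> x * (F x \<bullet> k)) = (\<lambda>x. \<delta> x0 * (I n x * (F x \<bullet> k)) - (a x - a x0) * (F x \<bullet> (I n x *\<^sub>R k)))"
    by (auto simp: fun_eq_iff \<delta>_def algebra_simps)
  then show ?thesis using i1 i2 by simp
qed

lemma I_vec_meas:
  fixes k :: 'a
  shows "(\<lambda>x. I n x *\<^sub>R k) \<in> borel_measurable M"
  by (rule L2v_meas[OF L2v_scale[OF essbdd_ball constL]])

lemma osc_ball_tendsto:
  fixes F :: "nat \<Rightarrow> 'a \<Rightarrow> 'a" and k :: 'a
  assumes F: "\<And>n. L2v M (F n)" "\<And>n. sqrt (l2sq M (\<lambda>x. I n x *\<^sub>R F n x)) \<le> C * s n"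
  shows "(\<lambda>n. (LINT x|M. (a x - a x0) * (F n x \<bullet> (I n x *\<^sub>R k))) / (s n)^2) \<longlonglongrightarrow> 0"
proof (rule square_product_tendsto[OF s0 _ ta_lim])
  show "\<bar>(LINT x|M. (a x - a x0) * (F n x \<bullet> (I n x *\<^sub>R k)))\<bar> \<le> (norm k * C) * s n * ta 1 n" for n
  proof -
    have "(\<lambda>x. (a x - a x0) * (F n x \<bullet> (I n x *\<^sub>R k))) = (\<lambda>x. (a x - a x0) * ((I n x *\<^sub>R F n x) \<bullet> (I n x *\<^sub>R k)))"
      by (auto simp: fun_eq_iff split: split_indicator)
    then have "\<bar>(LINT x|M. (a x - a x0) * (F n x \<bullet> (I n x *\<^sub>R k)))\<bar> \<le> norm k * sqrt (l2sq M (\<lambda>x. I n x *\<^sub>R F n x)) * ta 1 n"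
      using osc_bound[where g="\<lambda>x. I n x *\<^sub>R k" and F="\<lambda>x. I n x *\<^sub>R F n x" and c="norm k" and \<rho>=1 and n=n,
          OF L2v_scale[OF essbdd_ball F(1)] I_vec_meas] by simp
    also have "\<dots> \<le> norm k * (C * s n) * ta 1 n"
      using F(2)[of n] by (intro mult_right_mono mult_left_mono) (auto simp: ta_def)
    finally show ?thesis by (simp add: mult_ac)
  qed
qed simp

lemma mean_Gy_tendsto: "(\<lambda>n. (LINT x|M. I n x * (Gy x \<bullet> e)) / (s n)^2) \<longlonglongrightarrow> v * (Gy x0 \<bullet> e)"
proof -
  have D: "L2v M (\<lambda>x. Gy x - Gy x0)" by (rule L2v_diff[OF HL(5) constL])
  have eq: "(LINT x|M. I n x * (Gy x \<bullet> e)) / (s n)^2 = (LINT x|M. I n x * ((Gy x - Gy x0) \<bullet> e)) / (s n)^2 + v * (Gy x0 \<bullet> e)" for n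
  proof -
    have "(LINT x|M. I n x * ((Gy x - Gy x0) \<bullet> e)) = (LINT x|M. I n x * (Gy x \<bullet> e)) - (LINT x|M. I n x * (Gy x0 \<bullet> e))"
      by (rule weighted_integral_diff[OF essbdd_ball HL(5) constL constL])
    also have "(LINT x|M. I n x * (Gy x0 \<bullet> e)) = v * (s n)^2 * (Gy x0 \<bullet> e)"
      unfolding M_ball_integral[OF rsub] vball ..
    finally show ?thesis using s0[of n] by (simp add: field_simps)
  qed
  have "(\<lambda>n. (LINT x|M. I n x * ((Gy x - Gy x0) \<bullet> e)) / (s n)^2) \<longlonglongrightarrow> 0"
  proof (rule square_product_tendsto[OF s0 _ lim_scaled_1[OF LY]])
    show "\<bar>(LINT x|M. I n x * ((Gy x - Gy x0) \<bullet> e))\<bar> \<le> (norm e * sqrt v) * s n * sqrt (l2sq M (\<lambda>z. I n z *\<^sub>R (Gy z - Gy x0)))" for n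
      using I_bound[OF D constL, of n e] unfolding I_const_l2sq by (simp add: mult_ac)
  qed
  from tendsto_add[OF this tendsto_const] show ?thesis unfolding eq by simp
qed

text \<open>The gradient of the corrector equals \<open>e\<close> on the ball exactly, so the
  perturbation terms see only \<open>e\<close>. By the radial identity the main term becomes the
  integral of k * (W n \<bullet> e), with k = d on the ball and k of L2 norm at most sqrt \<epsilon>
  * s n outside. \<open>E\<close> collects the freezing errors, which are o((s n)^2); the remaining
  error is of the order (s n)^2 but carries the factor sqrt \<epsilon>.\<close>

lemma X_defect_bound:
  assumes \<epsilon>: "\<epsilon> > 0"
  obtains E where "(\<lambda>n. E n / (s n)^2) \<longlonglongrightarrow> 0"
    "eventually (\<lambda>n. \<bar>(a x0 * real DIM('a) + \<delta> x0) * X n + \<delta> x0 * (LINT x|M. I n x * (Gy x \<bullet> e)) + E n\<bar>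
        \<le> a x0 * norm e * C1 * sqrt \<epsilon> * (s n)^2) sequentially"
proof -
  obtain \<Phi> \<Phi>' :: "real \<Rightarrow> real" and R where \<Phi>Ck: "\<And>n. Ck n \<Phi>" and \<Phi>D: "\<And>s. (\<Phi> has_real_derivative \<Phi>' s) (at s)"
    and \<Phi>c: "continuous_on UNIV \<Phi>'" and \<Phi>1: "\<And>s. s \<le> 1 \<Longrightarrow> \<Phi> s = 1" and \<Phi>'0: "\<And>s. s \<le> 1 \<Longrightarrow> \<Phi>' s = 0"
    and R: "R > 0" and \<Phi>R: "\<And>s. s \<ge> R \<Longrightarrow> \<Phi> s = 0"
    and \<Phi>i: "integral\<^sup>L lborel (\<lambda>x::'a. indicator (- cball 0 1) x *
       (real DIM('a) * \<Phi> ((norm x)^2) + 2 * (norm x)^2 * \<Phi>' ((norm x)^2))^2) \<le> \<epsilon>"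
    by (rule exists_radial_profile[OF \<epsilon>, where 'a='a]) (rule that)
  \<comment> \<open>The argument is a squared distance, hence the division by the squared radius;
    the unit ball of the profile becomes the ball of radius r n.\<close>
  define \<Psi> where "\<Psi> n t = \<Phi> (t / (r n)^2)" for n t
  define \<Psi>' where "\<Psi>' n t = \<Phi>' (t / (r n)^2) / (r n)^2" for n t
  have r2: "(r n)^2 > 0" for n using r0[of n] by simp
  have \<Psi>D: "(\<Psi> n has_real_derivative \<Psi>' n t) (at t)" for n t
  proof -
    have "((\<lambda>t. t / (r n)^2) has_real_derivative 1 / (r n)^2) (at t)" by (rule DERIV_cdivide[OF DERIV_ident])
    from DERIV_chain2[OF \<Phi>D this] show ?thesis unfolding \<Psi>_def[abs_def] \<Psi>'_def by simp
  qed
  have \<Psi>c: "continuous_on UNIV (\<Psi>' n)" for n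
    unfolding \<Psi>'_def[abs_def] using r2[of n]
    by (intro continuous_intros continuous_on_compose2[OF \<Phi>c]) auto
  have \<Psi>R: "\<Psi> n t = 0" if "t \<ge> R * (r n)^2" for n t
    unfolding \<Psi>_def using that r2[of n] by (intro \<Phi>R) (simp add: le_divide_eq)
  have \<Psi>Ck: "Ck m (\<Psi> n)" for m n
  proof -
    have "Ck m (\<lambda>t::real. (1 / (r n)^2) * (1 \<bullet> (t - 0)))" by (intro Ck_mult Ck_const Ck_inner_affine)
    from Ck_compose[OF \<Phi>Ck this] show ?thesis by (simp add: \<Psi>_def[abs_def])
  qed
  define g where "g n x = \<Psi> n ((norm (x - x0))^2) *\<^sub>R e + (2 * \<Psi>' n ((norm (x - x0))^2) * (e \<bullet> (x - x0))) *\<^sub>R (x - x0)" for n x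
  define k where "k n x = real DIM('a) * \<Psi> n ((norm (x - x0))^2) + 2 * (norm (x - x0))^2 * \<Psi>' n ((norm (x - x0))^2)" for n x
  have Wg: "(LINT x|M. W n x \<bullet> g n x) = (LINT x|M. k n x * (W n x \<bullet> e))" for n
    unfolding g_def k_def by (rule H10_radial_identity(1)[OF \<Psi>D \<Psi>c \<Psi>R H(4)])
  have kb: "essbdd M (k n)" for n
    unfolding k_def[abs_def] by (rule H10_radial_identity(2)[OF \<Psi>D \<Psi>c \<Psi>R H(4)])
  have gL: "L2v M (g n)" for n
    unfolding g_def[abs_def] by (rule H10_radial_identity(3)[OF \<Psi>D \<Psi>c \<Psi>R H(4)])
  have in_ball: "g n x = e" "k n x = real DIM('a)" if "x \<in> ball x0 (r n)" for n x
  proof -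
    have "norm (x - x0) \<le> r n" using that by (simp add: dist_norm norm_minus_commute)
    then have "(norm (x - x0))^2 \<le> (r n)^2" by (intro power_mono) auto
    then have "(norm (x - x0))^2 / (r n)^2 \<le> 1" using r2[of n] by (simp add: divide_le_eq)
    then show "g n x = e" "k n x = real DIM('a)" by (auto simp: g_def k_def \<Psi>_def \<Psi>'_def \<Phi>1 \<Phi>'0)
  qed
  define g0 where "g0 z = \<Phi> ((norm (z - 0))^2) *\<^sub>R e + (2 * \<Phi>' ((norm (z - 0))^2) * (e \<bullet> (z - 0))) *\<^sub>R (z - 0)" for z :: 'a
  define k0 where "k0 z = real DIM('a) * \<Phi> ((norm z)^2) + 2 * (norm z)^2 * \<Phi>' ((norm z)^2)" for z :: 'a
  have C0: "C1c (\<lambda>z. (e \<bullet> (z - 0)) * \<Phi> ((norm (z - 0))^2)) g0"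
    unfolding g0_def[abs_def] by (rule C1c_radial[OF \<Phi>D \<Phi>c \<Phi>R])
  obtain R1 where R1: "R1 \<ge> 0" "\<And>x. norm x > R1 \<Longrightarrow> g0 x = 0" using C1c_support[OF C0] by metis
  obtain c where c: "c \<ge> 0" "\<And>x. norm (g0 x) \<le> c" using bounded_cont_compact_support[OF C1c_cont_grad[OF C0] R1(2)] by blast
  define \<rho> where "\<rho> = R1 + 1"
  have \<rho>: "\<rho> > 0" using R1 by (simp add: \<rho>_def)
  \<comment> \<open>The corrector scales like a length, so its gradient and \<open>k\<close> are
    invariant under dilation. Therefore the bound \<open>c\<close> and the support factor \<rho> do
    not depend on n.\<close>
  have gscale: "g n (x0 + r n *\<^sub>R z) = g0 z" "k n (x0 + r n *\<^sub>R z) = k0 z" for n z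
    using r0[of n] by (auto simp: g_def k_def g0_def k0_def \<Psi>_def \<Psi>'_def power_mult_distrib power2_eq_square)
  have gbound: "norm (g n x) \<le> c * indicator (ball x0 (\<rho> * r n)) x" for n x
  proof -
    define z where "z = (1 / r n) *\<^sub>R (x - x0)"
    have x: "x = x0 + r n *\<^sub>R z" using r0[of n] by (simp add: z_def)
    show ?thesis
    proof (cases "x \<in> ball x0 (\<rho> * r n)")
      case True
      then show ?thesis using c(2)[of z] unfolding x gscale by simp
    next
      case False
      then have "\<rho> * r n \<le> r n * norm z" using r0[of n] unfolding x by (simp add: dist_norm)
      then have "norm z > R1" using r0[of n] by (simp add: \<rho>_def mult.commute)
      then show ?thesis using R1(2)[of z] c(1) unfolding x gscale by simp
    qed
  qed
  \<comment> \<open>The support of the corrector is wider than the ball and fits into \<Omega> only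
    for small radii; this is why the final bound holds eventually.\<close>
  have inside: "eventually (\<lambda>n. cball x0 (sqrt (R * (r n)^2)) \<subseteq> \<Omega>) sequentially"
  proof -
    obtain d where d: "d > 0" "cball x0 d \<subseteq> \<Omega>" using open_Om x0 open_contains_cball by blast
    have "(\<lambda>n. sqrt (R * (r n)^2)) \<longlonglongrightarrow> sqrt (R * 0^2)" by (intro tendsto_intros rlim)
    then have "eventually (\<lambda>n. sqrt (R * (r n)^2) < d) sequentially" using d by (intro order_tendstoD) auto
    then show ?thesis by eventually_elim (use d in \<open>meson less_imp_le order_trans subset_cball\<close>)
  qed
  \<comment> \<open>\<open>E1\<close> is the part of the radial identity outside the ball.
    \<open>E2\<close> comes from freezing the coefficient in the main term, \<open>E3\<close> and
    \<open>E4\<close> from freezing \<delta> on the ball, next to \<open>W n\<close> and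
    \<open>Gy\<close> respectively.\<close>
  define E1 where "E1 n = (LINT x|M. (1 - I n x) * k n x * (W n x \<bullet> e))" for n
  define E2 where "E2 n = (LINT x|M. (a x - a x0) * (W n x \<bullet> g n x))" for n
  define E3 where "E3 n = (LINT x|M. (a x - a x0) * (W n x \<bullet> (I n x *\<^sub>R e)))" for n
  define E4 where "E4 n = (LINT x|M. (a x - a x0) * (Gy x \<bullet> (I n x *\<^sub>R e)))" for n
  have Icb: "essbdd M (\<lambda>x. 1 - I n x)" for n
    using essbdd_add[OF essbdd_const[of M 1] essbdd_mult[OF essbdd_const[of M "-1"] essbdd_ball]] by simp
  have l2: "(\<lambda>n. E2 n / (s n)^2) \<longlonglongrightarrow> 0"
  proof (rule square_product_tendsto[OF s0 _ ta_lim[OF \<rho>]])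
    show "\<bar>E2 n\<bar> \<le> (c * C1) * s n * ta \<rho> n" for n
    proof -
      have "\<bar>E2 n\<bar> \<le> c * sqrt (l2sq M (W n)) * ta \<rho> n"
        unfolding E2_def by (rule osc_bound[OF HL(8) L2v_meas[OF gL] gbound c(1)])
      also have "\<dots> \<le> c * (C1 * s n) * ta \<rho> n"
        using c(1) W_bound[of n] by (intro mult_right_mono mult_left_mono) (auto simp: ta_def)
      finally show ?thesis by (simp add: mult_ac)
    qed
  qed
  have l3: "(\<lambda>n. E3 n / (s n)^2) \<longlonglongrightarrow> 0"
    unfolding E3_def
  proof (rule osc_ball_tendsto[OF HL(8)])
    show "sqrt (l2sq M (\<lambda>x. I n x *\<^sub>R W n x)) \<le> C1 * s n" for n
      using order_trans[OF real_sqrt_le_mono[OF I_l2sq_le[OF HL(8)]] W_bound[of n]] .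
  qed
  have l4: "(\<lambda>n. E4 n / (s n)^2) \<longlonglongrightarrow> 0"
    unfolding E4_def by (rule osc_ball_tendsto[OF HL(5) IGy_bound])
  have kout: "l2sq M (\<lambda>x. (1 - I n x) * k n x) \<le> \<epsilon> * (s n)^2" for n
  proof -
    define F where "F x = ((1 - I n x) * k n x)^2" for x
    have ck: "continuous_on UNIV k0"
    proof -
      have c\<Phi>: "continuous_on UNIV \<Phi>" using DERIV_isCont[OF \<Phi>D] by (simp add: continuous_at_imp_continuous_on)
      show ?thesis unfolding k0_def[abs_def]
        by (intro continuous_intros continuous_on_compose2[OF c\<Phi>] continuous_on_compose2[OF \<Phi>c]) auto
    qed
    have kk: "k n x = k0 ((1 / r n) *\<^sub>R (x - x0))" for x
      using gscale(2)[of n "(1 / r n) *\<^sub>R (x - x0)"] r0[of n] by simp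
    have ckn: "continuous_on UNIV (k n)"
      unfolding kk[abs_def] by (intro continuous_on_compose2[OF ck] continuous_intros) auto
    have [measurable]: "k n \<in> borel_measurable borel" "k0 \<in> borel_measurable borel" "ball x0 (r n) \<in> sets borel"
        "ball (0::'a) 1 \<in> sets borel" "cball (0::'a) 1 \<in> sets borel"
      using borel_cont[OF ckn] borel_cont[OF ck] by auto
    have Fm [measurable]: "F \<in> borel_measurable borel" unfolding F_def by measurable
    have Fz: "F (x0 + r n *\<^sub>R z) = indicator (- ball 0 1) z * (k0 z)^2" for z
    proof -
      have "x0 + r n *\<^sub>R z \<in> ball x0 (r n) \<longleftrightarrow> z \<in> ball 0 1" using r0[of n] by (simp add: dist_norm)
      then show ?thesis unfolding F_def gscale by (auto split: split_indicator)
    qed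
    \<comment> \<open>The perturbed region is an open ball, whereas the profile estimate concerns
      the complement of the closed one; the sphere between them is a null set.\<close>
    have ae: "AE z in lborel. indicator (- ball 0 1) z * (k0 z)^2 = indicator (- cball 0 1) z * (k0 z)^2"
    proof -
      have "sphere (0::'a) 1 \<in> null_sets lborel"
        using negligible_sphere[of "0::'a" 1] by (simp add: negligible_iff_null_sets null_sets_completion_iff)
      then have "AE z in lborel. z \<notin> sphere (0::'a) 1" by (rule AE_not_in)
      then show ?thesis by eventually_elim (auto split: split_indicator)
    qed
    \<comment> \<open>Beyond R the profile is identically zero, so its derivative vanishes there as
      well.\<close>
    have k0R: "k0 z = 0" if "norm z > sqrt R" for z
    proof -
      have gt: "(norm z)^2 > R" using power_strict_mono[OF that, of 2] R by simp
      have "(\<Phi> has_real_derivative 0) (at ((norm z)^2))"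
        by (rule has_field_derivative_transform_within_open[where f="\<lambda>_. 0" and S="{R<..}"]) (use gt \<Phi>R in auto)
      then have "\<Phi>' ((norm z)^2) = 0" using \<Phi>D DERIV_unique by blast
      then show ?thesis using \<Phi>R gt by (simp add: k0_def)
    qed
    have ki: "integrable lborel (\<lambda>z. (k0 z)^2)"
      by (rule integrable_cont_compact_support[of _ "sqrt R"]) (use ck k0R in \<open>auto intro!: continuous_intros\<close>)
    have ii: "integrable lborel (\<lambda>z. F (x0 + r n *\<^sub>R z))"
      unfolding Fz
    proof (rule Bochner_Integration.integrable_bound[OF ki])
      show "(\<lambda>z. indicator (- ball 0 1) z * (k0 z)^2) \<in> borel_measurable lborel" by measurable
    qed (auto split: split_indicator)
    have Fi: "integrable lborel F" by (rule lborel_integrable_affine[OF Fm r0 ii])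
    have "l2sq M (\<lambda>x. (1 - I n x) * k n x) = integral\<^sup>L M F" by (simp add: l2sq_def F_def[abs_def])
    also have "\<dots> = (LINT x|lebesgue. indicator \<Omega> x *\<^sub>R F x)"
      by (rule integral_restrict_space) simp
    also have "\<dots> \<le> integral\<^sup>L lebesgue F"
    proof (rule integral_mono)
      show FiL: "integrable lebesgue F" using Fi by (simp add: integrable_completion)
      show "integrable lebesgue (\<lambda>x. indicator \<Omega> x *\<^sub>R F x)" by (rule integrable_mult_indicator[OF _ FiL]) simp
    qed (auto simp: F_def split: split_indicator)
    also have "\<dots> = integral\<^sup>L lborel F" by (simp add: integral_completion)
    also have "\<dots> = r n ^ DIM('a) * (LBINT z. F (x0 + r n *\<^sub>R z))"
      by (rule lborel_integral_affine[OF Fm r0])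
    also have "(LBINT z. F (x0 + r n *\<^sub>R z)) = (LBINT z. indicator (- cball 0 1) z * (k0 z)^2)"
      unfolding Fz by (rule integral_cong_AE) (use ae in auto)
    also have "r n ^ DIM('a) * \<dots> \<le> r n ^ DIM('a) * \<epsilon>"
      using \<Phi>i r0[of n] unfolding k0_def by (intro mult_left_mono) auto
    finally show ?thesis by (simp add: s_sq mult.commute)
  qed
  have b1: "\<bar>E1 n\<bar> \<le> norm e * C1 * sqrt \<epsilon> * (s n)^2" for n
  proof -
    have kL: "L2v M (\<lambda>x. ((1 - I n x) * k n x) *\<^sub>R e)" by (rule L2v_scale[OF essbdd_mult[OF Icb kb] constL])
    have "l2sq M (\<lambda>x. ((1 - I n x) * k n x) *\<^sub>R e) = (norm e)^2 * l2sq M (\<lambda>x. (1 - I n x) * k n x)"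
      by (simp add: l2sq_def power_mult_distrib mult.commute)
    also have "\<dots> \<le> (norm e)^2 * (\<epsilon> * (s n)^2)" by (intro mult_left_mono kout) simp
    finally have "sqrt (l2sq M (\<lambda>x. ((1 - I n x) * k n x) *\<^sub>R e)) \<le> sqrt ((norm e)^2 * (\<epsilon> * (s n)^2))"
      by (rule real_sqrt_le_mono)
    also have "\<dots> = norm e * sqrt \<epsilon> * s n" using s0[of n] by (simp add: real_sqrt_mult)
    finally have q: "sqrt (l2sq M (\<lambda>x. ((1 - I n x) * k n x) *\<^sub>R e)) \<le> norm e * sqrt \<epsilon> * s n" .
    have "\<bar>E1 n\<bar> = \<bar>(LINT x|M. W n x \<bullet> (((1 - I n x) * k n x) *\<^sub>R e))\<bar>" by (simp add: E1_def)
    also have "\<dots> \<le> sqrt (l2sq M (W n)) * sqrt (l2sq M (\<lambda>x. ((1 - I n x) * k n x) *\<^sub>R e))"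
      by (rule L2v_Cauchy_Schwarz[OF HL(8) kL])
    also have "\<dots> \<le> (C1 * s n) * (norm e * sqrt \<epsilon> * s n)"
      using C12(1) s0[of n] by (intro mult_mono W_bound q) auto
    finally show ?thesis by (simp add: power2_eq_square mult_ac)
  qed
  have key: "(a x0 * real DIM('a) + \<delta> x0) * X n + \<delta> x0 * (LINT x|M. I n x * (Gy x \<bullet> e)) + (E2 n - E3 n - E4 n) = - a x0 * E1 n"
    if sub: "cball x0 (sqrt (R * (r n)^2)) \<subseteq> \<Omega>" for n
  proof -
    define \<psi> where "\<psi> x = (e \<bullet> (x - x0)) * \<Psi> n ((norm (x - x0))^2)" for x
    have t: "test_fun \<Omega> \<psi>"
      unfolding \<psi>_def[abs_def] by (rule test_fun_radial[OF \<Psi>Ck \<Psi>R _ sub]) (use R r2 in auto)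
    have "C1c \<psi> (g n)" unfolding \<psi>_def[abs_def] g_def[abs_def] by (rule C1c_radial[OF \<Psi>D \<Psi>c \<Psi>R])
    then have gr: "grad \<psi> = g n" by (rule C1c_grad_eq)
    have Hg: "H10 \<Omega> \<psi> (g n)" using H10_test[OF t] unfolding gr .
    \<comment> \<open>Exact equality, not an approximation: the profile is constantly 1 on the unit
      ball.\<close>
    have Ig: "(\<lambda>x. I n x * \<delta> x * (F x \<bullet> g n x)) = (\<lambda>x. I n x * \<delta> x * (F x \<bullet> e))" for F :: "'a \<Rightarrow> 'a"
      using in_ball(1) by (auto simp: fun_eq_iff split: split_indicator)
    have 1: "(LINT x|M. an n x * (W n x \<bullet> g n x)) = - (LINT x|M. I n x * \<delta> x * (Gy x \<bullet> e))"
      using w_eq(1)[OF Hg, of n] unfolding Ig .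
    have i1: "integrable M (\<lambda>x. W n x \<bullet> g n x)" by (rule L2v_inner_integrable[OF HL(8) gL])
    have i2: "integrable M (\<lambda>x. (a x - a x0) * (W n x \<bullet> g n x))" by (rule L2v_weighted_integrable[OF aosc_b HL(8) gL])
    have i3: "integrable M (\<lambda>x. I n x * \<delta> x * (W n x \<bullet> g n x))" by (rule L2v_weighted_integrable[OF Idb HL(8) gL])
    have "(LINT x|M. an n x * (W n x \<bullet> g n x)) = (LINT x|M. a x0 * (W n x \<bullet> g n x) + (a x - a x0) * (W n x \<bullet> g n x) + I n x * \<delta> x * (W n x \<bullet> g n x))"
      by (intro Bochner_Integration.integral_cong) (auto simp: an_def algebra_simps)
    also have "\<dots> = a x0 * (LINT x|M. W n x \<bullet> g n x) + E2 n + (LINT x|M. I n x * \<delta> x * (W n x \<bullet> g n x))"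
      using i1 i2 i3 by (simp add: E2_def)
    also have "(LINT x|M. I n x * \<delta> x * (W n x \<bullet> g n x)) = \<delta> x0 * X n - E3 n"
      unfolding Ig X_def E3_def by (rule delta_split[OF HL(8)])
    finally have 2: "(LINT x|M. an n x * (W n x \<bullet> g n x)) = a x0 * (LINT x|M. W n x \<bullet> g n x) + E2 n + (\<delta> x0 * X n - E3 n)" .
    have 3: "(LINT x|M. I n x * \<delta> x * (Gy x \<bullet> e)) = \<delta> x0 * (LINT x|M. I n x * (Gy x \<bullet> e)) - E4 n"
      unfolding E4_def by (rule delta_split[OF HL(5)])
    have j1: "integrable M (\<lambda>x. I n x * (W n x \<bullet> e))" by (rule L2v_weighted_integrable[OF essbdd_ball HL(8) constL])
    have j2: "integrable M (\<lambda>x. (1 - I n x) * k n x * (W n x \<bullet> e))" by (rule L2v_weighted_integrable[OF essbdd_mult[OF Icb kb] HL(8) constL])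
    have "(LINT x|M. W n x \<bullet> g n x) = (LINT x|M. real DIM('a) * (I n x * (W n x \<bullet> e)) + (1 - I n x) * k n x * (W n x \<bullet> e))"
      unfolding Wg using in_ball(2) by (intro Bochner_Integration.integral_cong) (auto split: split_indicator)
    also have "\<dots> = real DIM('a) * X n + E1 n"
      using j1 j2 by (simp add: X_def E1_def)
    finally have 4: "(LINT x|M. W n x \<bullet> g n x) = real DIM('a) * X n + E1 n" .
    from 1 2 3 4 show ?thesis by (simp add: algebra_simps)
  qed
  show thesis
  proof (rule that[of "\<lambda>n. E2 n - E3 n - E4 n"])
    have "(\<lambda>n. E2 n / (s n)^2 - E3 n / (s n)^2 - E4 n / (s n)^2) \<longlonglongrightarrow> 0 - 0 - 0" by (intro tendsto_intros l2 l3 l4)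
    then show "(\<lambda>n. (E2 n - E3 n - E4 n) / (s n)^2) \<longlonglongrightarrow> 0" by (simp add: diff_divide_distrib)
    show "eventually (\<lambda>n. \<bar>(a x0 * real DIM('a) + \<delta> x0) * X n + \<delta> x0 * (LINT x|M. I n x * (Gy x \<bullet> e)) + (E2 n - E3 n - E4 n)\<bar>
        \<le> a x0 * norm e * C1 * sqrt \<epsilon> * (s n)^2) sequentially"
      using inside
    proof eventually_elim
      case (elim n)
      have "\<bar>- a x0 * E1 n\<bar> = a x0 * \<bar>E1 n\<bar>" using ax0 \<alpha> by (simp add: abs_mult)
      also have "\<dots> \<le> a x0 * (norm e * C1 * sqrt \<epsilon> * (s n)^2)" using ax0 \<alpha> by (intro mult_left_mono b1) auto
      finally show ?case unfolding key[OF elim] by (simp add: mult.assoc)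
    qed
  qed
qed

section \<open>The topological derivative\<close>

text \<open>The denominator b + a(x0)(d-1) of the formula: d * a(x0) comes from the value d of
  \<open>k\<close> on the ball, \<delta> x0 from the perturbation acting on \<open>w\<close>
  itself.\<close>

definition "D = a x0 * real DIM('a) + \<delta> x0"

lemma D_pos: "D > 0"
proof -
  have "a x0 * 1 \<le> a x0 * real DIM('a)"
    using ax0 \<alpha> DIM_positive[where 'a='a] by (intro mult_left_mono) auto
  then show ?thesis using b\<alpha> \<alpha> by (simp add: D_def \<delta>_def)
qed

text \<open>Only the error terms depend on the profile; \<open>X\<close> and the mean of
  \<open>Gy\<close> do not. Hence the profile can be chosen according to the target accuracy, before
  n tends to infinity.\<close>

lemma defect_tendsto: "(\<lambda>n. D * (X n / (s n)^2) + \<delta> x0 * ((LINT x|M. I n x * (Gy x \<bullet> e)) / (s n)^2)) \<longlonglongrightarrow> 0"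
proof (rule LIMSEQ_I)
  fix \<eta> :: real assume \<eta>: "\<eta> > 0"
  define \<kappa> where "\<kappa> = a x0 * norm e * C1"
  have \<kappa>: "\<kappa> \<ge> 0" using ax0 \<alpha> C12(1) by (simp add: \<kappa>_def)
  \<comment> \<open>The bound is applied with \<epsilon> = q^2, so that its square root is
    \<open>q\<close> and the leftover \<kappa> * q stays below half the tolerance; the summand 1
    covers \<kappa> = 0.\<close>
  define q where "q = \<eta> / (2 * (\<kappa> + 1))"
  have q: "q > 0" "\<kappa> * q < \<eta> / 2"
  proof -
    show "q > 0" using \<eta> \<kappa> by (simp add: q_def)
    have "\<kappa> * q < (\<kappa> + 1) * q" using \<open>q > 0\<close> by simp
    also have "\<dots> = \<eta> / 2"
    proof -
      have "\<kappa> + 1 \<noteq> 0" using \<kappa> by simp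
      then show ?thesis
        unfolding q_def times_divide_eq_right mult.commute[of "\<kappa> + 1" \<eta>]
        by (rule nonzero_mult_divide_mult_cancel_right)
    qed
    finally show "\<kappa> * q < \<eta> / 2" .
  qed
  obtain E where E: "(\<lambda>n. E n / (s n)^2) \<longlonglongrightarrow> 0"
    "eventually (\<lambda>n. \<bar>D * X n + \<delta> x0 * (LINT x|M. I n x * (Gy x \<bullet> e)) + E n\<bar> \<le> \<kappa> * sqrt (q^2) * (s n)^2) sequentially"
    by (rule X_defect_bound[OF zero_less_power[OF q(1), of 2], folded D_def \<kappa>_def]) (rule that)
  have "eventually (\<lambda>n. norm (E n / (s n)^2) < \<eta> / 2) sequentially"
    using order_tendstoD(2)[OF tendsto_norm_zero[OF E(1)], of "\<eta> / 2"] \<eta> by simp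
  with E(2) have "eventually (\<lambda>n. norm (D * (X n / (s n)^2) + \<delta> x0 * ((LINT x|M. I n x * (Gy x \<bullet> e)) / (s n)^2) - 0) < \<eta>) sequentially"
  proof eventually_elim
    case (elim n)
    have sp: "(s n)^2 > 0" using s0[of n] by simp
    define J where "J = (LINT x|M. I n x * (Gy x \<bullet> e))"
    have "\<bar>(D * X n + \<delta> x0 * J + E n) / (s n)^2\<bar> \<le> \<kappa> * q"
      using elim(1) sp q(1) by (simp add: J_def divide_le_eq)
    moreover have "(D * X n + \<delta> x0 * J + E n) / (s n)^2 = (D * (X n / (s n)^2) + \<delta> x0 * (J / (s n)^2)) + E n / (s n)^2"
      by (simp add: add_divide_distrib)
    moreover have "t = A + B \<Longrightarrow> \<bar>t\<bar> \<le> z \<Longrightarrow> \<bar>B\<bar> < \<eta> / 2 \<Longrightarrow> z < \<eta> / 2 \<Longrightarrow> \<bar>A\<bar> < \<eta>" for t A B z :: real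
      by linarith
    ultimately show ?case using elim(2) q(2) unfolding J_def[symmetric] real_norm_def diff_0_right by metis
  qed
  then show "\<exists>N. \<forall>n\<ge>N. norm (D * (X n / (s n)^2) + \<delta> x0 * ((LINT x|M. I n x * (Gy x \<bullet> e)) / (s n)^2) - 0) < \<eta>"
    by (simp add: eventually_sequentially)
qed

lemma X_tendsto: "(\<lambda>n. X n / (s n)^2) \<longlonglongrightarrow> - (\<delta> x0 * (v * (Gy x0 \<bullet> e)) / D)"
proof -
  have "(\<lambda>n. ((D * (X n / (s n)^2) + \<delta> x0 * ((LINT x|M. I n x * (Gy x \<bullet> e)) / (s n)^2))
      - \<delta> x0 * ((LINT x|M. I n x * (Gy x \<bullet> e)) / (s n)^2)) / D) \<longlonglongrightarrow> (0 - \<delta> x0 * (v * (Gy x0 \<bullet> e))) / D"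
    using D_pos by (intro tendsto_intros defect_tendsto mean_Gy_tendsto) simp
  then show ?thesis using D_pos by simp
qed

text \<open>Three reductions: \<open>Gp\<close> is replaced by its value at the Lebesgue point,
  \<delta> is frozen at x0, and \<open>Gs n\<close> splits into \<open>Gy\<close> and
  \<open>W n\<close>, whose means are both known.\<close>

lemma core_tendsto:
  "(\<lambda>n. (LINT x|M. I n x * \<delta> x * (Gs n x \<bullet> Gp x)) / (s n)^2) \<longlonglongrightarrow> v * ((Gy x0 \<bullet> e) * (a x0 * real DIM('a) / D) * \<delta> x0)"
proof -
  define Z where "Z n = (LINT x|M. I n x * \<delta> x * (Gs n x \<bullet> (Gp x - e)))" for n
  define Y where "Y n = (LINT x|M. (a x - a x0) * (Gs n x \<bullet> (I n x *\<^sub>R e)))" for n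
  define J where "J n = (LINT x|M. I n x * (Gy x \<bullet> e))" for n
  have P: "L2v M (\<lambda>x. Gp x - e)" by (rule L2v_diff[OF HL(6) constL])
  have lZ: "(\<lambda>n. Z n / (s n)^2) \<longlonglongrightarrow> 0"
  proof (rule square_product_tendsto[OF s0 _ lim_scaled_1[OF LP]])
    show "\<bar>Z n\<bar> \<le> (K * C2) * s n * sqrt (l2sq M (\<lambda>z. I n z *\<^sub>R (Gp z - Gp x0)))" for n
    proof -
      have "\<bar>Z n\<bar> \<le> K * sqrt (l2sq M (\<lambda>x. I n x *\<^sub>R Gs n x)) * sqrt (l2sq M (\<lambda>z. I n z *\<^sub>R (Gp z - e)))"
        unfolding Z_def by (rule Id_bound[OF HL(7) P])
      also have "\<dots> \<le> K * (C2 * s n) * sqrt (l2sq M (\<lambda>z. I n z *\<^sub>R (Gp z - e)))"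
        using K(1) by (intro mult_right_mono mult_left_mono IGs_bound) auto
      finally show ?thesis by (simp add: mult_ac e_def)
    qed
  qed
  have lY: "(\<lambda>n. Y n / (s n)^2) \<longlonglongrightarrow> 0"
    unfolding Y_def by (rule osc_ball_tendsto[OF HL(7) IGs_bound])
  have split: "(LINT x|M. I n x * \<delta> x * (Gs n x \<bullet> Gp x)) / (s n)^2
     = Z n / (s n)^2 - Y n / (s n)^2 + \<delta> x0 * (J n / (s n)^2 + X n / (s n)^2)" for n
  proof -
    have i1: "integrable M (\<lambda>x. I n x * \<delta> x * (Gs n x \<bullet> (Gp x - e)))" by (rule L2v_weighted_integrable[OF Idb HL(7) P])
    have i2: "integrable M (\<lambda>x. I n x * \<delta> x * (Gs n x \<bullet> e))" by (rule L2v_weighted_integrable[OF Idb HL(7) constL])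
    have "(LINT x|M. I n x * \<delta> x * (Gs n x \<bullet> Gp x)) = (LINT x|M. I n x * \<delta> x * (Gs n x \<bullet> (Gp x - e)) + I n x * \<delta> x * (Gs n x \<bullet> e))"
      by (intro Bochner_Integration.integral_cong) (auto simp: inner_diff_right algebra_simps)
    also have "\<dots> = Z n + (LINT x|M. I n x * \<delta> x * (Gs n x \<bullet> e))"
      unfolding Z_def by (rule Bochner_Integration.integral_add[OF i1 i2])
    also have "(LINT x|M. I n x * \<delta> x * (Gs n x \<bullet> e)) = \<delta> x0 * (LINT x|M. I n x * (Gs n x \<bullet> e)) - Y n"
      unfolding Y_def by (rule delta_split[OF HL(7)])
    also have "(LINT x|M. I n x * (Gs n x \<bullet> e)) = J n + X n"
      using weighted_integral_diff[OF essbdd_ball HL(7) HL(5) constL, of x0 "r n" n e] by (simp add: X_def J_def W_def)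
    finally show ?thesis by (simp add: add_divide_distrib diff_divide_distrib distrib_left)
  qed
  have "(\<lambda>n. Z n / (s n)^2 - Y n / (s n)^2 + \<delta> x0 * (J n / (s n)^2 + X n / (s n)^2)) \<longlonglongrightarrow>
      0 - 0 + \<delta> x0 * (v * (Gy x0 \<bullet> e) + - (\<delta> x0 * (v * (Gy x0 \<bullet> e)) / D))"
    unfolding J_def by (intro tendsto_intros lZ lY mean_Gy_tendsto X_tendsto)
  moreover have "0 - 0 + \<delta> x0 * (v * (Gy x0 \<bullet> e) + - (\<delta> x0 * (v * (Gy x0 \<bullet> e)) / D))
      = v * ((Gy x0 \<bullet> e) * (a x0 * real DIM('a) / D) * \<delta> x0)"
  proof -
    \<comment> \<open>Adding the two means gives the factor 1 - \<delta> x0 / D, which this identity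
      turns into the factor d * a(x0) / D of the formula.\<close>
    have aD: "a x0 * real DIM('a) = D - \<delta> x0" by (simp add: D_def)
    show ?thesis unfolding aD using D_pos by (simp add: field_simps)
  qed
  ultimately show ?thesis unfolding split by simp
qed

text \<open>The coefficient is scalar, so state and adjoint share one symmetric bilinear form: the
  adjoint equation is tested with \<open>w n\<close>, the equation of \<open>w n\<close> with
  \<open>p\<close>, and the identity is exact.\<close>

lemma J_difference:
  "Jfun \<Omega> f yd (an n) - Jfun \<Omega> f yd a = - (LINT x|M. I n x * \<delta> x * (Gs n x \<bullet> Gp x)) + l2sq M (w n) / 2"
proof -
  have ysn: "weak_sol \<Omega> (an n) f (ys n) (Gs n)" using ys[of n] by (simp add: an_def[abs_def] \<delta>_def)
  have ydL: "L2v M yd" using yd by (simp add: L2_iff_L2v)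
  have dL: "L2v M (\<lambda>x. y x - yd x)" by (rule L2v_diff[OF HL(1) ydL])
  have "l2sq M (\<lambda>x. ys n x - yd x) = l2sq M (\<lambda>x. (y x - yd x) + 1 *\<^sub>R w n x)" by (simp add: w_def algebra_simps)
  also have "\<dots> = l2sq M (\<lambda>x. y x - yd x) + 2 * (LINT x|M. (y x - yd x) \<bullet> w n x) + l2sq M (w n)"
    by (subst l2sq_expand[OF dL HL(4)]) simp
  finally have 1: "l2sq M (\<lambda>x. ys n x - yd x) = l2sq M (\<lambda>x. y x - yd x) + 2 * (LINT x|M. (y x - yd x) * w n x) + l2sq M (w n)"
    by simp
  have "(LINT x|M. (y x - yd x) * w n x) = (LINT x|M. a x * (Gp x \<bullet> W n x))"
    using p H(4)[of n] unfolding weak_sol_def by auto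
  also have "\<dots> = - (LINT x|M. I n x * \<delta> x * (Gs n x \<bullet> Gp x))"
    using w_eq(2)[OF H(2), of n] by (simp add: inner_commute)
  finally show ?thesis
    unfolding Jfun_eq[OF an_adm \<alpha> yd ysn] Jfun_eq[OF adm \<alpha> yd y] 1 by (simp add: field_simps)
qed

lemma J_quotient_tendsto:
  "(\<lambda>n. (Jfun \<Omega> f yd (an n) - Jfun \<Omega> f yd a) / (r n ^ DIM('a) * measure lebesgue (ball (0::'a) 1))) \<longlonglongrightarrow>
     - (Gy x0 \<bullet> Gp x0) * (a x0 * real DIM('a) / (b + a x0 * (real DIM('a) - 1))) * (b - a x0)"
proof -
  have "(\<lambda>n. (- ((LINT x|M. I n x * \<delta> x * (Gs n x \<bullet> Gp x)) / (s n)^2) + (l2sq M (w n) / (s n)^2) / 2) / v) \<longlonglongrightarrow>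
      (- (v * ((Gy x0 \<bullet> e) * (a x0 * real DIM('a) / D) * \<delta> x0)) + 0 / 2) / v"
    using v0 by (intro tendsto_intros core_tendsto w_small) auto
  moreover have "(- ((LINT x|M. I n x * \<delta> x * (Gs n x \<bullet> Gp x)) / (s n)^2) + (l2sq M (w n) / (s n)^2) / 2) / v
     = (Jfun \<Omega> f yd (an n) - Jfun \<Omega> f yd a) / (r n ^ DIM('a) * measure lebesgue (ball (0::'a) 1))" for n
    unfolding J_difference v_def[symmetric] s_sq[symmetric] using v0 s0[of n] by (simp add: field_simps)
  moreover have "D = b + a x0 * (real DIM('a) - 1)" by (simp add: D_def \<delta>_def algebra_simps)
  ultimately show ?thesis using v0 by (simp add: e_def \<delta>_def)
qed

end

section \<open>From sequences of radii to the one-sided limit at almost every point\<close>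

theorem mainTheorem11:
  fixes \<Omega> :: "'a::euclidean_space set"
    and \<alpha> b :: real and a f yd y p :: "'a \<Rightarrow> real" and Gy Gp :: "'a \<Rightarrow> 'a"
  assumes "open \<Omega>" and "connected \<Omega>" and "\<Omega> \<noteq> {}" and "bounded \<Omega>"
    and "\<alpha> > 0"
    and "L2 \<Omega> yd" and "L2 \<Omega> f"
    and "admissible \<Omega> \<alpha> a"
    and "b \<ge> \<alpha>"
    and "weak_sol \<Omega> a f y Gy"
    and "weak_sol \<Omega> a (\<lambda>x. y x - yd x) p Gp"
  shows "AE x0 in lebesgue_on \<Omega>.
    ((\<lambda>r. (Jfun \<Omega> f yd (pert a b x0 (ball 0 1) r) - Jfun \<Omega> f yd a)
           / (r ^ DIM('a) * measure lebesgue (ball (0::'a) 1)))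
     \<longlongrightarrow> - (Gy x0 \<bullet> Gp x0) * (a x0 * real DIM('a) / (b + a x0 * (real DIM('a) - 1)))
           * (b - a x0)) (at_right 0)"
proof -
  interpret bounded_open_set \<Omega> by unfold_locales (use assms in auto)
  have yH: "L2v M Gy" and pH: "L2v M Gp" using assms(10,11) H10_L2v(2) by (auto simp: weak_sol_def)
  have ab: "essbdd M a" by (rule admissible_essbdd[OF assms(8)])
  have aL: "L2v M a" using L2v_scale[OF ab L2v_const[OF finite_M, of "1::real"]] by simp
  have pos: "AE x0 in M. \<alpha> \<le> a x0" using assms(8) by (simp add: admissible_def)
  have inO: "AE x0 in M. x0 \<in> \<Omega>" by (rule AE_I2) (simp add: space_restrict_space)
  show ?thesis
    using L2_lebesgue_points[OF yH] L2_lebesgue_points[OF pH] L2_lebesgue_points[OF aL] pos inO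
  proof eventually_elim
    case (elim x0)
    note LY = elim(1) and LP = elim(2) and LA = elim(3) and ax0 = elim(4) and x0 = elim(5)
    have pert_eq: "pert a b x0 (ball 0 1) r = (\<lambda>x. a x + indicator (ball x0 r) x * (b - a x))" if "r > 0" for r
    proof -
      have "(\<lambda>z. x0 + r *\<^sub>R z) ` ball 0 1 = (+) x0 ` ((*\<^sub>R) r ` ball 0 1)" by (simp add: image_image)
      also have "(*\<^sub>R) r ` ball 0 1 = ball (0::'a) r" using ball_scale[of r "0::'a" 1] that by simp
      also have "(+) x0 ` ball 0 r = ball x0 r" by (simp add: image_add_ball)
      finally show ?thesis by (simp add: pert_def)
    qed
    obtain d1 where d1: "d1 > 0" "ball x0 d1 \<subseteq> \<Omega>" using open_Om x0 open_contains_ball by blast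
    \<comment> \<open>Provides the radius below which \<open>LYb\<close> holds, by comparing the
      limit 0 with 1.\<close>
    have "eventually (\<lambda>r. l2sq M (\<lambda>z. indicator (ball x0 r) z *\<^sub>R (Gy z - Gy x0)) / r ^ DIM('a) < 1) (at_right 0)"
      by (rule order_tendstoD(2)[OF LY]) simp
    then obtain d2 where d2: "d2 > 0" "\<And>r. 0 < r \<Longrightarrow> r < d2 \<Longrightarrow> l2sq M (\<lambda>z. indicator (ball x0 r) z *\<^sub>R (Gy z - Gy x0)) / r ^ DIM('a) < 1"
      unfolding eventually_at_right_field by blast
    show ?case
    \<comment> \<open>Only sequences staying below both thresholds have to be considered, so the
      uniform assumptions of \<open>blowup\<close> hold from the first index on.\<close>
    proof (rule tendsto_at_right_sequentially[of 0 "min d1 d2"])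
      show "0 < min d1 d2" using d1 d2 by simp
      fix r :: "nat \<Rightarrow> real"
      assume r: "\<And>n. 0 < r n" "\<And>n. r n < min d1 d2" "r \<longlonglongrightarrow> 0"
      define c where "c n x = a x + indicator (ball x0 (r n)) x * (b - a x)" for n x
      have cadm: "admissible \<Omega> \<alpha> (c n)" for n
      proof -
        have "essbdd M (\<lambda>x. b - a x)"
          using essbdd_add[OF essbdd_const[of M b] essbdd_mult[OF essbdd_const[of M "-1"] ab]] by simp
        then have "essbdd M (c n)" unfolding c_def[abs_def] by (intro essbdd_add ab essbdd_mult essbdd_ball)
        moreover have "AE x in M. \<alpha> \<le> c n x"
          using pos by eventually_elim (use assms(9) in \<open>auto simp: c_def split: split_indicator\<close>)
        ultimately show ?thesis by (auto simp: admissible_def essbdd_def)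
      qed
      have "\<exists>u G. weak_sol \<Omega> (c n) f u G" for n
        using weak_sol_exists[OF cadm assms(5,7)] by blast
      then obtain ys Gs where ys: "\<And>n. weak_sol \<Omega> (c n) f (ys n) (Gs n)" by metis
      interpret blowup \<Omega> \<alpha> b a f yd y p Gy Gp x0 r ys Gs
      proof
        show "\<alpha> > 0" "L2 \<Omega> yd" "admissible \<Omega> \<alpha> a" "b \<ge> \<alpha>" "weak_sol \<Omega> a f y Gy"
          "weak_sol \<Omega> a (\<lambda>x. y x - yd x) p Gp" by fact+
        show "weak_sol \<Omega> (\<lambda>x. a x + indicator (ball x0 (r n)) x * (b - a x)) f (ys n) (Gs n)" for n
          using ys[of n] by (simp add: c_def[abs_def])
        show "ball x0 (r n) \<subseteq> \<Omega>" for n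
          using d1(2) r(2)[of n] by (meson less_imp_le min_less_iff_conj order_trans subset_ball)
        show "l2sq M (\<lambda>z. indicator (ball x0 (r n)) z *\<^sub>R (Gy z - Gy x0)) / r n ^ DIM('a) \<le> 1" for n
          using d2(2)[of "r n"] r(1,2)[of n] by simp
      qed (use r x0 ax0 LY LP LA in auto)
      have "pert a b x0 (ball 0 1) (r n) = an n" for n
        by (simp add: pert_eq[OF r(1)] an_def[abs_def] \<delta>_def)
      then show "(\<lambda>n. (Jfun \<Omega> f yd (pert a b x0 (ball 0 1) (r n)) - Jfun \<Omega> f yd a)
           / (r n ^ DIM('a) * measure lebesgue (ball (0::'a) 1)))
         \<longlonglongrightarrow> - (Gy x0 \<bullet> Gp x0) * (a x0 * real DIM('a) / (b + a x0 * (real DIM('a) - 1))) * (b - a x0)"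
        using J_quotient_tendsto by simp
    qed
  qed
qed

end
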